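(* Let $d\ge2$ and $\vartheta>d+1$. Let $u(x,t)$ be a (mild) solution of the Navier--Stokes system (NS) on $\mathbb{R}_+\times\mathbb{R}^d$ with divergence-free initial datum $a\in L^\infty_\vartheta(\mathbb{R}^d)$, such that for some constant $C_0$, $$|u(x,t)|\le C_0\,(1+|x|)^{-\alpha}\,(1+t)^{-\beta/2}$$ for any $\alpha,\beta\ge0$ such that $\alpha+\beta\le d+1$. Let $$\Pi(x,t)=\gamma_d\sum_{h,k=1}^d\left(\frac{\delta_{h,k}}{d\,|x|^d}-\frac{x_hx_k}{|x|^{d+2}}\right)\int_0^t\int_{\mathbb{R}^d}(u_hu_k)(y,s)\,dy\,ds,\qquad \gamma_d=\pi^{-d/2}\,\Gamma\left(\tfrac{d+2}{2}\right),$$ and assume that $\nabla\Pi_\infty(x):=\lim_{t\to\infty}\nabla\Pi(x,t)$ (which is well defined) is not identically zero. Then there exist $t_0>0$ and a constant $c>0$ such that, for all $1\le p<\infty$ and $\alpha\ge0$ satisfying $\alpha+\frac dp<d+1$, and for all $t\ge t_0$, $$\|u(t)\|_{L^p_\alpha}\ge c\,t^{-\frac12\left(d+1-\alpha-\frac dp\right)}.$$ Moreover, for all $0\le\alpha\le d+1$ and all $t\ge t_0$, $$\|u(t)\|_{L^\infty_\alpha}\ge c\,t^{-\frac12(d+1-\alpha)}.$$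
   Context: (NS) is the system on $\mathbb{R}^d$: $\partial_t u-\Delta u+(u\cdot\nabla)u=-\nabla p$, $\operatorname{div}u=0$, $u(x,0)=a(x)$, understood in the mild sense $u(t)=e^{t\Delta}a-\int_0^te^{(t-s)\Delta}\mathbb{P}\operatorname{div}(u\otimes u)(s)\,ds$ with $\mathbb{P}f=f-\nabla\Delta^{-1}(\operatorname{div}f)$. Norms: $\|f\|_{L^p_\alpha}=\left(\int_{\mathbb{R}^d}|f(x)|^p(1+|x|)^{p\alpha}\,dx\right)^{1/p}$ for $1\le p<\infty$, and $\|f\|_{L^\infty_\alpha}=\operatorname{ess\,sup}_x(1+|x|)^\alpha|f(x)|$; $L^\infty_\vartheta$ is the space of measurable $f$ with $\|f\|_{L^\infty_\vartheta}<\infty$. $\delta_{h,k}$ is the Kronecker symbol and $\nabla$ is the gradient in $x$ (on $x\ne0$). *)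

theory Defs
  imports "HOL-Probability.Essential_Supremum"
begin

section \<open>Weighted Lebesgue norms\<close>

text \<open>Both norms take the value \<open>\<infinity>\<close> outside the corresponding space.\<close>

definition wLp_norm :: "real \<Rightarrow> real \<Rightarrow> (real ^ 'n \<Rightarrow> real ^ 'n) \<Rightarrow> ennreal" where
  "wLp_norm p \<alpha> f =
     (let I = (\<integral>\<^sup>+ x. ennreal (norm (f x) powr p * (1 + norm x) powr (p * \<alpha>)) \<partial>lebesgue)
      in if I = \<infinity> then \<infinity> else ennreal (enn2real I powr (1 / p)))"

definition wLinf_norm :: "real \<Rightarrow> (real ^ 'n \<Rightarrow> real ^ 'n) \<Rightarrow> ennreal" where
  "wLinf_norm \<alpha> f = esssup lebesgue (\<lambda>x. ennreal ((1 + norm x) powr \<alpha> * norm (f x)))"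

definition wLinf :: "real \<Rightarrow> (real ^ 'n \<Rightarrow> real ^ 'n) set" where
  "wLinf \<alpha> = {f. f \<in> borel_measurable lebesgue \<and> wLinf_norm \<alpha> f < \<infinity>}"


section \<open>Gradient and distributional divergence\<close>

definition partial :: "'n \<Rightarrow> (real ^ 'n \<Rightarrow> real) \<Rightarrow> real ^ 'n \<Rightarrow> real" where
  "partial i f x = frechet_derivative f (at x) (axis i 1)"

definition gradient :: "(real ^ 'n \<Rightarrow> real) \<Rightarrow> real ^ 'n \<Rightarrow> real ^ 'n" where
  "gradient f x = (\<chi> i. partial i f x)"

primrec Ck :: "nat \<Rightarrow> (real ^ 'n \<Rightarrow> real) \<Rightarrow> bool" where
  "Ck 0 f \<longleftrightarrow> continuous_on UNIV f"
| "Ck (Suc k) f \<longleftrightarrow> f differentiable_on UNIV \<and> (\<forall>i. Ck k (partial i f))"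

definition test_function :: "(real ^ 'n \<Rightarrow> real) \<Rightarrow> bool" where
  "test_function \<phi> \<longleftrightarrow> (\<forall>k. Ck k \<phi>) \<and> compact (closure {x. \<phi> x \<noteq> 0})"

text \<open>\<open>div a = 0\<close> in the sense of distributions.\<close>

definition divergence_free :: "(real ^ 'n \<Rightarrow> real ^ 'n) \<Rightarrow> bool" where
  "divergence_free a \<longleftrightarrow>
     (\<forall>\<phi>. test_function \<phi> \<longrightarrow> (LINT x|lebesgue. a x \<bullet> gradient \<phi> x) = 0)"


section \<open>Mild solutions of the Navier--Stokes system\<close>

text \<open>The operators \<open>exp (t \<Delta>)\<close>, \<open>P = Id - \<nabla> \<Delta>\<^sup>-\<^sup>1 div\<close> and \<open>div\<close> of the mild formulation are
  Fourier multipliers. Each symbol below is composed from the symbol \<open>i \<xi>\<^sub>j\<close> of \<open>\<partial>\<^sub>j\<close> exactly as the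
  operator is composed from the \<open>\<partial>\<^sub>j\<close>. The value given to the symbol of \<open>\<Delta>\<^sup>-\<^sup>1\<close> at the single point
  \<open>\<xi> = 0\<close> is immaterial.\<close>

definition fourier :: "(real ^ 'n \<Rightarrow> complex) \<Rightarrow> real ^ 'n \<Rightarrow> complex" where
  "fourier f \<xi> = (LINT x|lebesgue. cis (- (x \<bullet> \<xi>)) * f x)"

definition inv_fourier :: "(real ^ 'n \<Rightarrow> complex) \<Rightarrow> real ^ 'n \<Rightarrow> complex" where
  "inv_fourier g x =
     of_real (1 / (2 * pi) ^ CARD('n)) * (LINT \<xi>|lebesgue. cis (x \<bullet> \<xi>) * g \<xi>)"

definition multiplier ::
  "(real ^ 'n \<Rightarrow> complex) \<Rightarrow> (real ^ 'n \<Rightarrow> real) \<Rightarrow> real ^ 'n \<Rightarrow> complex" where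
  "multiplier m f = inv_fourier (\<lambda>\<xi>. m \<xi> * fourier (\<lambda>x. of_real (f x)) \<xi>)"

definition sym_deriv :: "'n \<Rightarrow> real ^ 'n \<Rightarrow> complex" where
  "sym_deriv j \<xi> = \<i> * of_real (\<xi> $ j)"

definition sym_laplace :: "real ^ 'n \<Rightarrow> complex" where
  "sym_laplace \<xi> = (\<Sum>j\<in>UNIV. sym_deriv j \<xi> * sym_deriv j \<xi>)"

definition sym_heat :: "real \<Rightarrow> real ^ 'n \<Rightarrow> complex" where
  "sym_heat t \<xi> = exp (of_real t * sym_laplace \<xi>)"

definition sym_leray :: "'n \<Rightarrow> 'n \<Rightarrow> real ^ 'n \<Rightarrow> complex" where
  "sym_leray j k \<xi> =
     (if j = k then 1 else 0) - sym_deriv j \<xi> * inverse (sym_laplace \<xi>) * sym_deriv k \<xi>"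

definition heat :: "real \<Rightarrow> (real ^ 'n \<Rightarrow> real ^ 'n) \<Rightarrow> real ^ 'n \<Rightarrow> 'n \<Rightarrow> complex" where
  "heat t a x j = multiplier (sym_heat t) (\<lambda>y. a y $ j) x"

text \<open>The \<open>j\<close>-th component of \<open>exp (t \<Delta>) P div (v \<otimes> v)\<close>, where
  \<open>(div (v \<otimes> v))\<^sub>k = \<Sum>\<^sub>h \<partial>\<^sub>h (v\<^sub>h v\<^sub>k)\<close>.\<close>

definition heat_leray_div ::
  "real \<Rightarrow> (real ^ 'n \<Rightarrow> real ^ 'n) \<Rightarrow> real ^ 'n \<Rightarrow> 'n \<Rightarrow> complex" where
  "heat_leray_div t v x j =
     (\<Sum>k\<in>UNIV. \<Sum>h\<in>UNIV.
        multiplier (\<lambda>\<xi>. sym_heat t \<xi> * sym_leray j k \<xi> * sym_deriv h \<xi>)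
          (\<lambda>y. v y $ h * v y $ k) x)"

text \<open>\<open>u t x\<close> is the velocity at time \<open>t\<close> and position \<open>x\<close>; functions are identified when equal
  almost everywhere. The integrals converge absolutely when \<open>a\<close> is integrable and
  \<open>|u t x| \<le> C (1 + |x|) powr (-(d + 1))\<close>. At \<open>t = 0\<close> the mild equation reads \<open>u 0 = a\<close>.\<close>

definition mild_solution ::
  "(real ^ 'n \<Rightarrow> real ^ 'n) \<Rightarrow> (real \<Rightarrow> real ^ 'n \<Rightarrow> real ^ 'n) \<Rightarrow> bool" where
  "mild_solution a u \<longleftrightarrow>
     (\<lambda>(t, x). u t x) \<in> borel_measurable (lebesgue_on ({0..} \<times> UNIV)) \<and>
     (\<forall>t\<ge>0. u t \<in> borel_measurable lebesgue) \<and>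
     (AE x in lebesgue. u 0 x = a x) \<and>
     (\<forall>t>0. AE x in lebesgue. \<forall>j.
        complex_of_real (u t x $ j) =
          heat t a x j - (LINT s:{0..t}|lebesgue. heat_leray_div (t - s) (u s) x j))"


section \<open>The asymptotic profile\<close>

definition gamma_const :: "nat \<Rightarrow> real" where
  "gamma_const d = pi powr (- real d / 2) * Gamma ((real d + 2) / 2)"

definition Pi_profile :: "(real \<Rightarrow> real ^ 'n \<Rightarrow> real ^ 'n) \<Rightarrow> real ^ 'n \<Rightarrow> real \<Rightarrow> real" where
  "Pi_profile u x t =
     gamma_const CARD('n) *
     (\<Sum>h\<in>UNIV. \<Sum>k\<in>UNIV.
        ((if h = k then 1 else 0) / (real CARD('n) * norm x ^ CARD('n))
           - x $ h * x $ k / norm x ^ (CARD('n) + 2)) *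
        (LINT s:{0..t}|lebesgue. (LINT y|lebesgue. u s y $ h * u s y $ k)))"

definition grad_Pi_inf :: "(real \<Rightarrow> real ^ 'n \<Rightarrow> real ^ 'n) \<Rightarrow> real ^ 'n \<Rightarrow> real ^ 'n" where
  "grad_Pi_inf u x = Lim at_top (\<lambda>t. gradient (\<lambda>y. Pi_profile u y t) x)"

end

theory Submission
  imports Defs "HOL-Probability.Probability"
begin

text \<open>
  Test \<open>u t\<close> against \<open>\<phi> (x / sqrt t)\<close>, where \<open>\<phi> y = (y\<^sub>a + i y\<^sub>b)\<^sup>3 exp (- |y|\<^sup>2 / 2)\<close>. The cubic factor is
  harmonic, so \<open>\<phi>\<close> annihilates the constant and linear Taylor terms of the Fourier transform of
  \<open>a\<close> and the heat part contributes \<open>o (t powr (- 1 / 2))\<close>. In the Duhamel term the rescaled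
  transform of \<open>u\<^sub>h u\<^sub>k\<close> tends to its value at the origin, so \<open>sqrt t\<close> times the tested integral
  tends to a nonzero multiple of \<open>\<lambda>\<^sub>a\<^sub>a - \<lambda>\<^sub>b\<^sub>b + 2 i \<lambda>\<^sub>a\<^sub>b\<close>, where \<open>\<lambda>\<^sub>h\<^sub>k\<close> is the space-time integral
  of \<open>u\<^sub>h u\<^sub>k\<close>. A nonzero \<open>\<nabla>\<Pi>\<^sub>\<infinity>\<close> means that \<open>\<lambda>\<close> is not a scalar matrix, so this is nonzero for some
  \<open>a \<noteq> b\<close>. The a priori bounds make the regions \<open>|x| < \<epsilon> sqrt t\<close> and \<open>|x| > sqrt t / \<epsilon>\<close> negligible,
  hence \<open>u t\<close> has \<open>L\<^sup>1\<close> mass at least \<open>c / sqrt t\<close> on the annulus between them, and Hoelder's inequality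
  there gives all the norm bounds with one constant.
\<close>

section \<open>Gaussian integrals and Fourier transforms\<close>

text \<open>Why degree three: in component \<open>a\<close>, the symbol of the projected divergence
  is the local part \<delta>(a,k) \<xi>(h), of spherical-harmonic degree one, minus the nonlocal
  part \<xi>(a) \<xi>(h) \<xi>(k) / |\<xi>|^2, whose restriction to the sphere has degrees one and
  three. The pressure is visible only in degree three, and a harmonic cubic selects it while being
  orthogonal to everything of degree one. A harmonic cubic times a Gaussian is moreover an
  eigenfunction of the Fourier transform, so the same cubic appears on both sides of the pairing.
  Orthogonality is obtained from invariance of the integrals under rotations of one coordinate
  plane, with no theory of spherical harmonics. The delicate point of the last stage is scale: the
  time and space bounds both produce errors of order \<open>1 / sqrt t\<close>, the order of the
  main term itself. Only the smallness of \<epsilon> separates them, so \<epsilon> is fixed from the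
  limit before \<open>t\<close> becomes large. The final constant must serve all p and \<alpha> at
  once; losses are therefore estimated by powers whose exponents stay in a bounded range.\<close>

text \<open>\<open>lborel\<close> is built as a product over \<open>Basis\<close>, while coordinates
  are indexed by the type \<open>'n\<close>; the injection \<open>axis\<close> translates one
  indexing into the other.\<close>

lemma prod_vec_as_Basis:
  fixes f :: "'n::finite \<Rightarrow> real \<Rightarrow> 'b::comm_monoid_mult" and x :: "real ^ 'n"
  shows "(\<Prod>i\<in>UNIV. f i (x $ i)) =
    (\<Prod>b\<in>Basis. f (inv (\<lambda>i. axis i (1::real)) b) (x \<bullet> b))"
proof -
  have inj: "inj (\<lambda>i::'n. axis i (1::real))"
    by (auto simp: inj_on_def axis_eq_axis)
  have B: "(Basis :: (real ^ 'n) set) = range (\<lambda>i. axis i 1)"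
    by (auto simp: Basis_vec_def)
  show ?thesis
    unfolding B by (subst prod.reindex[OF inj]) (simp add: inv_f_f[OF inj] inner_axis)
qed

lemma
  fixes f :: "'n::finite \<Rightarrow> real \<Rightarrow> complex"
  assumes f: "\<And>i. integrable lborel (f i)"
  shows integrable_lborel_vec_prod: "integrable lborel (\<lambda>x::real ^ 'n. \<Prod>i\<in>UNIV. f i (x $ i))"
    and integral_lborel_vec_prod:
      "(LINT x|lborel. (\<Prod>i\<in>UNIV. f i ((x::real ^ 'n) $ i))) = (\<Prod>i\<in>UNIV. LINT x|lborel. f i x)"
proof -
  let ?g = "\<lambda>b::real ^ 'n. f (inv (\<lambda>i. axis i (1::real)) b)"
  interpret product_sigma_finite "\<lambda>_::real ^ 'n. lborel :: real measure" ..
  have [measurable]: "f i \<in> borel_measurable borel" for i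
    using borel_measurable_integrable[OF f[of i]] by simp
  have inner: "(\<Sum>b\<in>Basis. x b *\<^sub>R b) \<bullet> c = x c" if "c \<in> Basis" for x and c :: "real ^ 'n"
    using that by (simp add: inner_sum_left inner_Basis if_distrib cong: if_cong)
  have eq: "(\<Prod>b\<in>Basis. ?g b ((\<Sum>b\<in>Basis. x b *\<^sub>R b) \<bullet> b)) = (\<Prod>b\<in>Basis. ?g b (x b))" for x
    by (intro prod.cong) (simp_all add: inner)
  have m: "(\<lambda>x::real ^ 'n. \<Prod>b\<in>Basis. ?g b (x \<bullet> b)) \<in> borel_measurable borel"
    by measurable
  have i: "integrable (\<Pi>\<^sub>M b\<in>(Basis :: (real ^ 'n) set). lborel) (\<lambda>x. \<Prod>b\<in>Basis. ?g b (x b))"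
    by (intro product_integrable_prod f) auto
  show "integrable lborel (\<lambda>x::real ^ 'n. \<Prod>i\<in>UNIV. f i (x $ i))"
    unfolding prod_vec_as_Basis
    by (subst lborel_eq, subst integrable_distr_eq[OF _ m]) (use i in \<open>simp_all add: eq\<close>)
  have "(LINT x|lborel. (\<Prod>i\<in>UNIV. f i ((x::real ^ 'n) $ i))) = (\<Prod>b\<in>Basis. integral\<^sup>L lborel (?g b))"
  proof -
    have "(LINT x|lborel. (\<Prod>i\<in>UNIV. f i ((x::real ^ 'n) $ i))) =
        (LINT x|distr (\<Pi>\<^sub>M b\<in>Basis. lborel) borel (\<lambda>f. \<Sum>b\<in>Basis. f b *\<^sub>R b). (\<Prod>b\<in>Basis. ?g b (x \<bullet> b)))"
      unfolding prod_vec_as_Basis lborel_eq[symmetric] ..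
    also have "\<dots> = (LINT x|(\<Pi>\<^sub>M b\<in>(Basis :: (real ^ 'n) set). lborel). (\<Prod>b\<in>Basis. ?g b (x b)))"
      by (subst integral_distr[OF _ m]) (simp_all add: eq)
    also have "\<dots> = (\<Prod>b\<in>Basis. integral\<^sup>L lborel (?g b))"
      by (rule product_integral_prod) (simp_all add: f)
    finally show ?thesis .
  qed
  also have "\<dots> = (\<Prod>i\<in>UNIV. LINT x|lborel. f i x)"
    using prod_vec_as_Basis[of "\<lambda>i _. LINT x|lborel. f i x" "0 :: real ^ 'n"] by simp
  finally show "(LINT x|lborel. (\<Prod>i\<in>UNIV. f i ((x::real ^ 'n) $ i))) = (\<Prod>i\<in>UNIV. LINT x|lborel. f i x)" .
qed

section \<open>One-dimensional Gaussian moments with an oscillating factor\<close>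

lemma integrable_gaussian_moment_cis:
  "integrable lborel (\<lambda>x::real. of_real x ^ p * cis (x * \<xi>) * of_real (exp (- x\<^sup>2 / 2)))"
proof -
  have "integrable lborel (\<lambda>x. std_normal_density x * \<bar>x\<bar> ^ p)"
    by (rule integrable_std_normal_moment_abs)
  then have "integrable lborel (\<lambda>x. sqrt (2 * pi) * (std_normal_density x * \<bar>x\<bar> ^ p))"
    by simp
  then show ?thesis
  proof (rule Bochner_Integration.integrable_bound)
    show "(\<lambda>x::real. of_real x ^ p * cis (x * \<xi>) * of_real (exp (- x\<^sup>2 / 2))) \<in> borel_measurable lborel"
      unfolding cis_conv_exp by measurable
  qed (simp add: norm_mult norm_power std_normal_density_def abs_mult)
qed

text \<open>Up to the factor \<open>(- \<i>) ^ p\<close> this is the p-th derivative of the Fourier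
  transform of the Gaussian, hence a Hermite-type polynomial times the Gaussian.\<close>

definition gauss_mom :: "nat \<Rightarrow> real \<Rightarrow> complex" where
  "gauss_mom p \<xi> = (LINT x|lborel. of_real x ^ p * cis (x * \<xi>) * of_real (exp (- x\<^sup>2 / 2)))"

lemma gauss_mom_0: "gauss_mom 0 \<xi> = of_real (sqrt (2 * pi) * exp (- \<xi>\<^sup>2 / 2))"
proof -
  have "gauss_mom 0 \<xi> = (LINT x|lborel. of_real (sqrt (2 * pi)) * (std_normal_density x *\<^sub>R iexp (\<xi> * x)))"
    unfolding gauss_mom_def
    by (intro Bochner_Integration.integral_cong refl)
       (simp add: std_normal_density_def cis_conv_exp scaleR_conv_of_real mult_ac)
  also have "\<dots> = of_real (sqrt (2 * pi)) * char std_normal_distribution \<xi>"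
    unfolding char_def by (subst integral_density) (auto simp: normal_density_nonneg simp flip: integral_mult_right_zero)
  finally show ?thesis
    by (simp add: char_std_normal_distribution)
qed

lemma tendsto_power_gaussian:
  shows "((\<lambda>x::real. x ^ p * exp (- x\<^sup>2 / 2)) \<longlongrightarrow> 0) at_top"
    and "((\<lambda>x::real. x ^ p * exp (- x\<^sup>2 / 2)) \<longlongrightarrow> 0) at_bot"
proof -
  show 1: "((\<lambda>x::real. x ^ p * exp (- x\<^sup>2 / 2)) \<longlongrightarrow> 0) at_top"
  proof (rule tendsto_sandwich[OF _ _ tendsto_const tendsto_power_div_exp_0[of p]])
    show "\<forall>\<^sub>F x::real in at_top. 0 \<le> x ^ p * exp (- x\<^sup>2 / 2)"
      using eventually_ge_at_top[of 0] by eventually_elim simp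
    show "\<forall>\<^sub>F x::real in at_top. x ^ p * exp (- x\<^sup>2 / 2) \<le> x ^ p / exp x"
      using eventually_ge_at_top[of 2]
    proof eventually_elim
      case (elim x)
      then have "x * 2 \<le> x * x" by (intro mult_left_mono) auto
      then have "exp (- x\<^sup>2 / 2) \<le> exp (- x)"
        by (simp add: power2_eq_square)
      then have "x ^ p * exp (- x\<^sup>2 / 2) \<le> x ^ p * exp (- x)"
        using elim by (intro mult_left_mono) auto
      then show ?case
        by (simp add: exp_minus inverse_eq_divide)
    qed
  qed
  have "((\<lambda>x::real. (-1) ^ p * (x ^ p * exp (- x\<^sup>2 / 2))) \<longlongrightarrow> (-1) ^ p * 0) at_top"
    by (intro tendsto_intros 1)
  moreover have "(\<lambda>x::real. (- x) ^ p * exp (- (- x)\<^sup>2 / 2)) = (\<lambda>x. (-1) ^ p * (x ^ p * exp (- x\<^sup>2 / 2)))"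
    by (rule ext, subst power_minus) simp
  ultimately show "((\<lambda>x::real. x ^ p * exp (- x\<^sup>2 / 2)) \<longlongrightarrow> 0) at_bot"
    unfolding at_bot_mirror filterlim_filtermap by simp
qed

text \<open>Integration by parts: the integrand \<open>?f\<close> is the derivative of
  \<open>?m p\<close>, which vanishes at both ends. For \<open>p = 0\<close> the truncated index
  \<open>p - 1\<close> is harmless because its coefficient is 0.\<close>

lemma gauss_mom_Suc:
  "gauss_mom (Suc p) \<xi> = of_nat p * gauss_mom (p - 1) \<xi> + \<i> * of_real \<xi> * gauss_mom p \<xi>"
proof -
  let ?m = "\<lambda>p x. of_real x ^ p * cis (x * \<xi>) * of_real (exp (- x\<^sup>2 / 2)) :: complex"
  let ?f = "\<lambda>x. of_nat p * ?m (p - 1) x + \<i> * of_real \<xi> * ?m p x - ?m (Suc p) x"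
  have int: "integrable lborel (?m q)" for q
    by (rule integrable_gaussian_moment_cis)
  have intf: "integrable lborel ?f"
    by (intro Bochner_Integration.integrable_add Bochner_Integration.integrable_diff integrable_mult_right int)
  have lim: "((\<lambda>x. ?m p x) \<longlongrightarrow> 0) F" if "((\<lambda>x::real. x ^ p * exp (- x\<^sup>2 / 2)) \<longlongrightarrow> 0) F" for F
    by (rule tendsto_norm_zero_cancel, rule Lim_transform_eventually[OF tendsto_norm_zero[OF that]])
       (simp add: norm_mult norm_power abs_mult power_abs)
  have "(LBINT x=-\<infinity>..\<infinity>. ?f x) = 0 - 0"
  proof (rule interval_integral_FTC_integrable)
    show "(?m p has_vector_derivative ?f x) (at x)" for x
    proof -
      \<comment> \<open>The entire extension of \<open>?m p\<close> is differentiated with the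
        complex rules and then restricted to the real line.\<close>
      let ?g = "\<lambda>z::complex. z ^ p * exp (\<i> * (z * of_real \<xi>)) * exp (- (z * z) / 2)"
      have eq: "?m p = (\<lambda>x. ?g (of_real x))"
        by (simp add: cis_conv_exp exp_of_real[symmetric] fun_eq_iff power2_eq_square)
      have 1: "((\<lambda>z::complex. exp (- (z * z) / 2)) has_field_derivative exp (- (z * z) / 2) * - z) (at z)" for z
        by (auto intro!: derivative_eq_intros)
      have 2: "((\<lambda>z::complex. exp (\<i> * (z * of_real \<xi>))) has_field_derivative exp (\<i> * (z * of_real \<xi>)) * (\<i> * of_real \<xi>)) (at z)" for z
        by (auto intro!: derivative_eq_intros)
      have "(?g has_field_derivative ?f x) (at (of_real x))"
        using DERIV_mult[OF DERIV_mult[OF DERIV_power[OF DERIV_ident, of p "of_real x :: complex"] 2] 1]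
        by (simp add: cis_conv_exp exp_of_real[symmetric] algebra_simps power2_eq_square)
      then have "((\<lambda>x. ?g (of_real x)) has_vector_derivative ?f x) (at x)"
        by (rule has_vector_derivative_real_field)
      then show ?thesis
        by (simp only: eq)
    qed
    show "isCont ?f x" for x
      unfolding cis_conv_exp by (intro isCont_add isCont_mult isCont_diff isCont_power isCont_of_real isCont_exp continuous_const continuous_ident continuous_minus continuous_divide) simp_all
    show "set_integrable lborel (einterval (- \<infinity>) \<infinity>) ?f"
      using intf by (simp add: set_integrable_def)
    show "((?m p \<circ> real_of_ereal) \<longlongrightarrow> 0) (at_right (- \<infinity>))"
      using lim[OF tendsto_power_gaussian(2)] by (simp add: at_right_MInf o_def filterlim_filtermap)
    show "((?m p \<circ> real_of_ereal) \<longlongrightarrow> 0) (at_left \<infinity>)"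
      using lim[OF tendsto_power_gaussian(1)] by (simp add: at_left_PInf o_def filterlim_filtermap)
  qed simp
  then have "(LINT x|lborel. ?f x) = 0"
    by (simp add: interval_integral_to_infinity_eq interval_lebesgue_integral_def set_lebesgue_integral_def)
  moreover have "(LINT x|lborel. ?f x) = of_nat p * gauss_mom (p - 1) \<xi> + \<i> * of_real \<xi> * gauss_mom p \<xi> - gauss_mom (Suc p) \<xi>"
    unfolding gauss_mom_def using int
    by (subst Bochner_Integration.integral_diff Bochner_Integration.integral_add;
        (intro Bochner_Integration.integrable_add integrable_mult_right int)?; simp)+
  ultimately show ?thesis by simp
qed

lemma gauss_mom_simps:
  shows "gauss_mom 1 \<xi> = \<i> * of_real \<xi> * gauss_mom 0 \<xi>"
    and "gauss_mom 2 \<xi> = (1 - of_real \<xi> ^ 2) * gauss_mom 0 \<xi>"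
    and "gauss_mom 3 \<xi> = (3 * \<i> * of_real \<xi> - \<i> * of_real \<xi> ^ 3) * gauss_mom 0 \<xi>"
proof -
  have i2: "\<i> * (\<i> * z) = - z" for z by (simp flip: mult.assoc)
  show 1: "gauss_mom 1 \<xi> = \<i> * of_real \<xi> * gauss_mom 0 \<xi>"
    using gauss_mom_Suc[of 0 \<xi>] by simp
  show 2: "gauss_mom 2 \<xi> = (1 - of_real \<xi> ^ 2) * gauss_mom 0 \<xi>"
    using gauss_mom_Suc[of 1 \<xi>] 1 by (simp add: eval_nat_numeral algebra_simps i2)
  show "gauss_mom 3 \<xi> = (3 * \<i> * of_real \<xi> - \<i> * of_real \<xi> ^ 3) * gauss_mom 0 \<xi>"
  proof -
    have "gauss_mom 3 \<xi> = 2 * gauss_mom 1 \<xi> + \<i> * of_real \<xi> * gauss_mom 2 \<xi>"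
      using gauss_mom_Suc[of 2 \<xi>] by simp
    also have "\<dots> = (3 * \<i> * of_real \<xi> - \<i> * of_real \<xi> ^ 3) * gauss_mom 0 \<xi>"
      unfolding 1 2 by (simp add: algebra_simps power2_eq_square power3_eq_cube)
    finally show ?thesis .
  qed
qed

section \<open>The complex coordinate of a plane and the Fourier transform of its cube times a
  Gaussian\<close>

definition planar :: "'n \<Rightarrow> 'n \<Rightarrow> real ^ 'n \<Rightarrow> complex" where
  "planar a b x = Complex (x $ a) (x $ b)"

lemma planar_eq: "planar a b x = of_real (x $ a) + \<i> * of_real (x $ b)"
  by (simp add: planar_def complex_eq_iff)

lemma planar_measurable [measurable]: "planar a b \<in> borel_measurable borel"
  unfolding planar_eq[abs_def] by measurable

lemma planar_scaleR: "planar a b (c *\<^sub>R x) = of_real c * planar a b x"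
  by (simp add: planar_def complex_eq_iff)

lemma norm_planar_le:
  assumes "a \<noteq> b"
  shows "norm (planar a b x) \<le> norm x"
proof -
  have "(norm (planar a b x))\<^sup>2 = (\<Sum>i\<in>{a, b}. (x $ i)\<^sup>2)"
    using assms by (simp add: planar_def cmod_power2)
  also have "\<dots> \<le> (\<Sum>i\<in>UNIV. (x $ i)\<^sup>2)"
    by (intro sum_mono2) auto
  also have "\<dots> = (norm x)\<^sup>2"
    by (simp add: norm_vec_def L2_set_def sum_nonneg)
  finally show ?thesis
    by (rule power2_le_imp_le) simp
qed

lemma norm2_vec: "(norm (x::real ^ 'n))\<^sup>2 = (\<Sum>i\<in>UNIV. (x $ i)\<^sup>2)"
  by (simp add: norm_vec_def L2_set_def sum_nonneg)

lemma cis_sum: "finite A \<Longrightarrow> cis (\<Sum>i\<in>A. f i) = (\<Prod>i\<in>A. cis (f i))"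
  by (induction A rule: finite_induct) (simp_all add: cis_mult[symmetric])

lemma inner_vec_sum: "(x::real ^ 'n) \<bullet> y = (\<Sum>i\<in>UNIV. x $ i * y $ i)"
  by (simp add: inner_vec_def)

lemma
  fixes \<xi> :: "real ^ 'n" and e :: "'n \<Rightarrow> nat"
  defines "f \<equiv> \<lambda>x::real ^ 'n. (\<Prod>i\<in>UNIV. of_real (x $ i) ^ e i) * cis (x \<bullet> \<xi>) * of_real (exp (- (norm x)\<^sup>2 / 2))"
  shows integrable_gaussian_monomial: "integrable lborel f"
    and integral_gaussian_monomial: "(LINT x|lborel. f x) = (\<Prod>i\<in>UNIV. gauss_mom (e i) (\<xi> $ i))"
proof -
  have f: "f = (\<lambda>x. \<Prod>i\<in>UNIV. of_real (x $ i) ^ e i * cis (x $ i * \<xi> $ i) * of_real (exp (- (x $ i)\<^sup>2 / 2)))"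
    unfolding f_def
    by (simp add: fun_eq_iff prod.distrib norm2_vec inner_vec_sum cis_sum exp_sum[symmetric] 
         sum_divide_distrib sum_negf flip: of_real_prod)
  show "integrable lborel f"
    unfolding f by (rule integrable_lborel_vec_prod[OF integrable_gaussian_moment_cis])
  show "(LINT x|lborel. f x) = (\<Prod>i\<in>UNIV. gauss_mom (e i) (\<xi> $ i))"
    unfolding f gauss_mom_def by (rule integral_lborel_vec_prod[OF integrable_gaussian_moment_cis])
qed

lemma gauss_mom_0_prod:
  "(\<Prod>i\<in>UNIV. gauss_mom 0 (\<xi> $ i)) = of_real (sqrt (2 * pi) ^ CARD('n) * exp (- (norm (\<xi>::real ^ 'n))\<^sup>2 / 2))"
  by (simp add: gauss_mom_0 prod.distrib norm2_vec exp_sum[symmetric] sum_divide_distrib sum_negf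
        flip: of_real_prod)

lemma
  fixes \<xi> :: "real ^ 'n"
  shows integrable_gaussian_cis: "integrable lborel (\<lambda>x::real ^ 'n. cis (x \<bullet> \<xi>) * of_real (exp (- (norm x)\<^sup>2 / 2)))"
    and fourier_gaussian: "(LINT x|lborel. cis (x \<bullet> \<xi>) * of_real (exp (- (norm x)\<^sup>2 / 2))) =
      of_real (sqrt (2 * pi) ^ CARD('n) * exp (- (norm \<xi>)\<^sup>2 / 2))"
  using integrable_gaussian_monomial[of "\<lambda>_. 0" \<xi>] integral_gaussian_monomial[of "\<lambda>_. 0" \<xi>]
  by (simp_all add: gauss_mom_0_prod)

lemma prod_two:
  fixes f :: "'n::finite \<Rightarrow> 'b::comm_monoid_mult"
  assumes "a \<noteq> b"
  shows "(\<Prod>i\<in>UNIV. f i) = f a * f b * (\<Prod>i\<in>UNIV - {a, b}. f i)"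
  using assms by (simp add: prod.remove[of UNIV a] prod.remove[of "UNIV - {a}" b] mult.assoc
      Diff_insert[symmetric] insert_commute)

text \<open>An instance of Hecke's identity: a harmonic homogeneous polynomial of degree k times the
  Gaussian is reproduced by the Fourier transform with the factor i^k, here i^3 = -i. It is checked
  by expanding the cube into monomials, each of which factorises over the coordinates.\<close>

lemma
  fixes \<xi> :: "real ^ 'n" and a b :: 'n
  assumes ab: "a \<noteq> b"
  defines "f \<equiv> \<lambda>x. planar a b x ^ 3 * cis (x \<bullet> \<xi>) * of_real (exp (- (norm x)\<^sup>2 / 2))"
  shows integrable_planar_cube_gaussian: "integrable lborel f"
    and fourier_planar_cube_gaussian: "(LINT x|lborel. f x) =
      - \<i> * of_real (sqrt (2 * pi) ^ CARD('n)) * planar a b \<xi> ^ 3 * of_real (exp (- (norm \<xi>)\<^sup>2 / 2))"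
proof -
  define e :: "nat \<Rightarrow> nat \<Rightarrow> 'n \<Rightarrow> nat" where "e p q i = (if i = a then p else if i = b then q else 0)" for p q i
  define g where "g p q x = (\<Prod>i\<in>UNIV. of_real (x $ i) ^ e p q i) * cis (x \<bullet> \<xi>) * of_real (exp (- (norm x)\<^sup>2 / 2))" 
    for p q and x :: "real ^ 'n"
  have ig: "integrable lborel (g p q)" for p q
    unfolding g_def by (rule integrable_gaussian_monomial)
  have e: "(\<Prod>i\<in>UNIV. of_real (x $ i) ^ e p q i) = of_real (x $ a) ^ p * of_real (x $ b) ^ q"
    for x :: "real ^ 'n" and p q
    using ab unfolding prod_two[OF ab] by (auto simp: e_def)
  have f: "f = (\<lambda>x. g 3 0 x + 3 * \<i> * g 2 1 x - 3 * g 1 2 x - \<i> * g 0 3 x)"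
    unfolding f_def g_def e planar_eq by (rule ext) (simp add: algebra_simps power3_eq_cube power2_eq_square)
  show "integrable lborel f"
    unfolding f
    by (intro Bochner_Integration.integrable_add Bochner_Integration.integrable_diff integrable_mult_right ig)
  define G where "G = (\<Prod>i\<in>UNIV. gauss_mom 0 (\<xi> $ i))"
  define R where "R = (\<Prod>i\<in>UNIV - {a, b}. gauss_mom 0 (\<xi> $ i))"
  have lg: "(LINT x|lborel. g p q x) = gauss_mom p (\<xi> $ a) * gauss_mom q (\<xi> $ b) * R" for p q
  proof -
    have "(LINT x|lborel. g p q x) = (\<Prod>i\<in>UNIV. gauss_mom (e p q i) (\<xi> $ i))"
      unfolding g_def by (rule integral_gaussian_monomial)
    also have "\<dots> = gauss_mom p (\<xi> $ a) * gauss_mom q (\<xi> $ b) * R"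
      using ab unfolding prod_two[OF ab] R_def by (auto simp: e_def)
    finally show ?thesis .
  qed
  have "(LINT x|lborel. f x) = (LINT x|lborel. g 3 0 x) + 3 * \<i> * (LINT x|lborel. g 2 1 x)
      - 3 * (LINT x|lborel. g 1 2 x) - \<i> * (LINT x|lborel. g 0 3 x)"
    unfolding f using ig by (simp add: Bochner_Integration.integral_diff Bochner_Integration.integral_add)
  \<comment> \<open>The terms of first degree in the moments \<open>gauss_mom 2\<close> and
    \<open>gauss_mom 3\<close> cancel against each other; this is where harmonicity of the cube
    enters.\<close>
  also have "\<dots> = - \<i> * planar a b \<xi> ^ 3 * G"
    unfolding lg gauss_mom_simps G_def prod_two[OF ab] R_def[symmetric] planar_eq
    by (simp add: algebra_simps power3_eq_cube power2_eq_square)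
  finally show "(LINT x|lborel. f x) =
      - \<i> * of_real (sqrt (2 * pi) ^ CARD('n)) * planar a b \<xi> ^ 3 * of_real (exp (- (norm \<xi>)\<^sup>2 / 2))"
    unfolding G_def gauss_mom_0_prod by (simp add: mult_ac)
qed

section \<open>Dilations of Lebesgue integrals\<close>

lemma
  fixes f :: "real ^ 'n \<Rightarrow> 'b::{banach, second_countable_topology}"
  assumes c: "c > 0"
  shows lborel_integral_scaleR: "(LINT x|lborel. f x) = c ^ CARD('n) *\<^sub>R (LINT x|lborel. f (c *\<^sub>R x))"
    and lborel_integrable_scaleR: "integrable lborel (\<lambda>x. f (c *\<^sub>R x)) \<longleftrightarrow> integrable lborel f"
proof -
  have *: "integrable lborel (\<lambda>x. f (c *\<^sub>R x))" if f: "integrable lborel f" and c: "c > 0"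
    for f :: "real ^ 'n \<Rightarrow> 'b" and c
  proof -
    have "integrable (density (distr lborel borel (\<lambda>x::real ^ 'n. 0 + c *\<^sub>R x)) (\<lambda>_. ennreal (\<bar>c\<bar>^DIM(real ^ 'n)))) f"
      using f c by (subst lborel_affine[symmetric]) auto
    then have "integrable lborel (\<lambda>x. c ^ CARD('n) *\<^sub>R f (c *\<^sub>R x))"
      using c borel_measurable_integrable[OF f]
      by (subst (asm) integrable_density) (auto simp: integrable_distr_eq)
    then have "integrable lborel (\<lambda>x. inverse (c ^ CARD('n)) *\<^sub>R c ^ CARD('n) *\<^sub>R f (c *\<^sub>R x))"
      by (rule integrable_scaleR_right[rotated])
    then show ?thesis
      using c by simp
  qed
  show iff: "integrable lborel (\<lambda>x. f (c *\<^sub>R x)) \<longleftrightarrow> integrable lborel f"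
    using *[of f c] *[of "\<lambda>x. f (c *\<^sub>R x)" "1 / c"] c by auto
  show "(LINT x|lborel. f x) = c ^ CARD('n) *\<^sub>R (LINT x|lborel. f (c *\<^sub>R x))"
  proof (cases "integrable lborel f")
    case True
    then have [measurable]: "f \<in> borel_measurable borel"
      by (auto dest: borel_measurable_integrable)
    show ?thesis
      using c True
      by (subst lborel_affine[of c 0]) (auto simp: integral_density integral_distr)
  next
    case False
    then show ?thesis
      using iff by (simp add: not_integrable_integral_eq)
  qed
qed

lemma nn_integral_lborel_scaleR:
  fixes f :: "real ^ 'n \<Rightarrow> ennreal"
  assumes [measurable]: "f \<in> borel_measurable borel" and c: "c > 0"
  shows "(\<integral>\<^sup>+x. f x \<partial>lborel) = ennreal (c ^ CARD('n)) * (\<integral>\<^sup>+x. f (c *\<^sub>R x) \<partial>lborel)"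
  using c by (subst lborel_affine[of c 0]) (auto simp: nn_integral_density nn_integral_distr nn_integral_cmult)

section \<open>Rotations in a coordinate plane\<close>

lemma integrable_pair_bound:
  fixes h :: "'a::euclidean_space \<times> 'b::euclidean_space \<Rightarrow> complex"
  assumes [measurable]: "h \<in> borel_measurable (lborel \<Otimes>\<^sub>M lborel)"
    and A: "integrable lborel A" and B: "integrable lborel B"
    and le: "\<And>x y. norm (h (x, y)) \<le> A x * B y"
  shows "integrable (lborel \<Otimes>\<^sub>M lborel) h"
proof (rule integrableI_bounded)
  have [measurable]: "A \<in> borel_measurable borel" "B \<in> borel_measurable borel"
    using A B by (auto dest: borel_measurable_integrable)
  have "(\<integral>\<^sup>+z. ennreal (norm (h z)) \<partial>(lborel \<Otimes>\<^sub>M lborel)) \<le>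
      (\<integral>\<^sup>+x. \<integral>\<^sup>+y. ennreal (norm (A x)) * ennreal (norm (B y)) \<partial>lborel \<partial>lborel)"
  proof -
    have "(\<integral>\<^sup>+z. ennreal (norm (h z)) \<partial>(lborel \<Otimes>\<^sub>M lborel)) \<le>
        (\<integral>\<^sup>+z. ennreal (norm (A (fst z))) * ennreal (norm (B (snd z))) \<partial>(lborel \<Otimes>\<^sub>M lborel))"
    proof (intro nn_integral_mono)
      fix z :: "'a \<times> 'b"
      have "norm (h z) \<le> norm (A (fst z)) * norm (B (snd z))"
        using le[of "fst z" "snd z"] by (simp flip: abs_mult)
      then show "ennreal (norm (h z)) \<le> ennreal (norm (A (fst z))) * ennreal (norm (B (snd z)))"
        by (simp flip: ennreal_mult)
    qed
    also have "\<dots> = (\<integral>\<^sup>+x. \<integral>\<^sup>+y. ennreal (norm (A x)) * ennreal (norm (B y)) \<partial>lborel \<partial>lborel)"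
      by (subst lborel.nn_integral_fst[symmetric]) simp_all
    finally show ?thesis .
  qed
  also have "\<dots> = (\<integral>\<^sup>+x. ennreal (norm (A x)) \<partial>lborel) * (\<integral>\<^sup>+y. ennreal (norm (B y)) \<partial>lborel)"
    by (simp add: nn_integral_cmult nn_integral_multc)
  also have "\<dots> < \<infinity>"
    using A B by (simp add: integrable_iff_bounded ennreal_mult_less_top)
  finally show "(\<integral>\<^sup>+z. ennreal (norm (h z)) \<partial>(lborel \<Otimes>\<^sub>M lborel)) < \<infinity>" .
qed measurable

lemma swap_integrals:
  fixes h :: "'a::euclidean_space \<Rightarrow> 'b::euclidean_space \<Rightarrow> complex"
  assumes "case_prod h \<in> borel_measurable (lborel \<Otimes>\<^sub>M lborel)"
    and "integrable lborel A" "integrable lborel B"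
    and "\<And>x y. norm (h x y) \<le> A x * B y"
  shows "(LINT x|lborel. LINT y|lborel. h x y) = (LINT y|lborel. LINT x|lborel. h x y)"
  using lborel_pair.Fubini_integral[OF integrable_pair_bound[of "case_prod h" A B]] assms by simp

lemma nn_integral_lborel_translate:
  fixes f :: "'a::euclidean_space \<Rightarrow> ennreal"
  assumes [measurable]: "f \<in> borel_measurable borel"
  shows "(\<integral>\<^sup>+x. f (c + x) \<partial>lborel) = (\<integral>\<^sup>+x. f x \<partial>lborel)"
proof -
  have "(\<integral>\<^sup>+x. f x \<partial>distr lborel borel ((+) c)) = (\<integral>\<^sup>+x. f (c + x) \<partial>lborel)"
    by (simp add: nn_integral_distr)
  then show ?thesis
    by (simp add: lborel_distr_plus)
qed

text \<open>Averaging over translations along \<open>axis a 1\<close> absorbs the shear into a translation of the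
  averaging variable.\<close>

lemma distr_lborel_shear:
  fixes a b :: "'n::finite" and s :: real
  assumes ab: "a \<noteq> b"
  defines "S \<equiv> \<lambda>x::real ^ 'n. x + (s * x $ b) *\<^sub>R axis a 1"
  shows "distr lborel borel S = lborel"
proof (rule measure_eqI)
  have nn: "(\<integral>\<^sup>+x. f (x + (s * x $ b) *\<^sub>R axis a 1) \<partial>lborel) =
      (\<integral>\<^sup>+x. indicator {0..1} (x $ a) * (\<integral>\<^sup>+r. f (x - r *\<^sub>R axis a 1) \<partial>lborel) \<partial>lborel)"
    if [measurable]: "f \<in> borel_measurable borel" for f :: "real ^ 'n \<Rightarrow> ennreal" and s :: real
  proof -
    let ?g = "indicator {0..1} :: real \<Rightarrow> ennreal"
    have m: "(\<lambda>x::real ^ 'n. x $ i) \<in> borel_measurable borel" for i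
      by (rule borel_measurable_continuous_onI) (intro continuous_intros)
    note m[measurable]
    \<comment> \<open>The window has mass 1 wherever it is shifted, so inserting it changes
      nothing.\<close>
    have g: "(\<integral>\<^sup>+r. ?g (c + r) \<partial>lborel) = 1" for c
      using nn_integral_lborel_translate[of ?g c] by simp
    have "(\<integral>\<^sup>+x. f (x + (s * x $ b) *\<^sub>R axis a 1) \<partial>lborel) =
        (\<integral>\<^sup>+x. (\<integral>\<^sup>+r. ?g (x $ a + r) * f (x + (s * x $ b) *\<^sub>R axis a 1) \<partial>lborel) \<partial>lborel)"
      by (simp add: nn_integral_multc g)
    also have "\<dots> = (\<integral>\<^sup>+r. (\<integral>\<^sup>+x. ?g (x $ a + r) * f (x + (s * x $ b) *\<^sub>R axis a 1) \<partial>lborel) \<partial>lborel)"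
      by (rule lborel_pair.Fubini') measurable
    \<comment> \<open>Translation of \<open>x\<close> by \<open>- r\<close> along
      \<open>axis a 1\<close>. It leaves \<open>x $ b\<close> fixed because \<open>a\<close> and
      \<open>b\<close> differ, so the size of the shear is untouched and the window becomes
      independent of \<open>r\<close>.\<close>
    also have "\<dots> = (\<integral>\<^sup>+r. (\<integral>\<^sup>+x. ?g (x $ a) * f (x + (s * x $ b - r) *\<^sub>R axis a 1) \<partial>lborel) \<partial>lborel)"
    proof (rule nn_integral_cong)
      fix r :: real
      have [simp]: "(axis a 1 :: real ^ 'n) $ b = 0" "(axis a 1 :: real ^ 'n) $ a = 1"
        using ab by (auto simp: axis_def)
      show "(\<integral>\<^sup>+x. ?g (x $ a + r) * f (x + (s * x $ b) *\<^sub>R axis a 1) \<partial>lborel) =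
          (\<integral>\<^sup>+x. ?g (x $ a) * f (x + (s * x $ b - r) *\<^sub>R axis a 1) \<partial>lborel)"
        using nn_integral_lborel_translate[of "\<lambda>x. ?g (x $ a + r) * f (x + (s * x $ b) *\<^sub>R axis a 1)" "(- r) *\<^sub>R axis a 1"]
        by (simp add: algebra_simps)
    qed
    also have "\<dots> = (\<integral>\<^sup>+x. (\<integral>\<^sup>+r. ?g (x $ a) * f (x + (s * x $ b - r) *\<^sub>R axis a 1) \<partial>lborel) \<partial>lborel)"
      by (rule lborel_pair.Fubini') measurable
    also have "\<dots> = (\<integral>\<^sup>+x. ?g (x $ a) * (\<integral>\<^sup>+r. f (x + (s * x $ b - r) *\<^sub>R axis a 1) \<partial>lborel) \<partial>lborel)"
      by (simp add: nn_integral_cmult)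
    also have "\<dots> = (\<integral>\<^sup>+x. ?g (x $ a) * (\<integral>\<^sup>+r. f (x - r *\<^sub>R axis a 1) \<partial>lborel) \<partial>lborel)"
    proof (rule nn_integral_cong)
      fix x :: "real ^ 'n"
      have "(\<integral>\<^sup>+r. f (x + (s * x $ b - r) *\<^sub>R axis a 1) \<partial>lborel) = (\<integral>\<^sup>+r. f (x - r *\<^sub>R axis a 1) \<partial>lborel)"
        using nn_integral_lborel_translate[of "\<lambda>r. f (x + (s * x $ b - r) *\<^sub>R axis a 1)" "s * x $ b"]
        by (simp add: algebra_simps)
      then show "?g (x $ a) * (\<integral>\<^sup>+r. f (x + (s * x $ b - r) *\<^sub>R axis a 1) \<partial>lborel) =
          ?g (x $ a) * (\<integral>\<^sup>+r. f (x - r *\<^sub>R axis a 1) \<partial>lborel)"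
        by simp
    qed
    finally show ?thesis .
  qed
  have [measurable]: "S \<in> borel_measurable borel"
    unfolding S_def by (rule borel_measurable_continuous_onI) (intro continuous_intros)
  fix A assume "A \<in> sets (distr lborel borel S)"
  then have [measurable]: "A \<in> sets borel" by simp
  have "emeasure (distr lborel borel S) A = (\<integral>\<^sup>+x. indicator A (S x) \<partial>lborel)"
    by (simp add: nn_integral_indicator[symmetric] nn_integral_distr del: nn_integral_indicator)
  \<comment> \<open>The right-hand side of \<open>nn\<close> does not contain the shear parameter,
    so the parameters \<open>s\<close> and 0 give the same value.\<close>
  also have "\<dots> = (\<integral>\<^sup>+x. indicator A x \<partial>lborel)"
    using nn[of "indicator A" s] nn[of "indicator A" 0] by (simp add: S_def)
  finally show "emeasure (distr lborel borel S) A = emeasure lborel A" by simp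
qed simp

lemma integral_shear:
  fixes f :: "real ^ 'n \<Rightarrow> complex"
  assumes [measurable]: "f \<in> borel_measurable borel" and "a \<noteq> b"
  shows "(LINT x|lborel. f (x + (s * x $ b) *\<^sub>R axis a 1)) = (LINT x|lborel. f x)"
proof -
  have [measurable]: "(\<lambda>x::real ^ 'n. x + (s * x $ b) *\<^sub>R axis a 1) \<in> borel_measurable borel"
    by (rule borel_measurable_continuous_onI) (intro continuous_intros)
  show ?thesis
    by (subst (2) distr_lborel_shear[OF assms(2), of s, symmetric]) (simp add: integral_distr)
qed

text \<open>A rotation of the \<open>(a, b)\<close>-plane, written as a product of three shears, multiplies the integrand
  by a constant different from 1.\<close>

lemma integral_planar_weight_eq_0:
  fixes w :: "real ^ 'n \<Rightarrow> complex"
  assumes ab: "a \<noteq> b" and nm: "n < m" and w[measurable]: "w \<in> borel_measurable borel"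
    and inv: "\<And>x y. norm x = norm y \<Longrightarrow> (\<And>i. i \<noteq> a \<Longrightarrow> i \<noteq> b \<Longrightarrow> x $ i = y $ i) \<Longrightarrow> w x = w y"
  shows "(LINT x|lborel. planar a b x ^ m * cnj (planar a b x) ^ n * w x) = 0"
proof -
  \<comment> \<open>The rotation will have angle \<open>2 * \<phi>\<close> and multiplies the
    integrand by \<open>cis (2 * \<phi> * (m - n)) = cis (2 * pi / 3)\<close>, which is not 1. Since
    \<open>\<phi> \<le> pi / 3\<close>, the cosine is positive and \<open>tan \<phi>\<close> is
    meaningful.\<close>
  define \<phi> where "\<phi> = pi / (3 * real (m - n))"
  have "1 \<le> real (m - n)"
    using nm by linarith
  then have "0 < \<phi>" "\<phi> \<le> pi / 3"
    using divide_left_mono[of 3 "3 * real (m - n)" pi] unfolding \<phi>_def by simp_all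
  then have "0 < \<phi>" "\<phi> < pi / 2"
    using pi_gt_zero by linarith+
  then have cos: "cos \<phi> > 0"
    by (intro cos_gt_zero_pi) auto
  \<comment> \<open>Shear parameters of a rotation by the angle \<open>2 * \<phi>\<close>: minus the
    tangent of the half angle for the outer two shears, the sine of the full angle for the middle
    one.\<close>
  define t s where "t = - tan \<phi>" and "s = sin (2 * \<phi>)"
  define S1 where "S1 x = x + (t * x $ b) *\<^sub>R axis a 1" for x :: "real ^ 'n"
  define S2 where "S2 x = x + (s * x $ a) *\<^sub>R axis b 1" for x :: "real ^ 'n"
  have meas[measurable]: "S1 \<in> borel_measurable borel" "S2 \<in> borel_measurable borel"
    unfolding S1_def[abs_def] S2_def[abs_def]
    by (auto intro!: borel_measurable_continuous_onI continuous_intros)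
  define R where "R x = S1 (S2 (S1 x))" for x
  define F where "F x = planar a b x ^ m * cnj (planar a b x) ^ n * w x" for x
  have [measurable]: "cnj \<in> borel_measurable borel"
    by (intro borel_measurable_continuous_onI continuous_intros)
  have [measurable]: "F \<in> borel_measurable borel"
    unfolding F_def[abs_def] by measurable
  have int: "(LINT x|lborel. F (R x)) = (LINT x|lborel. F x)"
  proof -
    have 1: "(LINT x|lborel. F (S1 x)) = (LINT x|lborel. F x)"
      unfolding S1_def using ab by (intro integral_shear) auto
    have 2: "(LINT x|lborel. F (S1 (S2 x))) = (LINT x|lborel. F (S1 x))"
      unfolding S2_def using ab by (intro integral_shear[of "\<lambda>x. F (S1 x)"]) auto
    have 3: "(LINT x|lborel. F (S1 (S2 (S1 x)))) = (LINT x|lborel. F (S1 (S2 x)))"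
      using integral_shear[of "\<lambda>x. F (S1 (S2 x))" a b t] ab unfolding S1_def[symmetric] by simp
    show ?thesis unfolding R_def using 1 2 3 by simp
  qed
  have id1: "1 + t * s = cos (2 * \<phi>)"
    using cos by (simp add: t_def s_def tan_def sin_double cos_double_sin power2_eq_square)
  have id2: "t * (1 + cos (2 * \<phi>)) = - s"
    using cos by (simp add: t_def s_def tan_def sin_double cos_double_cos power2_eq_square)
  have Ra: "R x $ a = cos (2 * \<phi>) * x $ a - sin (2 * \<phi>) * x $ b" for x
  proof -
    have "R x $ a = (1 + t * s) * x $ a + (t * (1 + (1 + t * s))) * x $ b"
      using ab by (simp add: R_def S1_def S2_def axis_def algebra_simps)
    then show ?thesis unfolding id1 id2 by (simp add: s_def)
  qed
  have Rb: "R x $ b = sin (2 * \<phi>) * x $ a + cos (2 * \<phi>) * x $ b" for x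
  proof -
    have "R x $ b = s * x $ a + (1 + t * s) * x $ b"
      using ab by (simp add: R_def S1_def S2_def axis_def algebra_simps)
    then show ?thesis unfolding id1 by (simp add: s_def)
  qed
  have Ri: "R x $ i = x $ i" if "i \<noteq> a" "i \<noteq> b" for x i
    using that by (simp add: R_def S1_def S2_def axis_def)
  have zR: "planar a b (R x) = cis (2 * \<phi>) * planar a b x" for x
    by (simp add: planar_def Ra Rb complex_eq_iff)
  have nR: "norm (R x) = norm x" for x
  proof -
    have "(C * p - S * q)\<^sup>2 + (S * p + C * q)\<^sup>2 = (S\<^sup>2 + C\<^sup>2) * (p\<^sup>2 + q\<^sup>2)" for C S p q :: real
      by (simp add: algebra_simps power2_eq_square)
    from this[of "cos (2 * \<phi>)" "x $ a" "sin (2 * \<phi>)" "x $ b"]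
    have "(norm (R x))\<^sup>2 = (norm x)\<^sup>2"
      unfolding norm2_vec using ab
      by (simp add: sum.remove[of UNIV a] sum.remove[of "UNIV - {a}" b] Ra Rb Ri add.assoc[symmetric])
    then show ?thesis by simp
  qed
  have "w (R x) = w x" for x
    by (rule inv) (auto simp: nR Ri)
  moreover have "cis (2 * \<phi>) ^ m * cnj (cis (2 * \<phi>)) ^ n = cis (2 * pi / 3)"
  proof -
    have "cis (2 * \<phi>) ^ m = cis (2 * \<phi>) ^ (m - n) * cis (2 * \<phi>) ^ n"
      using nm by (simp flip: power_add)
    moreover have "cis (2 * \<phi>) ^ (m - n) = cis (2 * pi / 3)"
    proof -
      have "real (m - n) * (2 * \<phi>) = 2 * pi / 3"
        unfolding \<phi>_def using \<open>1 \<le> real (m - n)\<close> by (simp add: field_simps del: of_nat_diff)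
      then show ?thesis by (simp only: Complex.DeMoivre)
    qed
    moreover have "cis (2 * \<phi>) ^ n * cnj (cis (2 * \<phi>)) ^ n = 1"
      by (simp add: power_mult_distrib[symmetric] cis_cnj cis_mult)
    ultimately show ?thesis by (simp add: mult.assoc)
  qed
  ultimately have "F (R x) = cis (2 * pi / 3) * F x" for x
    by (simp add: F_def zR power_mult_distrib mult_ac)
  then have "(LINT x|lborel. F x) = cis (2 * pi / 3) * (LINT x|lborel. F x)"
    using int by simp
  moreover have "cis (2 * pi / 3) \<noteq> 1"
  proof
    assume "cis (2 * pi / 3) = 1"
    from arg_cong[OF this, of Re] show False by (simp add: cos_120)
  qed
  ultimately have "(LINT x|lborel. F x) = 0"
    by (metis mult_cancel_right1)
  then show ?thesis
    unfolding F_def .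
qed

section \<open>Plancherel's inequality\<close>

lemma norm_LINT_le_nn_integral:
  fixes f :: "'a \<Rightarrow> 'b::{banach, second_countable_topology}"
  shows "ennreal (norm (LINT x|M. f x)) \<le> (\<integral>\<^sup>+x. ennreal (norm (f x)) \<partial>M)"
proof (cases "integrable M f")
  case True
  then show ?thesis by (rule integral_norm_bound_ennreal)
qed (simp add: not_integrable_integral_eq)

lemma nn_integral_gaussian_vec:
  fixes r :: real
  assumes r: "r > 0"
  shows "(\<integral>\<^sup>+x. ennreal (exp (- (norm (r *\<^sub>R x :: real ^ 'n))\<^sup>2 / 2)) \<partial>lborel) = ennreal ((sqrt (2 * pi) / r) ^ CARD('n))"
proof -
  let ?g = "\<lambda>x::real ^ 'n. exp (- (norm x)\<^sup>2 / 2)"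
  have c: "integrable lborel (\<lambda>x::real ^ 'n. complex_of_real (?g x))"
    "(LINT x|lborel. complex_of_real (?g x)) = of_real (sqrt (2 * pi) ^ CARD('n))"
    using integrable_gaussian_cis[of "0 :: real ^ 'n"] fourier_gaussian[of "0 :: real ^ 'n"]
    by (simp_all only: inner_zero_right cis_zero mult_1_left norm_zero power_zero_numeral minus_zero div_0 exp_zero mult_1_right)
  have i: "integrable lborel ?g"
    using c(1) unfolding complex_of_real_integrable_eq .
  have "complex_of_real (LINT x|lborel. ?g x) = of_real (sqrt (2 * pi) ^ CARD('n))"
    using c(2) unfolding integral_of_real[OF i] .
  then have "(LINT x|lborel. ?g x) = sqrt (2 * pi) ^ CARD('n)"
    by (simp only: of_real_eq_iff)
  then have "ennreal (sqrt (2 * pi) ^ CARD('n)) = (\<integral>\<^sup>+x. ennreal (?g x) \<partial>lborel)"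
    using i by (simp add: nn_integral_eq_integral)
  also have "\<dots> = ennreal (r ^ CARD('n)) * (\<integral>\<^sup>+x. ennreal (?g (r *\<^sub>R x)) \<partial>lborel)"
    using r by (intro nn_integral_lborel_scaleR) auto
  finally have "ennreal ((1 / r) ^ CARD('n)) * ennreal (sqrt (2 * pi) ^ CARD('n)) =
      ennreal ((1 / r) ^ CARD('n)) * (ennreal (r ^ CARD('n)) * (\<integral>\<^sup>+x. ennreal (?g (r *\<^sub>R x)) \<partial>lborel))"
    by simp
  also have "\<dots> = (\<integral>\<^sup>+x. ennreal (?g (r *\<^sub>R x)) \<partial>lborel)"
    using r by (simp flip: mult.assoc ennreal_mult add: power_divide)
  finally show ?thesis
    using r by (simp flip: ennreal_mult add: power_divide)
qed

lemma fourier_gaussian_scaled: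
  fixes z :: "real ^ 'n"
  assumes r: "r > 0"
  shows "integrable lborel (\<lambda>x. cis (x \<bullet> z) * of_real (exp (- (norm (r *\<^sub>R x))\<^sup>2 / 2)))"
    and "(LINT x|lborel. cis (x \<bullet> z) * of_real (exp (- (norm (r *\<^sub>R x))\<^sup>2 / 2))) =
      of_real ((sqrt (2 * pi) / r) ^ CARD('n) * exp (- (norm ((1 / r) *\<^sub>R z))\<^sup>2 / 2))"
proof -
  let ?f = "\<lambda>x::real ^ 'n. cis (x \<bullet> ((1 / r) *\<^sub>R z)) * of_real (exp (- (norm x)\<^sup>2 / 2)) :: complex"
  have eq: "?f (r *\<^sub>R x) = cis (x \<bullet> z) * of_real (exp (- (norm (r *\<^sub>R x))\<^sup>2 / 2))" for x
    using r by simp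
  show "integrable lborel (\<lambda>x. cis (x \<bullet> z) * of_real (exp (- (norm (r *\<^sub>R x))\<^sup>2 / 2)))"
    unfolding eq[symmetric] lborel_integrable_scaleR[OF r, of ?f] by (rule integrable_gaussian_cis)
  have "(LINT x|lborel. ?f x) = r ^ CARD('n) *\<^sub>R (LINT x|lborel. ?f (r *\<^sub>R x))"
    by (rule lborel_integral_scaleR[OF r])
  then have "r ^ CARD('n) *\<^sub>R (LINT x|lborel. ?f (r *\<^sub>R x)) =
      of_real (sqrt (2 * pi) ^ CARD('n) * exp (- (norm ((1 / r) *\<^sub>R z))\<^sup>2 / 2))"
    unfolding fourier_gaussian by simp
  then have "(1 / r ^ CARD('n)) *\<^sub>R r ^ CARD('n) *\<^sub>R (LINT x|lborel. ?f (r *\<^sub>R x)) =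
      (1 / r ^ CARD('n)) *\<^sub>R of_real (sqrt (2 * pi) ^ CARD('n) * exp (- (norm ((1 / r) *\<^sub>R z))\<^sup>2 / 2))"
    by (rule arg_cong)
  then show "(LINT x|lborel. cis (x \<bullet> z) * of_real (exp (- (norm (r *\<^sub>R x))\<^sup>2 / 2))) =
      of_real ((sqrt (2 * pi) / r) ^ CARD('n) * exp (- (norm ((1 / r) *\<^sub>R z))\<^sup>2 / 2))"
    unfolding eq using r by (simp add: power_divide scaleR_conv_of_real)
qed

lemma borel_measurable_cis [measurable (raw)]:
  "f \<in> borel_measurable M \<Longrightarrow> (\<lambda>x. cis (f x)) \<in> borel_measurable M"
  unfolding cis_conv_exp by measurable

lemma integrable_cis_mult:
  assumes "integrable M f" "g \<in> borel_measurable M"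
  shows "integrable M (\<lambda>x. cis (g x) * f x)"
  using assms(1)
  by (rule Bochner_Integration.integrable_bound)
     (use assms borel_measurable_integrable[OF assms(1)] in \<open>auto simp: norm_mult\<close>)

lemma borel_measurable_cnj [measurable (raw)]:
  "f \<in> borel_measurable M \<Longrightarrow> (\<lambda>x. cnj (f x)) \<in> borel_measurable M"
  by (rule measurable_compose[of _ _ borel]) (auto intro!: borel_measurable_continuous_onI continuous_intros)

text \<open>The Gaussian damping makes the frequency integral absolutely convergent. Writing the
  square as F times its conjugate and exchanging integrals turns the damping into the convolution
  kernel \<open>G\<close>, whose mass is \<open>(2 * pi) ^ CARD('n)\<close> for every
  \<open>r\<close>; Schur's test then bounds the resulting quadratic form. The right-hand side may
  be infinite, since \<open>f\<close> is only assumed integrable.\<close>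

lemma plancherel_le_gaussian:
  fixes f :: "real ^ 'n \<Rightarrow> complex"
  assumes f: "integrable lborel f" and r: "r > 0"
  shows "(\<integral>\<^sup>+\<xi>. ennreal (exp (- (norm (r *\<^sub>R \<xi>))\<^sup>2 / 2) * (norm (LINT x|lborel. cis (x \<bullet> \<xi>) * f x))\<^sup>2) \<partial>lborel)
    \<le> ennreal ((2 * pi) ^ CARD('n)) * (\<integral>\<^sup>+x. ennreal ((norm (f x))\<^sup>2) \<partial>lborel)"
proof -
  define W where "W \<xi> = exp (- (norm (r *\<^sub>R \<xi>))\<^sup>2 / 2)" for \<xi> :: "real ^ 'n"
  define F where "F \<xi> = (LINT x|lborel. cis (x \<bullet> \<xi>) * f x)" for \<xi>
  define G where "G z = (sqrt (2 * pi) / r) ^ CARD('n) * exp (- (norm ((1 / r) *\<^sub>R z))\<^sup>2 / 2)" for z :: "real ^ 'n"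
  define N where "N = (LINT x|lborel. norm (f x))"
  have [measurable]: "f \<in> borel_measurable borel"
    using f by (auto dest: borel_measurable_integrable)
  have [measurable]: "W \<in> borel_measurable borel" "G \<in> borel_measurable borel"
    unfolding W_def[abs_def] G_def[abs_def] by measurable
  have [measurable]: "F \<in> borel_measurable borel"
    unfolding F_def[abs_def] by measurable
  have W0: "W \<xi> > 0" for \<xi> by (simp add: W_def)
  have W0': "W \<xi> \<ge> 0" for \<xi> by (simp add: W_def)
  have G0: "G \<xi> \<ge> 0" for \<xi> using r by (simp add: G_def)
  have Wint: "integrable lborel W"
    using fourier_gaussian_scaled(1)[OF r, of 0] unfolding W_def[abs_def]
    by (simp only: inner_zero_right cis_zero mult_1_left complex_of_real_integrable_eq)
  have FN: "norm (F \<xi>) \<le> N" for \<xi>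
    unfolding F_def N_def by (rule order_trans[OF integral_norm_bound]) (simp add: norm_mult)
  have N0: "N \<ge> 0" by (simp add: N_def)
  have nf: "integrable lborel (\<lambda>x. norm (f x))" by (rule integrable_norm[OF f])
  have GF: "(LINT \<xi>|lborel. complex_of_real (W \<xi>) * (F \<xi> * cis (- (y \<bullet> \<xi>)))) = (LINT x|lborel. f x * complex_of_real (G (x - y)))" for y :: "real ^ 'n"
  proof -
    have "(LINT \<xi>|lborel. complex_of_real (W \<xi>) * (F \<xi> * cis (- (y \<bullet> \<xi>)))) =
        (LINT \<xi>|lborel. LINT x|lborel. complex_of_real (W \<xi>) * cis ((x - y) \<bullet> \<xi>) * f x)"
    proof (rule Bochner_Integration.integral_cong[OF refl])
      fix \<xi>
      have "complex_of_real (W \<xi>) * cis ((x - y) \<bullet> \<xi>) * f x =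
          complex_of_real (W \<xi>) * cis (- (y \<bullet> \<xi>)) * (cis (x \<bullet> \<xi>) * f x)" for x
        by (simp add: inner_diff_left cis_mult mult_ac flip: mult.assoc[of "cis _" "cis _"])
      then have "(LINT x|lborel. complex_of_real (W \<xi>) * cis ((x - y) \<bullet> \<xi>) * f x) =
          (LINT x|lborel. complex_of_real (W \<xi>) * cis (- (y \<bullet> \<xi>)) * (cis (x \<bullet> \<xi>) * f x))"
        by (simp only:)
      also have "\<dots> = complex_of_real (W \<xi>) * cis (- (y \<bullet> \<xi>)) * F \<xi>"
        unfolding F_def by (rule integral_mult_right_zero)
      finally show "complex_of_real (W \<xi>) * (F \<xi> * cis (- (y \<bullet> \<xi>))) =
          (LINT x|lborel. complex_of_real (W \<xi>) * cis ((x - y) \<bullet> \<xi>) * f x)"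
        by (simp only: mult_ac)
    qed
    also have "\<dots> = (LINT x|lborel. LINT \<xi>|lborel. complex_of_real (W \<xi>) * cis ((x - y) \<bullet> \<xi>) * f x)"
      by (rule swap_integrals[OF _ Wint nf]) (use W0 in \<open>auto simp: norm_mult less_imp_le abs_of_pos\<close>)
    also have "\<dots> = (LINT x|lborel. f x * (LINT \<xi>|lborel. cis (\<xi> \<bullet> (x - y)) * complex_of_real (W \<xi>)))"
      by (simp add: inner_commute mult_ac)
    also have "\<dots> = (LINT x|lborel. f x * complex_of_real (G (x - y)))"
      unfolding W_def fourier_gaussian_scaled(2)[OF r] G_def ..
    finally show ?thesis .
  qed
  have cF: "cnj (F \<xi>) = (LINT y|lborel. cis (- (y \<bullet> \<xi>)) * cnj (f y))" for \<xi>
    unfolding F_def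
    by (subst integral_bounded_linear[OF bounded_linear_cnj, symmetric])
       (auto intro!: integrable_cis_mult f simp: cis_cnj)
  have Q: "(LINT \<xi>|lborel. complex_of_real (W \<xi>) * F \<xi> * cnj (F \<xi>)) = (LINT y|lborel. cnj (f y) * (LINT x|lborel. f x * complex_of_real (G (x - y))))"
  proof -
    have "(LINT \<xi>|lborel. complex_of_real (W \<xi>) * F \<xi> * cnj (F \<xi>)) =
        (LINT \<xi>|lborel. LINT y|lborel. complex_of_real (W \<xi>) * F \<xi> * (cis (- (y \<bullet> \<xi>)) * cnj (f y)))"
      unfolding cF by simp
    also have "\<dots> = (LINT y|lborel. LINT \<xi>|lborel. complex_of_real (W \<xi>) * F \<xi> * (cis (- (y \<bullet> \<xi>)) * cnj (f y)))"
    proof (rule swap_integrals[OF _ _ nf])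
      show "integrable lborel (\<lambda>\<xi>. W \<xi> * N)" using Wint by simp
      show "norm (complex_of_real (W x) * F x * (cis (- (y \<bullet> x)) * cnj (f y))) \<le> W x * N * norm (f y)" for x y
        using W0[of x] FN[of x] by (simp add: norm_mult mult_left_mono mult_right_mono)
    qed measurable
    also have "\<dots> = (LINT y|lborel. cnj (f y) * (LINT \<xi>|lborel. complex_of_real (W \<xi>) * (F \<xi> * cis (- (y \<bullet> \<xi>)))))"
      unfolding integral_mult_right_zero[symmetric]
      by (intro Bochner_Integration.integral_cong refl) (simp only: mult_ac)
    finally show ?thesis unfolding GF .
  qed
  \<comment> \<open>The height of \<open>G\<close> is proportional to
    \<open>1 / r ^ CARD('n)\<close> and its width to \<open>r\<close>, so \<open>r\<close> drops out
    of the mass; this makes the bound uniform in the damping.\<close>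
  have intG: "(\<integral>\<^sup>+z. ennreal (G z) \<partial>lborel) = ennreal ((2 * pi) ^ CARD('n))"
  proof -
    have "(\<integral>\<^sup>+z. ennreal (G z) \<partial>lborel) = ennreal ((sqrt (2 * pi) / r) ^ CARD('n)) * ennreal ((sqrt (2 * pi) / (1 / r)) ^ CARD('n))"
    proof -
      have "(\<integral>\<^sup>+z. ennreal (G z) \<partial>lborel) = (\<integral>\<^sup>+z. ennreal ((sqrt (2 * pi) / r) ^ CARD('n)) *
          ennreal (exp (- (norm ((1 / r) *\<^sub>R z :: real ^ 'n))\<^sup>2 / 2)) \<partial>lborel)"
        using r unfolding G_def by (intro nn_integral_cong ennreal_mult) auto
      also have "\<dots> = ennreal ((sqrt (2 * pi) / r) ^ CARD('n)) * ennreal ((sqrt (2 * pi) / (1 / r)) ^ CARD('n))"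
        using r by (subst nn_integral_cmult) (simp, subst nn_integral_gaussian_vec, simp_all)
      finally show ?thesis .
    qed
    also have "\<dots> = ennreal ((2 * pi) ^ CARD('n))"
    proof -
      have "sqrt (2 * pi) / r * (sqrt (2 * pi) / (1 / r)) = 2 * pi"
        using r by simp
      then have "(sqrt (2 * pi) / r) ^ CARD('n) * (sqrt (2 * pi) / (1 / r)) ^ CARD('n) = (2 * pi) ^ CARD('n)"
        by (simp only: power_mult_distrib[symmetric])
      then show ?thesis
        using r by (subst ennreal_mult[symmetric]) auto
    qed
    finally show ?thesis .
  qed
  have Gx: "(\<integral>\<^sup>+x. ennreal (G (x - y)) \<partial>lborel) = ennreal ((2 * pi) ^ CARD('n))" for y
    using nn_integral_lborel_translate[of "\<lambda>x. ennreal (G x)" "- y"] intG by simp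
  have Gy: "(\<integral>\<^sup>+y. ennreal (G (x - y)) \<partial>lborel) = ennreal ((2 * pi) ^ CARD('n))" for x
  proof -
    have "G (x - y) = G (y - x)" for y by (simp add: G_def norm_minus_commute)
    then show ?thesis using Gx by simp
  qed
  obtain h :: real where h: "h = 1 / 2" by blast
  let ?S = "\<integral>\<^sup>+x. ennreal ((norm (f x))\<^sup>2) \<partial>lborel" and ?c = "ennreal ((2 * pi) ^ CARD('n))"
  have iW: "integrable lborel (\<lambda>\<xi>. W \<xi> * (norm (F \<xi>))\<^sup>2)"
    by (rule Bochner_Integration.integrable_bound[of _ "\<lambda>\<xi>. W \<xi> * N\<^sup>2"])
       (use Wint W0 FN N0 in \<open>auto simp: abs_mult abs_of_pos intro!: mult_left_mono power_mono less_imp_le\<close>)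
  have "(\<integral>\<^sup>+\<xi>. ennreal (W \<xi> * (norm (F \<xi>))\<^sup>2) \<partial>lborel) = ennreal (LINT \<xi>|lborel. W \<xi> * (norm (F \<xi>))\<^sup>2)"
    by (intro nn_integral_eq_integral iW AE_I2 mult_nonneg_nonneg W0') simp
  also have "(LINT \<xi>|lborel. W \<xi> * (norm (F \<xi>))\<^sup>2) = norm (complex_of_real (LINT \<xi>|lborel. W \<xi> * (norm (F \<xi>))\<^sup>2))"
    using W0' by (simp add: abs_of_nonneg)
  also have "complex_of_real (LINT \<xi>|lborel. W \<xi> * (norm (F \<xi>))\<^sup>2) = (LINT \<xi>|lborel. complex_of_real (W \<xi>) * F \<xi> * cnj (F \<xi>))"
    unfolding integral_of_real[OF iW, symmetric]
    by (intro Bochner_Integration.integral_cong refl) (simp add: complex_norm_square mult.assoc del: of_real_power)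
  also have "ennreal (norm \<dots>) \<le> (\<integral>\<^sup>+y. \<integral>\<^sup>+x. ennreal (norm (f y) * norm (f x) * G (x - y)) \<partial>lborel \<partial>lborel)"
    unfolding Q
  proof (rule order_trans[OF norm_LINT_le_nn_integral], rule nn_integral_mono)
    fix y
    have "ennreal (norm (cnj (f y) * (LINT x|lborel. f x * complex_of_real (G (x - y))))) = ennreal (norm (LINT x|lborel. cnj (f y) * (f x * complex_of_real (G (x - y)))))"
      by simp
    also have "\<dots> \<le> (\<integral>\<^sup>+x. ennreal (norm (cnj (f y) * (f x * complex_of_real (G (x - y))))) \<partial>lborel)"
      by (rule norm_LINT_le_nn_integral)
    also have "\<dots> = (\<integral>\<^sup>+x. ennreal (norm (f y) * norm (f x) * G (x - y)) \<partial>lborel)"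
      using G0 by (simp add: norm_mult mult_ac)
    finally show "ennreal (norm (cnj (f y) * (LINT x|lborel. f x * complex_of_real (G (x - y))))) \<le> (\<integral>\<^sup>+x. ennreal (norm (f y) * norm (f x) * G (x - y)) \<partial>lborel)" .
  qed
  \<comment> \<open>The arithmetic-geometric inequality separates \<open>f x\<close> from
    \<open>f y\<close>. In each half the kernel \<open>G\<close> is integrated over the variable
    that \<open>f\<close> does not contain, and contributes half of the final bound.\<close>
  also have "\<dots> \<le> (\<integral>\<^sup>+y. \<integral>\<^sup>+x. ennreal h * (ennreal ((norm (f y))\<^sup>2) * ennreal (G (x - y))) +
       ennreal h * (ennreal ((norm (f x))\<^sup>2) * ennreal (G (x - y))) \<partial>lborel \<partial>lborel)"
  proof (intro nn_integral_mono)
    fix y x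
    have "norm (f y) * norm (f x) \<le> h * (norm (f y))\<^sup>2 + h * (norm (f x))\<^sup>2"
      unfolding h using sum_squares_bound[of "norm (f y)" "norm (f x)"] by simp
    from mult_right_mono[OF this G0[of "x - y"]]
    have "norm (f y) * norm (f x) * G (x - y) \<le> h * ((norm (f y))\<^sup>2 * G (x - y)) + h * ((norm (f x))\<^sup>2 * G (x - y))"
      by (simp add: algebra_simps)
    moreover have "0 \<le> h" using h by simp
    ultimately show "ennreal (norm (f y) * norm (f x) * G (x - y)) \<le> ennreal h * (ennreal ((norm (f y))\<^sup>2) * ennreal (G (x - y))) +
       ennreal h * (ennreal ((norm (f x))\<^sup>2) * ennreal (G (x - y)))"
      using G0[of "x - y"] by (simp add: ennreal_mult[symmetric] ennreal_plus[symmetric] distrib_right mult.assoc del: ennreal_plus)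
  qed
  also have "\<dots> = (\<integral>\<^sup>+y. \<integral>\<^sup>+x. ennreal h * (ennreal ((norm (f y))\<^sup>2) * ennreal (G (x - y))) \<partial>lborel \<partial>lborel) +
       (\<integral>\<^sup>+y. \<integral>\<^sup>+x. ennreal h * (ennreal ((norm (f x))\<^sup>2) * ennreal (G (x - y))) \<partial>lborel \<partial>lborel)"
    by (simp add: nn_integral_add)
  also have "(\<integral>\<^sup>+y. \<integral>\<^sup>+x. ennreal h * (ennreal ((norm (f x))\<^sup>2) * ennreal (G (x - y))) \<partial>lborel \<partial>lborel) =
     (\<integral>\<^sup>+x. \<integral>\<^sup>+y. ennreal h * (ennreal ((norm (f x))\<^sup>2) * ennreal (G (x - y))) \<partial>lborel \<partial>lborel)"
    by (rule lborel_pair.Fubini') measurable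
  also have "\<dots> = ennreal h * (?S * ?c)"
    by (simp add: nn_integral_cmult nn_integral_multc Gy)
  also have "(\<integral>\<^sup>+y. \<integral>\<^sup>+x. ennreal h * (ennreal ((norm (f y))\<^sup>2) * ennreal (G (x - y))) \<partial>lborel \<partial>lborel) = ennreal h * (?S * ?c)"
    by (simp add: nn_integral_cmult nn_integral_multc Gx)
  also have "ennreal h * (?S * ?c) + ennreal h * (?S * ?c) = (ennreal h + ennreal h) * (?S * ?c)"
    by (rule distrib_right[symmetric])
  also have "\<dots> = ?c * ?S"
  proof -
    have "ennreal h + ennreal h = ennreal (h + h)"
      using h by (intro ennreal_plus[symmetric]) auto
    also have "h + h = 1" using h by simp
    finally show ?thesis by (simp add: mult.commute)
  qed
  finally show ?thesis
    unfolding W_def F_def .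
qed

text \<open>The damping is released along \<open>r = 1 / (n + 1)\<close>: the damped bound does not
  depend on \<open>r\<close>, and Fatou's lemma passes it to the limit.\<close>

lemma plancherel_le:
  fixes f :: "real ^ 'n \<Rightarrow> complex"
  assumes f: "integrable lborel f"
  shows "(\<integral>\<^sup>+\<xi>. ennreal ((norm (LINT x|lborel. cis (x \<bullet> \<xi>) * f x))\<^sup>2) \<partial>lborel)
    \<le> ennreal ((2 * pi) ^ CARD('n)) * (\<integral>\<^sup>+x. ennreal ((norm (f x))\<^sup>2) \<partial>lborel)"
proof -
  define F where "F \<xi> = (LINT x|lborel. cis (x \<bullet> \<xi>) * f x)" for \<xi>
  define W where "W n \<xi> = exp (- (norm ((1 / real (Suc n)) *\<^sub>R \<xi>))\<^sup>2 / 2)" for n and \<xi> :: "real ^ 'n"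
  have [measurable]: "f \<in> borel_measurable borel"
    using f by (auto dest: borel_measurable_integrable)
  have [measurable]: "F \<in> borel_measurable borel"
    unfolding F_def[abs_def] by measurable
  have [measurable]: "W n \<in> borel_measurable borel" for n
    unfolding W_def[abs_def] by measurable
  have lim: "(\<lambda>n. ennreal (W n \<xi> * (norm (F \<xi>))\<^sup>2)) \<longlonglongrightarrow> ennreal ((norm (F \<xi>))\<^sup>2)" for \<xi>
  proof -
    have "(\<lambda>n. inverse (real (Suc n))) \<longlonglongrightarrow> 0" by (rule LIMSEQ_inverse_real_of_nat)
    then have "(\<lambda>n. W n \<xi> * (norm (F \<xi>))\<^sup>2) \<longlonglongrightarrow> exp (- (norm (0 *\<^sub>R \<xi>))\<^sup>2 / 2) * (norm (F \<xi>))\<^sup>2"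
      unfolding W_def inverse_eq_divide by (intro tendsto_intros) simp_all
    then show ?thesis by (intro tendsto_ennrealI) simp
  qed
  have "(\<integral>\<^sup>+\<xi>. ennreal ((norm (F \<xi>))\<^sup>2) \<partial>lborel) = (\<integral>\<^sup>+\<xi>. liminf (\<lambda>n. ennreal (W n \<xi> * (norm (F \<xi>))\<^sup>2)) \<partial>lborel)"
    by (intro nn_integral_cong lim_imp_Liminf[OF _ lim, symmetric]) simp
  also have "\<dots> \<le> liminf (\<lambda>n. \<integral>\<^sup>+\<xi>. ennreal (W n \<xi> * (norm (F \<xi>))\<^sup>2) \<partial>lborel)"
    by (rule nn_integral_liminf) measurable
  also have "\<dots> \<le> ennreal ((2 * pi) ^ CARD('n)) * (\<integral>\<^sup>+x. ennreal ((norm (f x))\<^sup>2) \<partial>lborel)"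
    unfolding W_def F_def
    by (intro order_trans[OF Liminf_le_Limsup] Limsup_bounded always_eventually allI plancherel_le_gaussian[OF f]) simp_all
  finally show ?thesis unfolding F_def .
qed

section \<open>The linear term\<close>

lemma sqrt_norm_scaleR: "\<sigma> \<ge> 0 \<Longrightarrow> (norm (sqrt \<sigma> *\<^sub>R x))\<^sup>2 = \<sigma> * (norm x)\<^sup>2"
  by (simp add: power_mult_distrib)

lemma integrable_norm_power_gaussian:
  fixes \<sigma> :: real
  assumes s: "\<sigma> > 0"
  shows "integrable lborel (\<lambda>x::real ^ 'n. norm x ^ k * exp (- (\<sigma> * (norm x)\<^sup>2)))"
proof -
  \<comment> \<open>Each of the \<open>k\<close> factors \<open>norm x\<close> costs a factor
    \<open>exp (\<delta> * (norm x)\<^sup>2)\<close>; with this \<delta> all of them together use at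
    most half of the exponent \<sigma>.\<close>
  define \<delta> where "\<delta> = \<sigma> / (2 * (real k + 1))"
  have d: "\<delta> > 0" using s by (simp add: \<delta>_def)
  have kd: "real k * \<delta> \<le> \<sigma> / 2"
    using s by (simp add: \<delta>_def field_simps)
  have y: "y \<le> (1 + 1 / \<delta>) * exp (\<delta> * y\<^sup>2)" for y :: real
  proof -
    have "0 \<le> (y - 1/2)\<^sup>2" by simp
    then have 1: "y \<le> 1 + y\<^sup>2" by (simp add: power2_eq_square algebra_simps)
    have 2: "1 \<le> exp (\<delta> * y\<^sup>2)" using d by simp
    have "\<delta> * y\<^sup>2 \<le> exp (\<delta> * y\<^sup>2)"
      using exp_ge_add_one_self[of "\<delta> * y\<^sup>2"] by linarith
    then have "y\<^sup>2 \<le> 1 / \<delta> * exp (\<delta> * y\<^sup>2)"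
      using d by (simp add: field_simps)
    then have "y \<le> exp (\<delta> * y\<^sup>2) + 1 / \<delta> * exp (\<delta> * y\<^sup>2)"
      using 1 2 by linarith
    then show ?thesis by (simp add: distrib_right)
  qed
  have i: "integrable lborel (\<lambda>x::real ^ 'n. exp (- (norm (sqrt \<sigma> *\<^sub>R x))\<^sup>2 / 2))"
    using fourier_gaussian_scaled(1)[of "sqrt \<sigma>" "0 :: real ^ 'n"] s
    by (simp only: inner_zero_right cis_zero mult_1_left complex_of_real_integrable_eq real_sqrt_gt_0_iff)
  show ?thesis
  proof (rule Bochner_Integration.integrable_bound[OF integrable_mult_right[OF i, of "(1 + 1 / \<delta>) ^ k"]])
    show "AE x::real ^ 'n in lborel. norm (norm x ^ k * exp (- (\<sigma> * (norm x)\<^sup>2)))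
        \<le> norm ((1 + 1 / \<delta>) ^ k * exp (- (norm (sqrt \<sigma> *\<^sub>R x))\<^sup>2 / 2))"
    proof (rule AE_I2)
      fix x :: "real ^ 'n"
      have "norm x ^ k \<le> ((1 + 1 / \<delta>) * exp (\<delta> * (norm x)\<^sup>2)) ^ k"
        by (rule power_mono[OF y]) simp
      also have "\<dots> = (1 + 1 / \<delta>) ^ k * exp (real k * (\<delta> * (norm x)\<^sup>2))"
        by (simp add: power_mult_distrib exp_of_nat_mult)
      also have "\<dots> \<le> (1 + 1 / \<delta>) ^ k * exp (\<sigma> / 2 * (norm x)\<^sup>2)"
        using mult_right_mono[OF kd, of "(norm x)\<^sup>2"] d by (intro mult_left_mono) (simp_all add: mult.assoc)
      finally have "norm x ^ k * exp (- (\<sigma> * (norm x)\<^sup>2)) \<le>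
          (1 + 1 / \<delta>) ^ k * exp (\<sigma> / 2 * (norm x)\<^sup>2) * exp (- (\<sigma> * (norm x)\<^sup>2))"
        by (rule mult_right_mono) simp
      also have "\<dots> = (1 + 1 / \<delta>) ^ k * exp (- (norm (sqrt \<sigma> *\<^sub>R x))\<^sup>2 / 2)"
        using s by (simp add: sqrt_norm_scaleR mult.assoc exp_add[symmetric] del: norm_scaleR)
      finally show "norm (norm x ^ k * exp (- (\<sigma> * (norm x)\<^sup>2)))
          \<le> norm ((1 + 1 / \<delta>) ^ k * exp (- (norm (sqrt \<sigma> *\<^sub>R x))\<^sup>2 / 2))"
        using d by (simp add: abs_mult del: norm_scaleR)
    qed
  qed simp
qed

text \<open>Positive sign in the exponent and no normalisation. \<open>fourier\<close> is
  \<open>ft\<close> at the reflected frequency and \<open>inv_fourier\<close> is \<open>ft\<close>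
  divided by \<open>(2 * pi) ^ CARD('n)\<close>, so one transform serves both, at least for Borel
  integrands.\<close>

definition ft :: "(real ^ 'n \<Rightarrow> complex) \<Rightarrow> real ^ 'n \<Rightarrow> complex" where
  "ft f \<xi> = (LINT x|lborel. cis (x \<bullet> \<xi>) * f x)"

lemma norm_ft_le: "norm (ft f \<xi>) \<le> (LINT x|lborel. norm (f x))"
  unfolding ft_def by (rule order_trans[OF integral_norm_bound]) (simp add: norm_mult)

lemma borel_measurable_ft [measurable]:
  assumes [measurable]: "f \<in> borel_measurable borel"
  shows "ft f \<in> borel_measurable borel"
  unfolding ft_def[abs_def] by measurable

lemma norm_ft_minus_real:
  assumes f: "integrable lborel f"
  shows "norm (ft (\<lambda>y. complex_of_real (f y)) (- \<xi>)) = norm (ft (\<lambda>y. complex_of_real (f y)) \<xi>)"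
proof -
  have [measurable]: "f \<in> borel_measurable borel"
    using f by (auto dest: borel_measurable_integrable)
  have "ft (\<lambda>y. complex_of_real (f y)) (- \<xi>) = cnj (ft (\<lambda>y. complex_of_real (f y)) \<xi>)"
    unfolding ft_def using f
    by (subst integral_bounded_linear[OF bounded_linear_cnj, symmetric])
       (auto intro!: integrable_cis_mult simp: cis_cnj)
  then show ?thesis by simp
qed

text \<open>The multiplication formula of the Fourier transform. Dilating \<phi> by \<open>c\<close>
  contracts its transform by \<open>c\<close> with the Jacobian \<open>c ^ CARD('n)\<close>, which
  the change of variables in frequency removes again. All dependence on the scale thus ends up in
  the argument of the symbol \<open>m\<close>.\<close>

lemma ft_pairing:
  fixes m \<phi> :: "real ^ 'n \<Rightarrow> complex"
  assumes m: "integrable lborel m" and \<phi>: "integrable lborel \<phi>" and c: "c > 0"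
  shows "(LINT x|lborel. \<phi> ((1 / c) *\<^sub>R x) * ft m x) = (LINT \<eta>|lborel. m ((1 / c) *\<^sub>R \<eta>) * ft \<phi> \<eta>)"
proof -
  have [measurable]: "m \<in> borel_measurable borel" "\<phi> \<in> borel_measurable borel"
    using m \<phi> by (auto dest: borel_measurable_integrable)
  have i: "integrable lborel (\<lambda>x. norm (\<phi> ((1 / c) *\<^sub>R x)))"
    using c by (intro integrable_norm) (subst lborel_integrable_scaleR, simp_all add: \<phi>)
  have "(LINT x|lborel. \<phi> ((1 / c) *\<^sub>R x) * ft m x) =
      (LINT x|lborel. LINT \<xi>|lborel. \<phi> ((1 / c) *\<^sub>R x) * (cis (\<xi> \<bullet> x) * m \<xi>))"
    unfolding ft_def by simp
  also have "\<dots> = (LINT \<xi>|lborel. LINT x|lborel. \<phi> ((1 / c) *\<^sub>R x) * (cis (\<xi> \<bullet> x) * m \<xi>))"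
    by (rule swap_integrals[OF _ i integrable_norm[OF m]]) (simp_all add: norm_mult)
  also have "\<dots> = (LINT \<xi>|lborel. m \<xi> * (LINT x|lborel. cis (\<xi> \<bullet> x) * \<phi> ((1 / c) *\<^sub>R x)))"
    unfolding integral_mult_right_zero[symmetric]
    by (intro Bochner_Integration.integral_cong refl) (simp only: mult_ac)
  also have "\<dots> = (LINT \<xi>|lborel. c ^ CARD('n) *\<^sub>R (m \<xi> * ft \<phi> (c *\<^sub>R \<xi>)))"
  proof (intro Bochner_Integration.integral_cong refl)
    fix \<xi> :: "real ^ 'n"
    have "(LINT x|lborel. cis (\<xi> \<bullet> x) * \<phi> ((1 / c) *\<^sub>R x)) = c ^ CARD('n) *\<^sub>R ft \<phi> (c *\<^sub>R \<xi>)"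
      unfolding ft_def using c by (subst lborel_integral_scaleR[OF c]) (simp add: inner_commute)
    then show "m \<xi> * (LINT x|lborel. cis (\<xi> \<bullet> x) * \<phi> ((1 / c) *\<^sub>R x)) = c ^ CARD('n) *\<^sub>R (m \<xi> * ft \<phi> (c *\<^sub>R \<xi>))"
      by simp
  qed
  also have "\<dots> = (LINT \<eta>|lborel. m ((1 / c) *\<^sub>R \<eta>) * ft \<phi> \<eta>)"
    using c by (subst (2) lborel_integral_scaleR[OF c]) simp
  finally show ?thesis .
qed

section \<open>Closed forms and measurability of the symbols\<close>

lemma sym_laplace_eq: "sym_laplace \<xi> = - of_real ((norm \<xi>)\<^sup>2)"
proof -
  have "\<i> * complex_of_real c * (\<i> * complex_of_real c) = - complex_of_real (c\<^sup>2)" for c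
    by (simp add: complex_eq_iff power2_eq_square)
  then show ?thesis
    by (simp only: sym_laplace_def sym_deriv_def norm2_vec sum_negf of_real_sum)
qed

lemma sym_heat_eq: "sym_heat t \<xi> = of_real (exp (- (t * (norm \<xi>)\<^sup>2)))"
  by (simp add: sym_heat_def sym_laplace_eq exp_of_real[symmetric])

lemma borel_measurable_vec_nth_comp [measurable (raw)]:
  fixes f :: "'a \<Rightarrow> real ^ 'n"
  shows "f \<in> borel_measurable M \<Longrightarrow> (\<lambda>x. f x $ i) \<in> borel_measurable M"
  by (rule measurable_compose[of _ _ borel]) (auto intro!: borel_measurable_continuous_onI continuous_intros)

lemma measurable_sym_heat [measurable (raw)]:
  fixes g :: "'a \<Rightarrow> real ^ 'n"
  assumes [measurable]: "f \<in> borel_measurable M" "g \<in> borel_measurable M"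
  shows "(\<lambda>x. sym_heat (f x) (g x)) \<in> borel_measurable M"
  unfolding sym_heat_eq by measurable

lemma measurable_sym_deriv [measurable]: "sym_deriv j \<in> borel_measurable borel"
  unfolding sym_deriv_def[abs_def] by measurable

lemma measurable_sym_leray [measurable]: "sym_leray j k \<in> borel_measurable borel"
  unfolding sym_leray_def[abs_def] sym_laplace_eq by measurable

lemma multiplier_eq_ft:
  fixes m :: "real ^ 'n \<Rightarrow> complex"
  assumes [measurable]: "m \<in> borel_measurable borel" "g \<in> borel_measurable borel"
  shows "multiplier m g x = of_real (1 / (2 * pi) ^ CARD('n)) * ft (\<lambda>\<xi>. m \<xi> * ft (\<lambda>y. of_real (g y)) (- \<xi>)) x"
proof -
  have 1: "fourier (\<lambda>x. of_real (g x)) \<xi> = ft (\<lambda>y. of_real (g y)) (- \<xi>)" for \<xi>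
    unfolding fourier_def ft_def by (subst integral_completion) (simp_all add: inner_commute)
  have [measurable]: "(\<lambda>\<xi>. ft (\<lambda>y. of_real (g y)) (- \<xi>)) \<in> borel_measurable borel"
    by measurable
  show ?thesis
    unfolding multiplier_def inv_fourier_def 1 ft_def[of "\<lambda>\<xi>. m \<xi> * _ \<xi>"]
    by (subst integral_completion) (simp_all add: inner_commute)
qed

text \<open>Testing \<open>exp (t \<Delta>) a\<close> at scale \<open>sqrt t\<close> amounts to integrating \<open>a\<close> against the rescaled
  \<open>M = exp \<Delta> \<phi>\<close>, whose quadratic vanishing at the origin makes the limit zero.\<close>

lemma heat_pairing_tendsto_0:
  fixes a :: "real ^ 'n \<Rightarrow> real" and \<phi> :: "real ^ 'n \<Rightarrow> complex"
  defines "M \<equiv> \<lambda>y. LINT \<eta>|lborel. cis (- (y \<bullet> \<eta>)) * (of_real (exp (- (norm \<eta>)\<^sup>2)) * ft \<phi> \<eta>)"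
  assumes a: "integrable lborel a" "integrable lborel (\<lambda>x. norm x * a x)"
    and \<phi>: "integrable lborel \<phi>"
    and M1: "\<And>y. norm (M y) \<le> C * norm y" and M2: "\<And>y. norm (M y) \<le> C * (norm y)\<^sup>2"
  shows "((\<lambda>t. of_real (sqrt t) * (LINT x|lborel. \<phi> ((1 / sqrt t) *\<^sub>R x) * multiplier (sym_heat t) a x)) \<longlongrightarrow> 0) at_top"
proof -
  let ?K = "complex_of_real (1 / (2 * pi) ^ CARD('n))"
  have [measurable]: "a \<in> borel_measurable borel" "\<phi> \<in> borel_measurable borel"
    using a \<phi> by (auto dest: borel_measurable_integrable)
  have [measurable]: "M \<in> borel_measurable borel"
    unfolding M_def by measurable
  have C: "C \<ge> 0"
    using order_trans[OF norm_ge_zero M1[of "axis undefined 1"]] by simp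
  let ?A = "ft (\<lambda>y. complex_of_real (a y))"
  define Na where "Na = (LINT y|lborel. \<bar>a y\<bar>)"
  have A_le: "norm (?A \<xi>) \<le> Na" for \<xi>
    using norm_ft_le[of "\<lambda>y. complex_of_real (a y)" \<xi>] by (simp add: Na_def)
  define N\<phi> where "N\<phi> = (LINT x|lborel. norm (\<phi> x))"
  have N\<phi>: "norm (ft \<phi> \<eta>) \<le> N\<phi>" for \<eta>
    unfolding N\<phi>_def by (rule norm_ft_le)
  have gauss: "integrable lborel (\<lambda>x::real ^ 'n. exp (- (t * (norm x)\<^sup>2)))" if "t > 0" for t
    using integrable_norm_power_gaussian[OF that, of 0] by simp
  have eq: "of_real (sqrt t) * (LINT x|lborel. \<phi> ((1 / sqrt t) *\<^sub>R x) * multiplier (sym_heat t) a x) =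
      ?K * (LINT x|lborel. of_real (a x) * (of_real (sqrt t) * M ((1 / sqrt t) *\<^sub>R x)))" if t: "t > 0" for t
  proof -
    have c: "sqrt t > 0" using t by simp
    let ?m = "\<lambda>\<xi>::real ^ 'n. sym_heat t \<xi> * ?A (- \<xi>)"
    have mi: "integrable lborel ?m"
      by (rule Bochner_Integration.integrable_bound[OF integrable_mult_left[OF gauss[OF t], of Na]])
         (auto simp: norm_mult sym_heat_eq A_le intro!: order_trans[OF _ abs_ge_self] mult_left_mono)
    have "(LINT x|lborel. \<phi> ((1 / sqrt t) *\<^sub>R x) * multiplier (sym_heat t) a x) =
        ?K * (LINT x|lborel. \<phi> ((1 / sqrt t) *\<^sub>R x) * ft ?m x)"
      unfolding integral_mult_right_zero[symmetric]
      by (intro Bochner_Integration.integral_cong refl) (subst multiplier_eq_ft, simp_all add: mult_ac)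
    also have "(LINT x|lborel. \<phi> ((1 / sqrt t) *\<^sub>R x) * ft ?m x) = (LINT \<eta>|lborel. ?m ((1 / sqrt t) *\<^sub>R \<eta>) * ft \<phi> \<eta>)"
      by (rule ft_pairing[OF mi \<phi> c])
    also have "\<dots> = (LINT \<eta>|lborel. LINT x|lborel. of_real (a x) *
        (cis (- (((1 / sqrt t) *\<^sub>R x) \<bullet> \<eta>)) * (of_real (exp (- (norm \<eta>)\<^sup>2)) * ft \<phi> \<eta>)))"
    proof (intro Bochner_Integration.integral_cong refl)
      fix \<eta> :: "real ^ 'n"
      have h: "sym_heat t ((1 / sqrt t) *\<^sub>R \<eta>) = of_real (exp (- (norm \<eta>)\<^sup>2))"
        using t by (simp add: sym_heat_eq power_divide)
      have "?m ((1 / sqrt t) *\<^sub>R \<eta>) * ft \<phi> \<eta> =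
          (of_real (exp (- (norm \<eta>)\<^sup>2)) * ft \<phi> \<eta>) * ?A (- ((1 / sqrt t) *\<^sub>R \<eta>))"
        unfolding h by (simp only: mult_ac)
      also have "\<dots> = (LINT x|lborel. of_real (a x) *
          (cis (- (((1 / sqrt t) *\<^sub>R x) \<bullet> \<eta>)) * (of_real (exp (- (norm \<eta>)\<^sup>2)) * ft \<phi> \<eta>)))"
        unfolding ft_def[of "\<lambda>y. complex_of_real (a y)"] integral_mult_right_zero[symmetric]
        by (intro Bochner_Integration.integral_cong refl)
           (simp only: mult_ac inner_minus_right inner_scaleR_left inner_scaleR_right)
      finally show "?m ((1 / sqrt t) *\<^sub>R \<eta>) * ft \<phi> \<eta> = (LINT x|lborel. of_real (a x) *
        (cis (- (((1 / sqrt t) *\<^sub>R x) \<bullet> \<eta>)) * (of_real (exp (- (norm \<eta>)\<^sup>2)) * ft \<phi> \<eta>)))" .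
    qed
    also have "\<dots> = (LINT x|lborel. LINT \<eta>|lborel. of_real (a x) *
        (cis (- (((1 / sqrt t) *\<^sub>R x) \<bullet> \<eta>)) * (of_real (exp (- (norm \<eta>)\<^sup>2)) * ft \<phi> \<eta>)))"
    proof (rule swap_integrals)
      show "integrable lborel (\<lambda>\<eta>::real ^ 'n. exp (- (norm \<eta>)\<^sup>2) * N\<phi>)"
        using gauss[of 1] by simp
      show "integrable lborel (\<lambda>x. \<bar>a x\<bar>)" using a(1) by (rule integrable_abs)
      show "norm (of_real (a x) * (cis (- (((1 / sqrt t) *\<^sub>R x) \<bullet> \<eta>)) * (of_real (exp (- (norm \<eta>)\<^sup>2)) * ft \<phi> \<eta>)))
          \<le> exp (- (norm \<eta>)\<^sup>2) * N\<phi> * \<bar>a x\<bar>" for \<eta> x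
        using mult_right_mono[OF mult_left_mono[OF N\<phi>[of \<eta>], of "exp (- (norm \<eta>)\<^sup>2)"], of "\<bar>a x\<bar>"]
        by (simp add: norm_mult mult_ac)
    qed measurable
    also have "\<dots> = (LINT x|lborel. of_real (a x) * M ((1 / sqrt t) *\<^sub>R x))"
      unfolding M_def by simp
    finally show ?thesis
      by (simp only: integral_mult_right_zero[symmetric] mult_ac)
  qed
  \<comment> \<open>The two bounds on \<open>M\<close> have different tasks. The linear one
    \<open>M1\<close> gives the majorant \<open>C * norm (norm x * a x)\<close>, independent of
    \<open>t\<close> and integrable by the first moment of \<open>a\<close>; the quadratic one
    \<open>M2\<close> gives pointwise decay of order \<open>1 / sqrt t\<close>.\<close>
  have "((\<lambda>t. LINT x|lborel. of_real (a x) * (of_real (sqrt t) * M ((1 / sqrt t) *\<^sub>R x))) \<longlongrightarrow> (LINT x::real ^ 'n|lborel. 0)) at_top"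
  proof (rule integral_dominated_convergence_at_top)
    show "integrable lborel (\<lambda>x. C * norm (norm x * a x))"
      using a(2) by (intro integrable_mult_right integrable_norm)
    show "\<forall>\<^sub>F t in at_top. AE x in lborel. norm (of_real (a x) * (of_real (sqrt t) * M ((1 / sqrt t) *\<^sub>R x))) \<le> C * norm (norm x * a x)"
      using eventually_gt_at_top[of 0]
    proof eventually_elim
      case (elim t)
      show ?case
      proof (rule AE_I2)
        fix x :: "real ^ 'n"
        have "sqrt t * norm (M ((1 / sqrt t) *\<^sub>R x)) \<le> sqrt t * (C * norm ((1 / sqrt t) *\<^sub>R x))"
          by (intro mult_left_mono M1) (use elim in simp)
        also have "\<dots> = C * norm x" using elim by simp
        finally have "\<bar>a x\<bar> * (sqrt t * norm (M ((1 / sqrt t) *\<^sub>R x))) \<le> \<bar>a x\<bar> * (C * norm x)"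
          by (rule mult_left_mono) simp
        then show "norm (of_real (a x) * (of_real (sqrt t) * M ((1 / sqrt t) *\<^sub>R x))) \<le> C * norm (norm x * a x)"
          using elim by (simp add: norm_mult abs_mult mult_ac)
      qed
    qed
    show "AE x in lborel. ((\<lambda>t. of_real (a x) * (of_real (sqrt t) * M ((1 / sqrt t) *\<^sub>R x))) \<longlongrightarrow> 0) at_top"
    proof (rule AE_I2)
      fix x :: "real ^ 'n"
      have "((\<lambda>t. C * (norm x)\<^sup>2 * inverse (sqrt t)) \<longlongrightarrow> C * (norm x)\<^sup>2 * 0) at_top"
        by (intro tendsto_intros tendsto_inverse_0_at_top sqrt_at_top)
      then have l: "((\<lambda>t. C * (norm x)\<^sup>2 * inverse (sqrt t)) \<longlongrightarrow> 0) at_top" by simp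
      have "((\<lambda>t. of_real (sqrt t) * M ((1 / sqrt t) *\<^sub>R x)) \<longlongrightarrow> 0) at_top"
      proof (rule Lim_null_comparison[OF _ l])
        show "\<forall>\<^sub>F t in at_top. norm (of_real (sqrt t) * M ((1 / sqrt t) *\<^sub>R x)) \<le> C * (norm x)\<^sup>2 * inverse (sqrt t)"
          using eventually_gt_at_top[of 0]
        proof eventually_elim
          case (elim t)
          have "sqrt t * norm (M ((1 / sqrt t) *\<^sub>R x)) \<le> sqrt t * (C * (norm ((1 / sqrt t) *\<^sub>R x))\<^sup>2)"
            by (intro mult_left_mono M2) (use elim in simp)
          also have "\<dots> = C * (norm x)\<^sup>2 * inverse (sqrt t)"
            using elim by (simp add: power2_eq_square field_simps)
          finally show ?case using elim by (simp add: norm_mult)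
        qed
      qed
      from tendsto_mult_left[OF this, of "of_real (a x)"]
      show "((\<lambda>t. of_real (a x) * (of_real (sqrt t) * M ((1 / sqrt t) *\<^sub>R x))) \<longlongrightarrow> 0) at_top" by simp
    qed
  qed measurable
  from tendsto_mult_left[OF this, of ?K]
  have "((\<lambda>t. ?K * (LINT x|lborel. of_real (a x) * (of_real (sqrt t) * M ((1 / sqrt t) *\<^sub>R x)))) \<longlongrightarrow> 0) at_top"
    by simp
  then show ?thesis
    by (rule Lim_transform_eventually)
       (use eventually_gt_at_top[of 0] in \<open>eventually_elim, simp only: eq\<close>)
qed

section \<open>The Duhamel term\<close>

lemma nn_integral_inverse_sqrt_finite:
  assumes t: "t > 0"
  shows "(\<integral>\<^sup>+s. ennreal (indicator {0..<t} s * (t - s) powr (- 1 / 2)) \<partial>lborel) < \<infinity>"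
proof -
  let ?f = "\<lambda>r::real. if r \<in> {0..t} then r powr (- 1 / 2) else 0"
  have f: "?f \<in> borel_measurable borel" by measurable
  have "(?f has_integral (t powr (- 1 / 2 + 1) / (- 1 / 2 + 1))) UNIV"
    unfolding has_integral_restrict_UNIV using t by (intro has_integral_powr_from_0) auto
  then have 1: "(\<integral>\<^sup>+r. ennreal (?f r) \<partial>lborel) = ennreal (t powr (- 1 / 2 + 1) / (- 1 / 2 + 1))"
    by (intro nn_integral_has_integral_lborel[OF f]) auto
  have "(\<integral>\<^sup>+r. ennreal (?f r) \<partial>lborel) = (\<integral>\<^sup>+s. ennreal (?f (t + (- 1) * s)) \<partial>lborel)"
    using nn_integral_real_affine[of "\<lambda>r. ennreal (?f r)" "-1" t] f by simp
  with 1 have "(\<integral>\<^sup>+s. ennreal (?f (t + (- 1) * s)) \<partial>lborel) = ennreal (t powr (- 1 / 2 + 1) / (- 1 / 2 + 1))"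
    by (simp only:)
  then have 2: "(\<integral>\<^sup>+s. ennreal (?f (t + (- 1) * s)) \<partial>lborel) < \<infinity>"
    by (simp only: ennreal_less_top infinity_ennreal_def)
  show ?thesis
    by (rule order.strict_trans1[OF nn_integral_mono 2]) (auto simp: indicator_def)
qed

text \<open>One scalar summand of the Duhamel term in abstract form: \<open>g\<close> stands for a
  product of two velocity components, with a bound separated into space and time, and
  \<open>P\<close> for an entry of the Leray symbol times a derivative, homogeneous of degree one
  and possibly discontinuous in higher order at the origin. The bounds \<open>w x \<le> 1\<close>
  and \<open>e s \<le> 1\<close> allow squares and crude estimates to reuse the same
  weights.\<close>

locale duhamel_term =
  fixes g :: "real \<Rightarrow> real ^ 'n \<Rightarrow> real" and P \<phi> :: "real ^ 'n \<Rightarrow> complex"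
    and w :: "real ^ 'n \<Rightarrow> real" and e :: "real \<Rightarrow> real" and K c B :: real
  assumes g_pair: "(\<lambda>z. g (fst z) (snd z)) \<in> borel_measurable (borel \<Otimes>\<^sub>M borel)"
    and g_le: "\<And>s x. s \<ge> 0 \<Longrightarrow> \<bar>g s x\<bar> \<le> K * (w x * e s)"
    and w: "integrable lborel w" "\<And>x. 0 \<le> w x" "\<And>x. w x \<le> 1"
    and e: "integrable lborel e" "\<And>s. 0 \<le> e s" "\<And>s. e s \<le> 1"
    and K: "K \<ge> 0"
    and P_meas [measurable]: "P \<in> borel_measurable borel"
    and P_le: "\<And>\<xi>. norm (P \<xi>) \<le> c * norm \<xi>"
    and P_hom: "\<And>r \<xi>. r > 0 \<Longrightarrow> P (r *\<^sub>R \<xi>) = of_real r * P \<xi>"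
    and phi: "integrable lborel \<phi>" "\<And>x. norm (\<phi> x) \<le> B"
    and ft_phi: "integrable lborel (\<lambda>\<eta>. norm \<eta> * norm (ft \<phi> \<eta>))"
begin

lemma g_meas [measurable (raw)]:
  assumes [measurable]: "p \<in> borel_measurable M" "q \<in> borel_measurable M"
  shows "(\<lambda>x. g (p x) (q x)) \<in> borel_measurable M"
  using measurable_compose[OF measurable_Pair[OF assms] g_pair] by simp

lemma w_meas [measurable]: "w \<in> borel_measurable borel"
  and e_meas [measurable]: "e \<in> borel_measurable borel"
  and phi_meas [measurable]: "\<phi> \<in> borel_measurable borel"
  using w e phi by (auto dest: borel_measurable_integrable)

lemma c_nonneg: "c \<ge> 0"
  using order_trans[OF norm_ge_zero P_le[of "axis undefined 1"]] by simp

lemma B_nonneg: "B \<ge> 0"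
  using order_trans[OF norm_ge_zero phi(2)[of 0]] .

definition W where "W = (LINT x|lborel. w x)"

lemma W_nonneg: "W \<ge> 0"
  unfolding W_def using w by (intro integral_nonneg_AE) auto

definition g_hat where "g_hat s \<xi> = (LINT y|lborel. cis (y \<bullet> \<xi>) * of_real (g s y))"

lemma g_hat_meas [measurable (raw)]:
  assumes [measurable]: "p \<in> borel_measurable M" "q \<in> borel_measurable M"
  shows "(\<lambda>x. g_hat (p x) (q x)) \<in> borel_measurable M"
  unfolding g_hat_def by measurable

lemma g_integrable: 
  assumes s: "s \<ge> 0"
  shows "integrable lborel (g s)"
  by (rule Bochner_Integration.integrable_bound[OF integrable_mult_right[OF w(1), of "K * e s"]])
     (use g_le[OF s] w e K in \<open>auto simp: mult_ac abs_mult\<close>)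

lemma g_hat_le:
  assumes s: "s \<ge> 0"
  shows "norm (g_hat s \<xi>) \<le> K * W * e s"
proof -
  have "norm (g_hat s \<xi>) \<le> (LINT y|lborel. \<bar>g s y\<bar>)"
    using norm_ft_le[of "\<lambda>y. complex_of_real (g s y)" \<xi>] by (simp add: g_hat_def ft_def)
  also have "\<dots> \<le> (LINT y|lborel. K * e s * w y)"
    using g_le[OF s] g_integrable[OF s] w by (intro integral_mono) (auto simp: mult_ac)
  also have "\<dots> = K * W * e s" by (simp add: W_def)
  finally show ?thesis .
qed

definition m where "m \<tau> s \<xi> = sym_heat \<tau> \<xi> * P \<xi> * g_hat s (- \<xi>)"

lemma m_meas [measurable (raw)]:
  assumes [measurable]: "p \<in> borel_measurable M" "q \<in> borel_measurable M" "r \<in> borel_measurable M"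
  shows "(\<lambda>x. m (p x) (q x) (r x)) \<in> borel_measurable M"
  unfolding m_def by measurable

lemma norm_m_le:
  assumes s: "s \<ge> 0"
  shows "norm (m \<tau> s \<xi>) \<le> c * (K * W) * (norm \<xi> * exp (- (\<tau> * (norm \<xi>)\<^sup>2)))"
proof -
  have "norm (m \<tau> s \<xi>) = exp (- (\<tau> * (norm \<xi>)\<^sup>2)) * (norm (P \<xi>) * norm (g_hat s (- \<xi>)))"
    by (simp add: m_def norm_mult sym_heat_eq mult_ac)
  also have "norm (g_hat s (- \<xi>)) \<le> K * W"
    using g_hat_le[OF s, of "- \<xi>"] mult_left_mono[OF e(3), of "K * W" s] K W_nonneg by simp
  then have "exp (- (\<tau> * (norm \<xi>)\<^sup>2)) * (norm (P \<xi>) * norm (g_hat s (- \<xi>))) \<le> exp (- (\<tau> * (norm \<xi>)\<^sup>2)) * ((c * norm \<xi>) * (K * W))"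
    using P_le[of \<xi>] c_nonneg by (intro mult_left_mono mult_mono) auto
  finally show ?thesis by (simp add: mult_ac)
qed

lemma m_integrable:
  assumes s: "s \<ge> 0" and \<tau>: "\<tau> > 0"
  shows "integrable lborel (m \<tau> s)"
  by (rule Bochner_Integration.integrable_bound
      [OF integrable_mult_right[OF integrable_norm_power_gaussian[OF \<tau>, of 1], of "c * (K * W)"]])
     (auto intro!: order_trans[OF norm_m_le[OF s]] order_trans[OF _ abs_ge_self])

definition T where "T \<tau> s x = of_real (1 / (2 * pi) ^ CARD('n)) * (LINT \<xi>|lborel. cis (\<xi> \<bullet> x) * m \<tau> s \<xi>)"

lemma T_meas [measurable (raw)]:
  assumes [measurable]: "p \<in> borel_measurable M" "q \<in> borel_measurable M" "r \<in> borel_measurable M"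
  shows "(\<lambda>x. T (p x) (q x) (r x)) \<in> borel_measurable M"
  unfolding T_def by measurable

lemma multiplier_eq_evolved: "multiplier (\<lambda>\<xi>. sym_heat \<tau> \<xi> * P \<xi>) (g s) x = T \<tau> s x"
  by (subst multiplier_eq_ft) (simp_all add: T_def m_def ft_def g_hat_def)

lemma T_eq_ft: "T \<tau> s x = of_real (1 / (2 * pi) ^ CARD('n)) * ft (m \<tau> s) x"
  by (simp add: T_def ft_def)

text \<open>Plancherel's inequality is used twice, from \<open>g\<close> to \<open>g_hat\<close> and
  from \<open>m\<close> to \<open>T\<close>. In between, the growth of the symbol is paid by the
  heat factor, as |\<xi>|^2 exp(-2 \<tau> |\<xi>|^2) is at most 1 / \<tau>. The two factors \<kappa>
  cancel against the squared normalisation of the inverse transform.\<close>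

lemma T_L2:
  assumes s: "s \<ge> 0" and \<tau>: "\<tau> > 0"
  shows "(\<integral>\<^sup>+x. ennreal ((norm (T \<tau> s x))\<^sup>2) \<partial>lborel) \<le> ennreal (c\<^sup>2 * K\<^sup>2 * W / \<tau>)"
proof -
  define \<kappa> :: real where "\<kappa> = (2 * pi) ^ CARD('n)"
  have \<kappa>: "\<kappa> > 0" by (simp add: \<kappa>_def)
  have g2: "(\<integral>\<^sup>+y. ennreal ((g s y)\<^sup>2) \<partial>lborel) \<le> ennreal (K\<^sup>2 * W)"
  proof -
    have "(\<integral>\<^sup>+y. ennreal ((g s y)\<^sup>2) \<partial>lborel) \<le> (\<integral>\<^sup>+y. ennreal (K\<^sup>2 * w y) \<partial>lborel)"
    proof (intro nn_integral_mono ennreal_leI)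
      fix y
      have "\<bar>g s y\<bar> \<le> K * w y"
        using g_le[OF s, of y] mult_left_mono[OF e(3)[of s], of "K * w y"] K w(2)[of y] by (simp add: mult_ac)
      then have "(g s y)\<^sup>2 \<le> (K * w y)\<^sup>2"
        using K w(2)[of y] by (intro abs_le_square_iff[THEN iffD1]) auto
      also have "\<dots> \<le> K\<^sup>2 * w y"
        using mult_left_mono[OF w(3)[of y] w(2)[of y]] by (simp add: power_mult_distrib power2_eq_square[of "w y"] mult_left_mono)
      finally show "(g s y)\<^sup>2 \<le> K\<^sup>2 * w y" .
    qed
    also have "\<dots> = ennreal (K\<^sup>2 * W)"
      using w by (subst nn_integral_eq_integral) (auto simp: W_def)
    finally show ?thesis .
  qed
  have gh2: "(\<integral>\<^sup>+\<xi>. ennreal ((norm (g_hat s (- \<xi>)))\<^sup>2) \<partial>lborel) \<le> ennreal (\<kappa> * (K\<^sup>2 * W))"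
  proof -
    have "norm (g_hat s (- \<xi>)) = norm (LINT x|lborel. cis (x \<bullet> \<xi>) * complex_of_real (g s x))" for \<xi>
      using norm_ft_minus_real[OF g_integrable[OF s], of \<xi>] by (simp add: g_hat_def ft_def)
    then have "(\<integral>\<^sup>+\<xi>. ennreal ((norm (g_hat s (- \<xi>)))\<^sup>2) \<partial>lborel) \<le>
        ennreal \<kappa> * (\<integral>\<^sup>+x. ennreal ((norm (complex_of_real (g s x)))\<^sup>2) \<partial>lborel)"
      using plancherel_le[of "\<lambda>x. complex_of_real (g s x)"] g_integrable[OF s] by (simp add: \<kappa>_def del: power_mult_distrib)
    also have "\<dots> \<le> ennreal \<kappa> * ennreal (K\<^sup>2 * W)"
      using g2 by (intro mult_left_mono) auto
    finally show ?thesis using W_nonneg \<kappa> by (simp add: ennreal_mult)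
  qed
  have m2: "(\<integral>\<^sup>+\<xi>. ennreal ((norm (m \<tau> s \<xi>))\<^sup>2) \<partial>lborel) \<le> ennreal (c\<^sup>2 / \<tau>) * ennreal (\<kappa> * (K\<^sup>2 * W))"
  proof -
    have "(norm (m \<tau> s \<xi>))\<^sup>2 \<le> c\<^sup>2 / \<tau> * (norm (g_hat s (- \<xi>)))\<^sup>2" for \<xi>
    proof -
      have "\<tau> * (norm \<xi>)\<^sup>2 \<le> exp (\<tau> * (norm \<xi>)\<^sup>2)"
        using exp_ge_add_one_self[of "\<tau> * (norm \<xi>)\<^sup>2"] by linarith
      also have "\<dots> \<le> exp (2 * (\<tau> * (norm \<xi>)\<^sup>2))" using \<tau> by simp
      finally have "\<tau> * (norm \<xi>)\<^sup>2 * exp (- (2 * (\<tau> * (norm \<xi>)\<^sup>2))) \<le> 1"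
        by (simp add: exp_minus field_simps)
      then have 1: "(norm \<xi>)\<^sup>2 * exp (- (2 * (\<tau> * (norm \<xi>)\<^sup>2))) \<le> 1 / \<tau>"
        using \<tau> by (simp add: field_simps)
      have "(norm (m \<tau> s \<xi>))\<^sup>2 = exp (- (2 * (\<tau> * (norm \<xi>)\<^sup>2))) * ((norm (P \<xi>))\<^sup>2 * (norm (g_hat s (- \<xi>)))\<^sup>2)"
        by (simp add: m_def norm_mult sym_heat_eq power_mult_distrib exp_double[symmetric] mult_ac)
      also have "\<dots> \<le> exp (- (2 * (\<tau> * (norm \<xi>)\<^sup>2))) * ((c * norm \<xi>)\<^sup>2 * (norm (g_hat s (- \<xi>)))\<^sup>2)"
        using P_le[of \<xi>] by (intro mult_left_mono mult_right_mono power_mono) auto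
      also have "\<dots> = c\<^sup>2 * (norm (g_hat s (- \<xi>)))\<^sup>2 * ((norm \<xi>)\<^sup>2 * exp (- (2 * (\<tau> * (norm \<xi>)\<^sup>2))))"
        by (simp add: power_mult_distrib mult_ac)
      also have "\<dots> \<le> c\<^sup>2 * (norm (g_hat s (- \<xi>)))\<^sup>2 * (1 / \<tau>)"
        using 1 by (intro mult_left_mono) auto
      finally show ?thesis by simp
    qed
    then have "(\<integral>\<^sup>+\<xi>. ennreal ((norm (m \<tau> s \<xi>))\<^sup>2) \<partial>lborel) \<le>
        (\<integral>\<^sup>+\<xi>. ennreal (c\<^sup>2 / \<tau>) * ennreal ((norm (g_hat s (- \<xi>)))\<^sup>2) \<partial>lborel)"
      using \<tau> by (intro nn_integral_mono) (simp add: ennreal_mult[symmetric])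
    also have "\<dots> = ennreal (c\<^sup>2 / \<tau>) * (\<integral>\<^sup>+\<xi>. ennreal ((norm (g_hat s (- \<xi>)))\<^sup>2) \<partial>lborel)"
      by (rule nn_integral_cmult) measurable
    also have "\<dots> \<le> ennreal (c\<^sup>2 / \<tau>) * ennreal (\<kappa> * (K\<^sup>2 * W))"
      by (rule mult_left_mono[OF gh2]) simp
    finally show ?thesis .
  qed
  have "(\<integral>\<^sup>+x. ennreal ((norm (T \<tau> s x))\<^sup>2) \<partial>lborel) =
      (\<integral>\<^sup>+x. ennreal (1 / \<kappa>\<^sup>2) * ennreal ((norm (ft (m \<tau> s) x))\<^sup>2) \<partial>lborel)"
    by (intro nn_integral_cong)
       (simp add: T_eq_ft[folded \<kappa>_def] norm_mult norm_divide norm_power power_mult_distrib power_divide ennreal_mult[symmetric])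
  also have "\<dots> = ennreal (1 / \<kappa>\<^sup>2) * (\<integral>\<^sup>+x. ennreal ((norm (ft (m \<tau> s) x))\<^sup>2) \<partial>lborel)"
    by (rule nn_integral_cmult) measurable
  also have "\<dots> \<le> ennreal (1 / \<kappa>\<^sup>2) * (ennreal \<kappa> * (ennreal (c\<^sup>2 / \<tau>) * ennreal (\<kappa> * (K\<^sup>2 * W))))"
    by (intro mult_left_mono order_trans[OF plancherel_le[OF m_integrable[OF s \<tau>], folded ft_def \<kappa>_def] mult_left_mono[OF m2]]) simp_all
  also have "\<dots> = ennreal (1 / \<kappa>\<^sup>2 * (\<kappa> * (c\<^sup>2 / \<tau> * (\<kappa> * (K\<^sup>2 * W)))))"
    using \<tau> W_nonneg \<kappa> by (subst ennreal_mult, simp, simp)+ simp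
  also have "1 / \<kappa>\<^sup>2 * (\<kappa> * (c\<^sup>2 / \<tau> * (\<kappa> * (K\<^sup>2 * W)))) = c\<^sup>2 * K\<^sup>2 * W / \<tau>"
    using \<kappa> by (simp add: power2_eq_square field_simps del: zero_less_power)
  finally show ?thesis .
qed

lemma phi_L2_scaled:
  assumes t: "t > 0"
  shows "(\<integral>\<^sup>+x. ennreal ((norm (\<phi> ((1 / sqrt t) *\<^sub>R x)))\<^sup>2) \<partial>lborel) \<le> 
    ennreal (B * (LINT x|lborel. norm (\<phi> ((1 / sqrt t) *\<^sub>R x))))"
proof -
  have i: "integrable lborel (\<lambda>x. norm (\<phi> ((1 / sqrt t) *\<^sub>R x)))"
    using t by (intro integrable_norm) (subst lborel_integrable_scaleR, simp_all add: phi)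
  have "(\<integral>\<^sup>+x. ennreal ((norm (\<phi> ((1 / sqrt t) *\<^sub>R x)))\<^sup>2) \<partial>lborel) \<le>
      (\<integral>\<^sup>+x. ennreal (B * norm (\<phi> ((1 / sqrt t) *\<^sub>R x))) \<partial>lborel)"
    unfolding power2_eq_square
    by (intro nn_integral_mono ennreal_leI mult_right_mono phi) simp
  also have "\<dots> = ennreal (LINT x|lborel. B * norm (\<phi> ((1 / sqrt t) *\<^sub>R x)))"
    using i B_nonneg by (intro nn_integral_eq_integral) auto
  finally show ?thesis by simp
qed

text \<open>The time interval is open at \<open>t\<close> so that the elapsed time
  \<open>t - s\<close> is positive wherever \<open>T\<close> is evaluated under the
  indicator.\<close>

definition J where "J t z = indicator {0..<t} (fst z) * (\<phi> ((1 / sqrt t) *\<^sub>R snd z) * T (t - fst z) (fst z) (snd z))"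

text \<open>Near \<open>s = t\<close> the frequency integral is not absolutely convergent jointly in \<open>s\<close>. Plancherel gives
  the \<open>L\<^sup>2\<close> norm \<open>O ((t - s) powr (- 1 / 2))\<close> in \<open>x\<close> instead, which is integrable.\<close>

lemma J_integrable:
  assumes t: "t > 0"
  shows "integrable (lborel \<Otimes>\<^sub>M lborel) (J t)"
proof (rule integrableI_bounded)
  show [measurable]: "J t \<in> borel_measurable (lborel \<Otimes>\<^sub>M lborel)"
    unfolding J_def[abs_def] by measurable
  define \<Phi> where "\<Phi> = B * (LINT x|lborel. norm (\<phi> ((1 / sqrt t) *\<^sub>R x)))"
  define D where "D = c\<^sup>2 * K\<^sup>2 * W"
  have \<Phi>: "\<Phi> \<ge> 0" using B_nonneg by (simp add: \<Phi>_def)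
  have D: "D \<ge> 0" using W_nonneg by (simp add: D_def)
  have inner: "(\<integral>\<^sup>+x. ennreal (norm (J t (s, x))) \<partial>lborel) \<le> ennreal (\<Phi> + D) * ennreal (indicator {0..<t} s * (t - s) powr (- 1 / 2))" for s
  proof (cases "s \<in> {0..<t}")
    case False
    then show ?thesis by (simp add: J_def)
  next
    case True
    \<comment> \<open>Weight in the inequality p q \<le> r p^2 + q^2 / r. The squared norm of
      \<open>T\<close> is of order \<open>1 / (t - s)\<close>, so this choice makes both terms
      proportional to the integrable singularity \<open>(t - s) powr (- 1 / 2)\<close>.\<close>
    define r where "r = (t - s) powr (- 1 / 2)"
    have ts: "t - s > 0" "s \<ge> 0" using True by auto
    have r: "r > 0" using ts by (simp add: r_def)
    have rr: "r * r = 1 / (t - s)"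
      using ts by (simp add: r_def powr_add[symmetric] powr_minus_divide)
    have r': "1 / r * (D / (t - s)) = r * D"
      using r rr[symmetric] by (simp add: divide_inverse[of D] field_simps)
    have "(\<integral>\<^sup>+x. ennreal (norm (J t (s, x))) \<partial>lborel) \<le>
       (\<integral>\<^sup>+x. ennreal r * ennreal ((norm (\<phi> ((1 / sqrt t) *\<^sub>R x)))\<^sup>2) + ennreal (1 / r) * ennreal ((norm (T (t - s) s x))\<^sup>2) \<partial>lborel)"
    proof (intro nn_integral_mono)
      fix x
      define p q where "p = norm (\<phi> ((1 / sqrt t) *\<^sub>R x))" and "q = norm (T (t - s) s x)"
      have pq: "p \<ge> 0" "q \<ge> 0" by (simp_all add: p_def q_def)
      have "0 \<le> (r * p - q)\<^sup>2" by simp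
      then have "2 * (r * p * q) \<le> (r * p)\<^sup>2 + q\<^sup>2" by (simp add: power2_diff)
      moreover have "0 \<le> r * p * q" using r pq by simp
      ultimately have "r * p * q \<le> (r * p)\<^sup>2 + q\<^sup>2" by linarith
      then have "p * q \<le> r * p\<^sup>2 + 1 / r * q\<^sup>2"
        using r by (simp add: field_simps power2_eq_square)
      then have "ennreal (p * q) \<le> ennreal (r * p\<^sup>2 + 1 / r * q\<^sup>2)" by (rule ennreal_leI)
      also have "\<dots> = ennreal r * ennreal (p\<^sup>2) + ennreal (1 / r) * ennreal (q\<^sup>2)"
      proof -
        have "ennreal (r * p\<^sup>2 + 1 / r * q\<^sup>2) = ennreal (r * p\<^sup>2) + ennreal (1 / r * q\<^sup>2)"
          by (rule ennreal_plus) (use r in auto)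
        also have "ennreal (r * p\<^sup>2) = ennreal r * ennreal (p\<^sup>2)"
          by (rule ennreal_mult) (use r in auto)
        also have "ennreal (1 / r * q\<^sup>2) = ennreal (1 / r) * ennreal (q\<^sup>2)"
          by (rule ennreal_mult) (use r in auto)
        finally show ?thesis .
      qed
      finally show "ennreal (norm (J t (s, x))) \<le> ennreal r * ennreal ((norm (\<phi> ((1 / sqrt t) *\<^sub>R x)))\<^sup>2) + ennreal (1 / r) * ennreal ((norm (T (t - s) s x))\<^sup>2)"
        using True by (simp add: J_def norm_mult p_def q_def)
    qed
    also have "\<dots> = ennreal r * (\<integral>\<^sup>+x. ennreal ((norm (\<phi> ((1 / sqrt t) *\<^sub>R x)))\<^sup>2) \<partial>lborel) +
        ennreal (1 / r) * (\<integral>\<^sup>+x. ennreal ((norm (T (t - s) s x))\<^sup>2) \<partial>lborel)"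
      by (subst nn_integral_add) (simp_all add: nn_integral_cmult)
    also have "\<dots> \<le> ennreal r * ennreal \<Phi> + ennreal (1 / r) * ennreal (D / (t - s))"
      unfolding \<Phi>_def D_def by (intro add_mono mult_left_mono phi_L2_scaled t T_L2 ts) auto
    also have "\<dots> = ennreal (r * \<Phi> + 1 / r * (D / (t - s)))"
      using r ts \<Phi> D by (subst ennreal_plus) (simp_all add: ennreal_mult[symmetric])
    also have "r * \<Phi> + 1 / r * (D / (t - s)) = (\<Phi> + D) * r"
      unfolding r' by (simp add: algebra_simps)
    finally show ?thesis
      using True r \<Phi> D by (simp add: ennreal_mult r_def)
  qed
  have "(\<integral>\<^sup>+z. ennreal (norm (J t z)) \<partial>(lborel \<Otimes>\<^sub>M lborel)) = (\<integral>\<^sup>+s. \<integral>\<^sup>+x. ennreal (norm (J t (s, x))) \<partial>lborel \<partial>lborel)"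
    by (rule lborel.nn_integral_fst[symmetric]) measurable
  also have "\<dots> \<le> (\<integral>\<^sup>+s. ennreal (\<Phi> + D) * ennreal (indicator {0..<t} s * (t - s) powr (- 1 / 2)) \<partial>lborel)"
    by (intro nn_integral_mono inner)
  also have "\<dots> = ennreal (\<Phi> + D) * (\<integral>\<^sup>+s. ennreal (indicator {0..<t} s * (t - s) powr (- 1 / 2)) \<partial>lborel)"
    by (rule nn_integral_cmult) measurable
  also have "\<dots> < \<infinity>"
    using nn_integral_inverse_sqrt_finite[OF t] by (simp add: ennreal_mult_less_top)
  finally show "(\<integral>\<^sup>+z. ennreal (norm (J t z)) \<partial>(lborel \<Otimes>\<^sub>M lborel)) < \<infinity>" .
qed

text \<open>The frequency side of the pairing after the substitution \<xi> = \<eta> /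
  \<open>sqrt t\<close>. The prefactor \<open>sqrt t\<close> is absorbed by the homogeneity of
  \<open>P\<close>, and the heat exponent \<open>(t - s) * (norm \<xi>)\<^sup>2\<close> becomes
  \<open>(1 - s / t) * (norm \<eta>)\<^sup>2\<close>.\<close>

definition Z where "Z t z = indicator {0..<t} (fst z) * (of_real (exp (- ((1 - fst z / t) * (norm (snd z))\<^sup>2))) * P (snd z) * g_hat (fst z) ((- 1 / sqrt t) *\<^sub>R snd z) * ft \<phi> (snd z))"

lemma Z_meas [measurable]: "Z t \<in> borel_measurable (lborel \<Otimes>\<^sub>M lborel)"
  unfolding Z_def[abs_def] by measurable

text \<open>For \<open>s < t\<close> the heat factor is at most 1. The decay of the transformed test
  function alone controls \<eta>, which yields a majorant free of \<open>t\<close>.\<close>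

lemma Z_bound:
  shows "norm (Z t (s, \<eta>)) \<le> (K * W * e s) * (c * (norm \<eta> * norm (ft \<phi> \<eta>)))"
proof (cases "s \<in> {0..<t}")
  case True
  have "(1 - s / t) * (norm \<eta>)\<^sup>2 \<ge> 0" using True by simp
  then have "exp (- ((1 - s / t) * (norm \<eta>)\<^sup>2)) \<le> 1" by simp
  moreover have "norm (g_hat s \<xi>) \<le> K * W * e s" for \<xi>
    using g_hat_le True by simp
  ultimately have "exp (- ((1 - s / t) * (norm \<eta>)\<^sup>2)) * norm (P \<eta>) * norm (g_hat s ((- 1 / sqrt t) *\<^sub>R \<eta>)) * norm (ft \<phi> \<eta>)
      \<le> 1 * (c * norm \<eta>) * (K * W * e s) * norm (ft \<phi> \<eta>)"
    using P_le[of \<eta>] c_nonneg K W_nonneg e(2)[of s] by (intro mult_mono) simp_all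
  then have "norm (Z t (s, \<eta>)) \<le> 1 * (c * norm \<eta>) * (K * W * e s) * norm (ft \<phi> \<eta>)"
    using True by (simp add: Z_def norm_mult)
  then show ?thesis by (simp add: mult_ac)
next
  case False
  then show ?thesis using K W_nonneg e c_nonneg by (simp add: Z_def)
qed

lemma Z_dominating: "integrable (lborel \<Otimes>\<^sub>M lborel) (\<lambda>(s, \<eta>). complex_of_real ((K * W * e s) * (c * (norm \<eta> * norm (ft \<phi> \<eta>)))))"
  by (rule integrable_pair_bound[of _ "\<lambda>s. K * W * e s" "\<lambda>\<eta>. c * (norm \<eta> * norm (ft \<phi> \<eta>))"])
     (use e ft_phi K W_nonneg c_nonneg in \<open>auto simp: norm_mult\<close>)

lemma Z_integrable: "integrable (lborel \<Otimes>\<^sub>M lborel) (Z t)"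
  using Z_dominating
proof (rule Bochner_Integration.integrable_bound)
  show "AE z in lborel \<Otimes>\<^sub>M lborel. norm (Z t z) \<le>
      norm (case z of (s, \<eta>) \<Rightarrow> complex_of_real ((K * W * e s) * (c * (norm \<eta> * norm (ft \<phi> \<eta>)))))"
    by (intro AE_I2, clarify, unfold prod.case norm_of_real) (rule order_trans[OF Z_bound abs_ge_self])
qed measurable

text \<open>For each fixed \<open>s < t\<close> the symbol \<open>m (t - s) s\<close> is integrable
  and \<open>ft_pairing\<close> applies. The slices are then assembled on both sides, by joint
  integrability of \<open>J\<close> in physical space and of \<open>Z\<close> in frequency
  space.\<close>

lemma integral_J:
  assumes t: "t > 0"
  shows "of_real (sqrt t) * (LINT z|(lborel \<Otimes>\<^sub>M lborel). J t z) =
    of_real (1 / (2 * pi) ^ CARD('n)) * (LINT z|(lborel \<Otimes>\<^sub>M lborel). Z t z)"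
proof -
  let ?\<kappa> = "complex_of_real (1 / (2 * pi) ^ CARD('n))"
  have inner: "of_real (sqrt t) * (LINT x|lborel. J t (s, x)) = ?\<kappa> * (LINT \<eta>|lborel. Z t (s, \<eta>))" for s
  proof (cases "s \<in> {0..<t}")
    case False
    then show ?thesis by (simp add: J_def Z_def)
  next
    case True
    then have s: "s \<ge> 0" and ts: "t - s > 0" by auto
    have c: "sqrt t > 0" using t by simp
    have "(LINT x|lborel. J t (s, x)) = ?\<kappa> * (LINT x|lborel. \<phi> ((1 / sqrt t) *\<^sub>R x) * ft (m (t - s) s) x)"
      unfolding integral_mult_right_zero[symmetric] using True
      by (intro Bochner_Integration.integral_cong refl) (simp add: J_def T_eq_ft)
    also have "(LINT x|lborel. \<phi> ((1 / sqrt t) *\<^sub>R x) * ft (m (t - s) s) x) =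
        (LINT \<eta>|lborel. m (t - s) s ((1 / sqrt t) *\<^sub>R \<eta>) * ft \<phi> \<eta>)"
      by (rule ft_pairing[OF m_integrable[OF s ts] phi(1) c])
    finally have 1: "of_real (sqrt t) * (LINT x|lborel. J t (s, x)) =
        ?\<kappa> * (LINT \<eta>|lborel. of_real (sqrt t) * (m (t - s) s ((1 / sqrt t) *\<^sub>R \<eta>) * ft \<phi> \<eta>))"
      by (simp only: integral_mult_right_zero mult.left_commute)
    have "of_real (sqrt t) * (m (t - s) s ((1 / sqrt t) *\<^sub>R \<eta>) * ft \<phi> \<eta>) = Z t (s, \<eta>)" for \<eta>
    proof -
      have h: "sym_heat (t - s) ((1 / sqrt t) *\<^sub>R \<eta>) = of_real (exp (- ((1 - s / t) * (norm \<eta>)\<^sup>2)))"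
        unfolding sym_heat_eq using t by (simp add: power_divide field_simps)
      have p: "of_real (sqrt t) * P ((1 / sqrt t) *\<^sub>R \<eta>) = P \<eta>"
        using t by (subst P_hom) simp_all
      have "of_real (sqrt t) * (m (t - s) s ((1 / sqrt t) *\<^sub>R \<eta>) * ft \<phi> \<eta>) =
          of_real (exp (- ((1 - s / t) * (norm \<eta>)\<^sup>2))) * (of_real (sqrt t) * P ((1 / sqrt t) *\<^sub>R \<eta>)) * g_hat s (- ((1 / sqrt t) *\<^sub>R \<eta>)) * ft \<phi> \<eta>"
        unfolding m_def h by (simp only: mult_ac)
      then show ?thesis
        unfolding p Z_def using True by simp
    qed
    with 1 show ?thesis by simp
  qed
  have "of_real (sqrt t) * (LINT z|(lborel \<Otimes>\<^sub>M lborel). J t z) = (LINT s|lborel. of_real (sqrt t) * (LINT x|lborel. J t (s, x)))"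
    using lborel_pair.integral_fst'[OF J_integrable[OF t]] by simp
  also have "\<dots> = ?\<kappa> * (LINT z|(lborel \<Otimes>\<^sub>M lborel). Z t z)"
    unfolding inner using lborel_pair.integral_fst'[OF Z_integrable[of t]] by simp
  finally show ?thesis .
qed

lemma g_hat_tendsto:
  assumes s: "s \<ge> 0"
  shows "((\<lambda>t. g_hat s ((- 1 / sqrt t) *\<^sub>R \<eta>)) \<longlongrightarrow> g_hat s 0) at_top"
  unfolding g_hat_def
proof (rule integral_dominated_convergence_at_top)
  show "integrable lborel (\<lambda>y. \<bar>g s y\<bar>)" using g_integrable[OF s] by (rule integrable_abs)
  show "\<forall>\<^sub>F t in at_top. AE x in lborel. norm (cis (x \<bullet> ((- 1 / sqrt t) *\<^sub>R \<eta>)) * complex_of_real (g s x)) \<le> \<bar>g s x\<bar>"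
    by (intro always_eventually allI AE_I2) (simp add: norm_mult)
  show "AE x in lborel. ((\<lambda>t. cis (x \<bullet> ((- 1 / sqrt t) *\<^sub>R \<eta>)) * complex_of_real (g s x)) \<longlongrightarrow> cis (x \<bullet> 0) * complex_of_real (g s x)) at_top"
  proof (rule AE_I2)
    fix x :: "real ^ 'n"
    have "((\<lambda>t. inverse (sqrt t)) \<longlongrightarrow> 0) at_top"
      by (intro tendsto_inverse_0_at_top sqrt_at_top)
    then have "((\<lambda>t. - inverse (sqrt t) * (x \<bullet> \<eta>)) \<longlongrightarrow> - 0 * (x \<bullet> \<eta>)) at_top"
      by (intro tendsto_intros)
    then have "((\<lambda>t. x \<bullet> ((- 1 / sqrt t) *\<^sub>R \<eta>)) \<longlongrightarrow> 0) at_top"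
      by (simp add: field_simps)
    then show "((\<lambda>t. cis (x \<bullet> ((- 1 / sqrt t) *\<^sub>R \<eta>)) * complex_of_real (g s x)) \<longlongrightarrow> cis (x \<bullet> 0) * complex_of_real (g s x)) at_top"
      unfolding inner_zero_right cis_conv_exp
      by (intro tendsto_intros)
  qed
qed measurable

text \<open>For fixed \<open>s\<close> the ratio \<open>s / t\<close> tends to 0 and the argument of
  \<open>g_hat\<close> tends to the origin, so the limit integrand separates: all of time enters
  through the masses of \<open>g s\<close>, all of frequency through the profile at unit time.
  Dominated convergence with the majorant of \<open>Z\<close> justifies the limit.\<close>

lemma J_tendsto:
  "((\<lambda>t. of_real (sqrt t) * (LINT z|(lborel \<Otimes>\<^sub>M lborel). J t z)) \<longlongrightarrow>
     of_real (1 / (2 * pi) ^ CARD('n)) *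
     ((LINT \<eta>|lborel. of_real (exp (- (norm \<eta>)\<^sup>2)) * P \<eta> * ft \<phi> \<eta>) * 
      of_real (LINT s|lborel. indicator {0..} s * (LINT y|lborel. g s y)))) at_top"
proof -
  let ?\<kappa> = "complex_of_real (1 / (2 * pi) ^ CARD('n))"
  define Y where "Y z = indicator {0..} (fst z) * (of_real (exp (- (norm (snd z))\<^sup>2)) * P (snd z) * g_hat (fst z) 0 * ft \<phi> (snd z))" for z :: "real \<times> (real ^ 'n)"
  have [measurable]: "Y \<in> borel_measurable (lborel \<Otimes>\<^sub>M lborel)"
    unfolding Y_def[abs_def] by measurable
  let ?D = "\<lambda>z::real \<times> (real ^ 'n). norm (case z of (s, \<eta>) \<Rightarrow> complex_of_real ((K * W * e s) * (c * (norm \<eta> * norm (ft \<phi> \<eta>)))))"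
  have D: "integrable (lborel \<Otimes>\<^sub>M lborel) ?D"
    by (rule integrable_norm[OF Z_dominating])
  have ZD: "norm (Z t z) \<le> ?D z" for t z
  proof (cases z)
    case (Pair s \<eta>)
    show ?thesis
      unfolding Pair prod.case norm_of_real by (rule order_trans[OF Z_bound abs_ge_self])
  qed
  have ZY: "((\<lambda>t. Z t z) \<longlongrightarrow> Y z) at_top" for z
  proof (cases "fst z \<ge> 0")
    case False
    then show ?thesis by (simp add: Z_def Y_def)
  next
    case True
    have "((\<lambda>t. inverse t) \<longlongrightarrow> (0::real)) at_top"
      by (intro tendsto_inverse_0_at_top filterlim_ident)
    then have "((\<lambda>t. of_real (exp (- ((1 - fst z * inverse t) * (norm (snd z))\<^sup>2))) * P (snd z) * g_hat (fst z) ((- 1 / sqrt t) *\<^sub>R snd z) * ft \<phi> (snd z))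
      \<longlongrightarrow> of_real (exp (- ((1 - fst z * 0) * (norm (snd z))\<^sup>2))) * P (snd z) * g_hat (fst z) 0 * ft \<phi> (snd z)) at_top"
      by (intro tendsto_intros g_hat_tendsto True)
    then have "((\<lambda>t. of_real (exp (- ((1 - fst z * inverse t) * (norm (snd z))\<^sup>2))) * P (snd z) * g_hat (fst z) ((- 1 / sqrt t) *\<^sub>R snd z) * ft \<phi> (snd z))
      \<longlongrightarrow> Y z) at_top"
      using True by (simp add: Y_def)
    then show ?thesis
      by (rule Lim_transform_eventually)
         (use eventually_gt_at_top[of "fst z"] in \<open>eventually_elim, use True in \<open>simp add: Z_def divide_inverse\<close>\<close>)
  qed
  have lim: "((\<lambda>t. LINT z|(lborel \<Otimes>\<^sub>M lborel). Z t z) \<longlongrightarrow> (LINT z|(lborel \<Otimes>\<^sub>M lborel). Y z)) at_top"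
    by (rule integral_dominated_convergence_at_top[OF _ _ D])
       (use ZD ZY in \<open>auto intro!: always_eventually AE_I2\<close>)
  \<comment> \<open>The majorant survives the pointwise limit, which makes \<open>Y\<close>
    integrable and allows its iterated evaluation.\<close>
  have YD: "norm (Y z) \<le> ?D z" for z
    by (rule tendsto_upperbound[OF tendsto_norm[OF ZY]]) (use ZD in auto)
  have Yi: "integrable (lborel \<Otimes>\<^sub>M lborel) Y"
    by (rule Bochner_Integration.integrable_bound[OF D]) (use YD in \<open>auto\<close>)
  have "(LINT z|(lborel \<Otimes>\<^sub>M lborel). Y z) = (LINT s|lborel. LINT \<eta>|lborel. Y (s, \<eta>))"
    by (rule lborel_pair.integral_fst'[OF Yi, symmetric])
  also have "\<dots> = (LINT s|lborel. (LINT \<eta>|lborel. of_real (exp (- (norm \<eta>)\<^sup>2)) * P \<eta> * ft \<phi> \<eta>) * (of_real (indicator {0..} s) * g_hat s 0))"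
    unfolding integral_mult_left_zero[symmetric]
    by (intro Bochner_Integration.integral_cong refl) (simp add: Y_def mult_ac indicator_def)
  also have "\<dots> = (LINT \<eta>|lborel. of_real (exp (- (norm \<eta>)\<^sup>2)) * P \<eta> * ft \<phi> \<eta>) * (LINT s|lborel. of_real (indicator {0..} s) * g_hat s 0)"
    by (rule integral_mult_right_zero)
  also have "(LINT s|lborel. of_real (indicator {0..} s) * g_hat s 0) = (LINT s|lborel. of_real (indicator {0..} s * (LINT y|lborel. g s y)))"
  proof (intro Bochner_Integration.integral_cong refl)
    fix s :: real
    show "of_real (indicator {0..} s) * g_hat s 0 = complex_of_real (indicator {0..} s * (LINT y|lborel. g s y))"
      using g_integrable[of s] by (cases "s \<ge> 0") (simp_all add: g_hat_def)
  qed
  also have "\<dots> = of_real (LINT s|lborel. indicator {0..} s * (LINT y|lborel. g s y))"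
  proof (rule integral_of_real, rule Bochner_Integration.integrable_bound[OF integrable_mult_right[OF e(1), of "K * W"]])
    have "\<bar>LINT y|lborel. g s y\<bar> \<le> K * W * e s" if "s \<ge> 0" for s
      using g_hat_le[OF that, of 0] g_integrable[OF that] by (simp add: g_hat_def)
    then show "AE s in lborel. norm (indicator {0..} s * (LINT y|lborel. g s y)) \<le> norm (K * W * e s)"
      using K W_nonneg e by (intro AE_I2) (auto simp: indicator_def intro: order_trans[OF _ abs_ge_self])
  qed measurable
  finally have Y: "(LINT z|(lborel \<Otimes>\<^sub>M lborel). Y z) = (LINT \<eta>|lborel. of_real (exp (- (norm \<eta>)\<^sup>2)) * P \<eta> * ft \<phi> \<eta>) *
     of_real (LINT s|lborel. indicator {0..} s * (LINT y|lborel. g s y))" .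
  from tendsto_mult_left[OF lim, of ?\<kappa>]
  have "((\<lambda>t. ?\<kappa> * (LINT z|(lborel \<Otimes>\<^sub>M lborel). Z t z)) \<longlongrightarrow> ?\<kappa> * (LINT z|(lborel \<Otimes>\<^sub>M lborel). Y z)) at_top" .
  then show ?thesis
    unfolding Y
    by (rule Lim_transform_eventually)
       (use eventually_gt_at_top[of 0] in \<open>eventually_elim, simp only: integral_J\<close>)
qed

end

section \<open>The test function\<close>

definition cubic_gaussian :: "'n \<Rightarrow> 'n \<Rightarrow> real ^ 'n \<Rightarrow> complex" where
  "cubic_gaussian a b x = planar a b x ^ 3 * of_real (exp (- (norm x)\<^sup>2 / 2))"

lemma cubic_gaussian_measurable [measurable]: "cubic_gaussian a b \<in> borel_measurable borel"
  unfolding cubic_gaussian_def[abs_def] by measurable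

lemma cubic_gaussian_integrable:
  assumes "a \<noteq> b"
  shows "integrable lborel (cubic_gaussian a b)"
  using integrable_planar_cube_gaussian[OF assms, of 0] by (simp only: cubic_gaussian_def[abs_def] inner_zero_right cis_zero mult_1_right)

lemma ft_cubic_gaussian:
  assumes "a \<noteq> b"
  shows "ft (cubic_gaussian a b) \<xi> = - \<i> * of_real (sqrt (2 * pi) ^ CARD('n)) * planar a b \<xi> ^ 3 * of_real (exp (- (norm (\<xi> :: real ^ 'n))\<^sup>2 / 2))"
proof -
  have "ft (cubic_gaussian a b) \<xi> = (LINT x|lborel. planar a b x ^ 3 * cis (x \<bullet> \<xi>) * of_real (exp (- (norm x)\<^sup>2 / 2)))"
    unfolding ft_def cubic_gaussian_def by (intro Bochner_Integration.integral_cong refl) (simp only: mult_ac)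
  then show ?thesis using fourier_planar_cube_gaussian[OF assms, of \<xi>] by simp
qed

lemma norm_cubic_gaussian_le:
  assumes "a \<noteq> b"
  shows "norm (cubic_gaussian a b x) \<le> norm x ^ 3 * exp (- (norm x)\<^sup>2 / 2)"
  unfolding cubic_gaussian_def norm_mult norm_power norm_of_real
  by (intro mult_mono power_mono norm_planar_le assms) auto

lemma power2_mult_exp_le:
  fixes y \<sigma> :: real
  assumes "\<sigma> > 0"
  shows "y\<^sup>2 * exp (- (\<sigma> * y\<^sup>2)) \<le> 1 / \<sigma>"
proof -
  have "\<sigma> * y\<^sup>2 \<le> exp (\<sigma> * y\<^sup>2)"
    using exp_ge_add_one_self[of "\<sigma> * y\<^sup>2"] by linarith
  then have "\<sigma> * y\<^sup>2 * exp (- (\<sigma> * y\<^sup>2)) \<le> 1"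
    by (simp add: exp_minus field_simps)
  then show ?thesis using assms by (simp add: field_simps)
qed

lemma power1_mult_exp_le:
  fixes y \<sigma> :: real
  assumes "\<sigma> > 0"
  shows "y * exp (- (\<sigma> * y\<^sup>2)) \<le> 1 + 1 / \<sigma>"
proof -
  have "0 \<le> (y - 1/2)\<^sup>2" by simp
  then have "y \<le> 1 + y\<^sup>2" by (simp add: power2_eq_square algebra_simps)
  then have "y * exp (- (\<sigma> * y\<^sup>2)) \<le> (1 + y\<^sup>2) * exp (- (\<sigma> * y\<^sup>2))"
    by (rule mult_right_mono) simp
  also have "\<dots> \<le> 1 + 1 / \<sigma>"
    using power2_mult_exp_le[OF assms, of y] assms by (simp add: distrib_right add_mono)
  finally show ?thesis .
qed

lemma norm_cubic_gaussian_bounded: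
  assumes "a \<noteq> b"
  shows "norm (cubic_gaussian a b x) \<le> 20"
proof -
  \<comment> \<open>Half of the Gaussian is spent on one factor \<open>norm x\<close>, the other
    half on the remaining square. With \<sigma> = 1/4 the two bounds are 5 and 4, whence 20.\<close>
  let ?e = "exp (- (1 / 4 * (norm x)\<^sup>2))"
  have "norm x * ?e \<le> 1 + 1 / (1 / 4)" "(norm x)\<^sup>2 * ?e \<le> 1 / (1 / 4)"
    by (intro power1_mult_exp_le power2_mult_exp_le; simp)+
  then have "(norm x * ?e) * ((norm x)\<^sup>2 * ?e) \<le> 5 * 4"
    by (intro mult_mono) simp_all
  moreover have "?e * ?e = exp (- (norm x)\<^sup>2 / 2)"
    by (simp flip: exp_add)
  ultimately show ?thesis
    using norm_cubic_gaussian_le[OF assms, of x]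
    by (simp add: power3_eq_cube power2_eq_square mult_ac)
qed

lemma ft_cubic_gaussian_integrable:
  assumes "a \<noteq> (b :: 'n)"
  shows "integrable lborel (\<lambda>\<eta> :: real ^ 'n. norm \<eta> * norm (ft (cubic_gaussian a b) \<eta>))"
proof (rule Bochner_Integration.integrable_bound[OF integrable_mult_right[OF integrable_norm_power_gaussian[of "1 / 2" 4]]])
  show "AE \<eta> in lborel. norm (norm \<eta> * norm (ft (cubic_gaussian a b) \<eta>)) \<le>
      norm (sqrt (2 * pi) ^ CARD('n) * (norm \<eta> ^ 4 * exp (- (1 / 2 * (norm (\<eta> :: real ^ 'n))\<^sup>2))))"
  proof (rule AE_I2)
    fix \<eta> :: "real ^ 'n"
    have "norm (planar a b \<eta>) ^ 3 \<le> norm \<eta> ^ 3"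
      by (intro power_mono norm_planar_le assms) simp
    then have "norm \<eta> * (sqrt (2 * pi) ^ CARD('n) * norm (planar a b \<eta>) ^ 3 * exp (- (norm \<eta>)\<^sup>2 / 2))
       \<le> norm \<eta> * (sqrt (2 * pi) ^ CARD('n) * norm \<eta> ^ 3 * exp (- (norm \<eta>)\<^sup>2 / 2))"
      by (intro mult_left_mono mult_right_mono) auto
    then show "norm (norm \<eta> * norm (ft (cubic_gaussian a b) \<eta>)) \<le>
      norm (sqrt (2 * pi) ^ CARD('n) * (norm \<eta> ^ 4 * exp (- (1 / 2 * (norm \<eta>)\<^sup>2))))"
      by (simp add: ft_cubic_gaussian[OF assms] norm_mult norm_power abs_mult power3_eq_cube power4_eq_xxxx mult_ac)
  qed
qed simp_all

text \<open>Multiplying the transform of the test function by the heat symbol only changes the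
  Gaussian width, from exponent 1/2 to 3/2. A dilation restores the eigenfunction of the Fourier
  transform, so the evolved test function is again a cubic times a Gaussian.\<close>

lemma heat_cubic_gaussian:
  fixes y :: "real ^ 'n" and a b :: 'n
  assumes ab: "a \<noteq> b"
  shows "norm (LINT \<eta>|lborel. cis (- (y \<bullet> \<eta>)) * (of_real (exp (- (norm \<eta>)\<^sup>2)) * ft (cubic_gaussian a b) \<eta>))
    \<le> (2 * pi) ^ CARD('n) * (norm y ^ 3 * exp (- (1 / 6 * (norm y)\<^sup>2)))"
proof -
  define S :: real where "S = sqrt (2 * pi) ^ CARD('n)"
  \<comment> \<open>The dilation by \<open>sqrt 3\<close> turns exp(-|x|^2 / 2) into exp(-3 |x|^2 /
    2).\<close>
  define r :: real where "r = sqrt 3"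
  have r: "r > 0" "r \<ge> 1" "r\<^sup>2 = 3" by (simp_all add: r_def)
  have "sqrt (2 * pi) * sqrt (2 * pi) = 2 * pi" by simp
  then have S: "S \<ge> 0" "S * S = (2 * pi) ^ CARD('n)"
    unfolding S_def by (simp, simp only: power_mult_distrib[symmetric])
  let ?z = "- ((1 / r) *\<^sub>R y)"
  let ?f = "\<lambda>x. planar a b x ^ 3 * cis (x \<bullet> ?z) * of_real (exp (- (norm x)\<^sup>2 / 2))"
  have fr: "?f (r *\<^sub>R \<eta>) = of_real (r ^ 3) * (planar a b \<eta> ^ 3 * cis (- (y \<bullet> \<eta>)) * of_real (exp (- (3 / 2 * (norm \<eta>)\<^sup>2))))" for \<eta>
    using r by (simp add: planar_scaleR power_mult_distrib inner_commute mult_ac)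
  have "(LINT \<eta>|lborel. cis (- (y \<bullet> \<eta>)) * (of_real (exp (- (norm \<eta>)\<^sup>2)) * ft (cubic_gaussian a b) \<eta>)) =
      (LINT \<eta>|lborel. (- \<i> * of_real S / of_real (r ^ 3)) * ?f (r *\<^sub>R \<eta>))"
  proof (intro Bochner_Integration.integral_cong refl)
    fix \<eta> :: "real ^ 'n"
    have e: "exp (- (norm \<eta>)\<^sup>2) * exp (- (norm \<eta>)\<^sup>2 / 2) = exp (- (3 / 2 * (norm \<eta>)\<^sup>2))"
      by (simp flip: exp_add)
    have "cis (- (y \<bullet> \<eta>)) * (of_real (exp (- (norm \<eta>)\<^sup>2)) * ft (cubic_gaussian a b) \<eta>) =
       - \<i> * of_real S * (planar a b \<eta> ^ 3 * cis (- (y \<bullet> \<eta>)) * of_real (exp (- (norm \<eta>)\<^sup>2) * exp (- (norm \<eta>)\<^sup>2 / 2)))"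
      unfolding ft_cubic_gaussian[OF ab] S_def of_real_mult by (simp only: mult_ac)
    also have "\<dots> = (- \<i> * of_real S / of_real (r ^ 3)) * ?f (r *\<^sub>R \<eta>)"
      unfolding fr e using r by simp
    finally show "cis (- (y \<bullet> \<eta>)) * (of_real (exp (- (norm \<eta>)\<^sup>2)) * ft (cubic_gaussian a b) \<eta>) =
       (- \<i> * of_real S / of_real (r ^ 3)) * ?f (r *\<^sub>R \<eta>)" .
  qed
  also have "\<dots> = (- \<i> * of_real S / of_real (r ^ 3)) * (LINT \<eta>|lborel. ?f (r *\<^sub>R \<eta>))"
    by (rule integral_mult_right_zero)
  also have "norm \<dots> = S / r ^ 3 * norm (LINT \<eta>|lborel. ?f (r *\<^sub>R \<eta>))"
    using r S by (simp add: norm_mult norm_divide norm_power)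
  \<comment> \<open>Both powers of \<open>r\<close>, from the cubic and from the Jacobian, stand in
    denominators and are dropped because \<open>r \<ge> 1\<close>.\<close>
  also have "\<dots> \<le> S / 1 * norm (LINT x|lborel. ?f x)"
  proof (intro mult_mono divide_left_mono)
    have "norm (LINT x|lborel. ?f x) = r ^ CARD('n) * norm (LINT \<eta>|lborel. ?f (r *\<^sub>R \<eta>))"
      using r by (subst lborel_integral_scaleR[OF r(1)]) simp
    moreover have "1 * norm (LINT \<eta>|lborel. ?f (r *\<^sub>R \<eta>)) \<le> r ^ CARD('n) * norm (LINT \<eta>|lborel. ?f (r *\<^sub>R \<eta>))"
      using r by (intro mult_right_mono) auto
    ultimately show "norm (LINT \<eta>|lborel. ?f (r *\<^sub>R \<eta>)) \<le> norm (LINT x|lborel. ?f x)" by simp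
  qed (use r S in auto)
  also have "norm (LINT x|lborel. ?f x) = S * norm (planar a b ?z) ^ 3 * exp (- (norm ?z)\<^sup>2 / 2)"
    unfolding fourier_planar_cube_gaussian[OF ab] S_def[symmetric] using S by (simp add: norm_mult norm_power)
  also have "(norm ?z)\<^sup>2 = 1 / 3 * (norm y)\<^sup>2"
    using r by (simp add: power_divide)
  also have "S / 1 * (S * norm (planar a b ?z) ^ 3 * exp (- (1 / 3 * (norm y)\<^sup>2) / 2)) \<le>
      S / 1 * (S * norm y ^ 3 * exp (- (1 / 3 * (norm y)\<^sup>2) / 2))"
  proof -
    have "norm (planar a b ?z) \<le> norm ?z" by (rule norm_planar_le[OF ab])
    also have "\<dots> \<le> norm y" using r mult_right_mono[OF r(2), of "norm y"] by (simp add: field_simps)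
    finally show ?thesis using S by (intro mult_left_mono mult_right_mono power_mono) auto
  qed
  also have "\<dots> = (2 * pi) ^ CARD('n) * (norm y ^ 3 * exp (- (1 / 6 * (norm y)\<^sup>2)))"
    unfolding S(2)[symmetric] by simp
  finally show ?thesis .
qed

lemma heat_cubic_gaussian_bounds:
  fixes y :: "real ^ 'n" and a b :: 'n
  assumes ab: "a \<noteq> b"
  defines "M \<equiv> LINT \<eta>|lborel. cis (- (y \<bullet> \<eta>)) * (of_real (exp (- (norm \<eta>)\<^sup>2)) * ft (cubic_gaussian a b) \<eta>)"
  shows "norm M \<le> 7 * (2 * pi) ^ CARD('n) * norm y" "norm M \<le> 7 * (2 * pi) ^ CARD('n) * (norm y)\<^sup>2"
proof -
  let ?e = "exp (- (1 / 6 * (norm y)\<^sup>2))"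
  \<comment> \<open>The elementary bounds at \<sigma> = 1/6 are 1 + 6 and 6; the constant 7 serves
    both. The Gaussian absorbs two powers of \<open>norm y\<close> in one estimate and one power in
    the other.\<close>
  have 1: "norm y * ?e \<le> 7" using power1_mult_exp_le[of "1 / 6" "norm y"] by simp
  have 2: "(norm y)\<^sup>2 * ?e \<le> 7" using power2_mult_exp_le[of "1 / 6" "norm y"] by simp
  have "norm M \<le> (2 * pi) ^ CARD('n) * (norm y ^ 3 * ?e)"
    unfolding M_def by (rule heat_cubic_gaussian[OF ab])
  also have "norm y ^ 3 * ?e = (norm y)\<^sup>2 * ?e * norm y" by (simp add: power3_eq_cube power2_eq_square)
  also have "(2 * pi) ^ CARD('n) * \<dots> \<le> (2 * pi) ^ CARD('n) * (7 * norm y)"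
    by (intro mult_left_mono mult_right_mono 2) auto
  finally show "norm M \<le> 7 * (2 * pi) ^ CARD('n) * norm y" by (simp add: mult_ac)
  have "norm M \<le> (2 * pi) ^ CARD('n) * (norm y ^ 3 * ?e)"
    unfolding M_def by (rule heat_cubic_gaussian[OF ab])
  also have "norm y ^ 3 * ?e = norm y * ?e * (norm y)\<^sup>2" by (simp add: power3_eq_cube power2_eq_square)
  also have "(2 * pi) ^ CARD('n) * \<dots> \<le> (2 * pi) ^ CARD('n) * (7 * (norm y)\<^sup>2)"
    by (intro mult_left_mono mult_right_mono 1) auto
  finally show "norm M \<le> 7 * (2 * pi) ^ CARD('n) * (norm y)\<^sup>2" by (simp add: mult_ac)
qed

section \<open>Moments of the Leray symbol against the planar cube\<close>

definition conj_coeff :: "'n \<Rightarrow> 'n \<Rightarrow> 'n \<Rightarrow> complex" where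
  "conj_coeff a b h = (if h = a then 1 / 2 else if h = b then \<i> / 2 else 0)"

definition other_coeff :: "'n \<Rightarrow> 'n \<Rightarrow> 'n \<Rightarrow> real ^ 'n \<Rightarrow> complex" where
  "other_coeff a b h x = (if h = a \<or> h = b then 0 else of_real (x $ h))"

lemma other_coeff_measurable [measurable]: "other_coeff a b h \<in> borel_measurable borel"
  unfolding other_coeff_def[abs_def] by (cases "h = a \<or> h = b") simp_all

text \<open>For \<open>h = a\<close> this is the real part (z + cnj z) / 2, for \<open>h = b\<close>
  the imaginary part (z - cnj z) / (2 i). The two coefficients are conjugate to each other since the
  coordinate is real.\<close>

lemma component_decomp:
  assumes "a \<noteq> b"
  shows "complex_of_real (x $ h) = cnj (conj_coeff a b h) * planar a b x + conj_coeff a b h * cnj (planar a b x) + other_coeff a b h x"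
  using assms by (auto simp: conj_coeff_def other_coeff_def planar_def complex_eq_iff)

lemma norm_other_coeff_le: "norm (other_coeff a b h x) \<le> norm x"
  using component_le_norm_cart[of x h] by (auto simp: other_coeff_def)

lemma other_coeff_cong: "(\<And>i. i \<noteq> a \<Longrightarrow> i \<noteq> b \<Longrightarrow> x $ i = y $ i) \<Longrightarrow> other_coeff a b h x = other_coeff a b h y"
  by (auto simp: other_coeff_def)

lemma integrable_planar_weight:
  fixes w :: "real ^ 'n \<Rightarrow> complex"
  assumes ab: "a \<noteq> b" and [measurable]: "w \<in> borel_measurable borel"
    and w: "\<And>x. norm x ^ (m + n) * norm (w x) \<le> C * (norm x ^ 4 * exp (- (3 / 2 * (norm x)\<^sup>2)))"
  shows "integrable lborel (\<lambda>x. planar a b x ^ m * cnj (planar a b x) ^ n * w x)"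
proof (rule Bochner_Integration.integrable_bound[OF integrable_mult_right[OF integrable_norm_power_gaussian[of "3 / 2" 4], of C]])
  show "AE x in lborel. norm (planar a b x ^ m * cnj (planar a b x) ^ n * w x) \<le> norm (C * (norm x ^ 4 * exp (- (3 / 2 * (norm x)\<^sup>2))))"
  proof (rule AE_I2)
    fix x :: "real ^ 'n"
    have "norm (planar a b x ^ m * cnj (planar a b x) ^ n * w x) = norm (planar a b x) ^ (m + n) * norm (w x)"
      by (simp add: norm_mult norm_power power_add)
    also have "\<dots> \<le> norm x ^ (m + n) * norm (w x)"
      by (intro mult_right_mono power_mono norm_planar_le ab) auto
    also note w
    finally show "norm (planar a b x ^ m * cnj (planar a b x) ^ n * w x) \<le> norm (C * (norm x ^ 4 * exp (- (3 / 2 * (norm x)\<^sup>2))))"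
      by (rule order_trans) (simp add: abs_ge_self del: abs_mult)
  qed
qed simp_all

text \<open>The exponent 3/2 collects 1 from the heat symbol at unit time and 1/2 from the
  transformed test function; the denominator comes from the inverse Laplacian in the Leray symbol.
  At the origin the quotient is 0 by the convention for division.\<close>

definition weighted_monomial :: "'n \<Rightarrow> 'n \<Rightarrow> nat \<Rightarrow> nat \<Rightarrow> (real ^ 'n \<Rightarrow> complex) \<Rightarrow> real ^ 'n \<Rightarrow> complex" where
  "weighted_monomial a b m n v x = planar a b x ^ m * cnj (planar a b x) ^ n * (of_real (exp (- (3 / 2 * (norm x)\<^sup>2)) / (norm x)\<^sup>2) * v x)"

lemma weighted_monomial_integrable:
  fixes v :: "real ^ 'n \<Rightarrow> complex"
  assumes ab: "a \<noteq> b" and [measurable]: "v \<in> borel_measurable borel"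
    and v: "\<And>x. norm (v x) \<le> C * norm x ^ k" and k: "m + n + k = 6"
  shows "integrable lborel (weighted_monomial a b m n v)"
  unfolding weighted_monomial_def[abs_def]
proof (rule integrable_planar_weight[OF ab, of _ m n C])
  fix x :: "real ^ 'n"
  let ?e = "exp (- (3 / 2 * (norm x)\<^sup>2))"
  have "norm x ^ (m + n) * norm (of_real (?e / (norm x)\<^sup>2) * v x) = norm x ^ (m + n) * (?e / (norm x)\<^sup>2) * norm (v x)"
    by (simp add: norm_mult norm_divide norm_power)
  also have "\<dots> \<le> norm x ^ (m + n) * (?e / (norm x)\<^sup>2) * (C * norm x ^ k)"
    by (intro mult_left_mono v) simp
  also have "\<dots> = C * (norm x ^ (m + n + k) / (norm x)\<^sup>2 * ?e)"
    by (simp add: power_add)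
  also have "norm x ^ (m + n + k) / (norm x)\<^sup>2 = norm x ^ 4"
    unfolding k by (cases "x = 0") (simp_all add: eval_nat_numeral)
  finally show "norm x ^ (m + n) * norm (of_real (?e / (norm x)\<^sup>2) * v x) \<le> C * (norm x ^ 4 * ?e)" .
qed measurable

lemma weighted_monomial_integral_0:
  fixes v :: "real ^ 'n \<Rightarrow> complex"
  assumes ab: "a \<noteq> b" and [measurable]: "v \<in> borel_measurable borel" and nm: "n < m"
    and inv: "\<And>x y. norm x = norm y \<Longrightarrow> (\<And>i. i \<noteq> a \<Longrightarrow> i \<noteq> b \<Longrightarrow> x $ i = y $ i) \<Longrightarrow> v x = v y"
  shows "(LINT x|lborel. weighted_monomial a b m n v x) = 0"
  unfolding weighted_monomial_def
proof (rule integral_planar_weight_eq_0[OF ab nm])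
  fix x y :: "real ^ 'n"
  assume *: "norm x = norm y" "\<And>i. i \<noteq> a \<Longrightarrow> i \<noteq> b \<Longrightarrow> x $ i = y $ i"
  show "of_real (exp (- (3 / 2 * (norm x)\<^sup>2)) / (norm x)\<^sup>2) * v x = of_real (exp (- (3 / 2 * (norm y)\<^sup>2)) / (norm y)\<^sup>2) * v y"
    using inv[OF *] *(1) by simp
qed measurable

lemma norm_conj_coeff_le: "norm (conj_coeff a b h) \<le> 1 / 2"
  by (simp add: conj_coeff_def norm_divide)

lemma norm_conj_coeff_mult_le: "norm (conj_coeff a b h * conj_coeff a b k) \<le> 1" "norm (conj_coeff a b h * cnj (conj_coeff a b k)) \<le> 1"
  "norm (cnj (conj_coeff a b h) * conj_coeff a b k) \<le> 1" "norm (cnj (conj_coeff a b h) * cnj (conj_coeff a b k)) \<le> 1"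
  using mult_mono[OF norm_conj_coeff_le[of a b h] norm_conj_coeff_le[of a b k]] by (simp_all add: norm_mult)

lemma norm_conj_other_coeff_le: "norm (conj_coeff a b h * other_coeff a b k x) \<le> norm x" "norm (cnj (conj_coeff a b h) * other_coeff a b k x) \<le> norm x"
proof -
  have "norm (conj_coeff a b h) * norm (other_coeff a b k x) \<le> 1 * norm x"
    using norm_conj_coeff_le[of a b h] by (intro mult_mono norm_other_coeff_le) auto
  then show "norm (conj_coeff a b h * other_coeff a b k x) \<le> norm x" "norm (cnj (conj_coeff a b h) * other_coeff a b k x) \<le> norm x"
    by (simp_all add: norm_mult)
qed

text \<open>The rotation-invariant moment |z|^6 = z^3 (cnj z)^3. Its positivity is what keeps the
  final limit away from zero.\<close>

definition sextic_integral :: "'n \<Rightarrow> 'n \<Rightarrow> (real ^ 'n) itself \<Rightarrow> real" where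
  "sextic_integral a b _ = (LINT x::real ^ 'n|lborel. norm (planar a b x) ^ 6 * (exp (- (3 / 2 * (norm x)\<^sup>2)) / (norm x)\<^sup>2))"

lemma norm_triple_le: "norm (x + y + z) \<le> norm x + norm y + norm (z :: complex)"
  using norm_triangle_ineq[of "x + y" z] norm_triangle_ineq[of x y] by linarith

text \<open>Terms are sorted by their degrees in \<open>z\<close> and in \<open>y\<close>, which
  stands for the conjugate of \<open>z\<close>. Only z^3 y^3 is balanced; in every other term
  \<open>z\<close> has the larger exponent. The letter \<open>h\<close> is the common coefficient
  1/2 of \<open>x $ a\<close>.\<close>

lemma cubic_expand:
  fixes z y p q r p' q' r' \<rho> h :: complex
  shows "z ^ 3 * (h * z + h * y) * (p * z + q * y + r) * (p' * z + q' * y + r') * \<rho> =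
      z ^ 6 * y ^ 0 * (\<rho> * (h * (p * p')))
      + z ^ 5 * y ^ 1 * (\<rho> * (h * (p * p' + p * q' + q * p')))
      + z ^ 4 * y ^ 2 * (\<rho> * (h * (p * q' + q * p' + q * q')))
      + z ^ 3 * y ^ 3 * (\<rho> * (h * (q * q')))
      + z ^ 5 * y ^ 0 * (\<rho> * (h * (p * r' + p' * r)))
      + z ^ 4 * y ^ 1 * (\<rho> * (h * (p * r' + p' * r + (q * r' + q' * r))))
      + z ^ 3 * y ^ 2 * (\<rho> * (h * (q * r' + q' * r)))
      + z ^ 4 * y ^ 0 * (\<rho> * (h * (r * r')))
      + z ^ 3 * y ^ 1 * (\<rho> * (h * (r * r')))"
  by (simp add: algebra_simps eval_nat_numeral)

text \<open>Three conjugate factors are required to balance z^3, and the three coordinates can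
  supply them only by each contributing its conjugate part. Hence the product of the three conjugate
  coefficients, the first being 1/2.\<close>

lemma integral_cubic:
  fixes f :: "real ^ 'n \<Rightarrow> complex" and a b h k :: 'n
  assumes ab: "a \<noteq> b"
  assumes f_eq: "\<And>x. f x = planar a b x ^ 3 * of_real (x $ a) * of_real (x $ h) * of_real (x $ k) *
    of_real (exp (- (3 / 2 * (norm x)\<^sup>2)) / (norm x)\<^sup>2)"
  shows "integrable lborel f" "(LINT x|lborel. f x) = 1 / 2 * conj_coeff a b h * conj_coeff a b k * of_real (sextic_integral a b TYPE(real ^ 'n))"
proof -
  define q p where "q = conj_coeff a b" and "p = (\<lambda>h. cnj (conj_coeff a b h))"
  define r :: "'n \<Rightarrow> real ^ 'n \<Rightarrow> complex" where "r = other_coeff a b"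
  define t where "t = (weighted_monomial a b :: nat \<Rightarrow> nat \<Rightarrow> (real ^ 'n \<Rightarrow> complex) \<Rightarrow> real ^ 'n \<Rightarrow> complex)"
  define R1 R2 rr where "R1 = (\<lambda>x. p h * r k x + p k * r h x)" and "R2 = (\<lambda>x. q h * r k x + q k * r h x)"
    and "rr = (\<lambda>x. r h x * r k x)"
  have [measurable]: "r h \<in> borel_measurable borel" for h unfolding r_def by measurable
  have [measurable]: "R1 \<in> borel_measurable borel" "R2 \<in> borel_measurable borel" "rr \<in> borel_measurable borel"
    unfolding R1_def R2_def rr_def by measurable
  have pq: "norm (p h * p k) \<le> 1" "norm (p h * q k) \<le> 1" "norm (q h * p k) \<le> 1" "norm (q h * q k) \<le> 1"
    unfolding p_def q_def by (rule norm_conj_coeff_mult_le)+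
  have R1b: "norm (R1 x) \<le> 2 * norm x" and R2b: "norm (R2 x) \<le> 2 * norm x" for x
    unfolding R1_def R2_def p_def q_def r_def
    by (rule order_trans[OF norm_triangle_ineq], use norm_conj_other_coeff_le[of a b h k x] norm_conj_other_coeff_le[of a b k h x] in linarith)+
  have rrb: "norm (rr x) \<le> norm x * norm x" for x
    unfolding rr_def norm_mult r_def by (intro mult_mono norm_other_coeff_le) auto
  have rcong: "r h x = r h y" if "\<And>i. i \<noteq> a \<Longrightarrow> i \<noteq> b \<Longrightarrow> x $ i = y $ i" for h x y
    unfolding r_def by (rule other_coeff_cong[OF that])
  define v1 v2 v3 v4 v5 v6 v7 v8 :: "real ^ 'n \<Rightarrow> complex" where
    "v1 = (\<lambda>_. 1 / 2 * (p h * p k))" and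
    "v2 = (\<lambda>_. 1 / 2 * (p h * p k + p h * q k + q h * p k))" and
    "v3 = (\<lambda>_. 1 / 2 * (p h * q k + q h * p k + q h * q k))" and
    "v4 = (\<lambda>_. 1 / 2 * (q h * q k))" and
    "v5 = (\<lambda>x. 1 / 2 * R1 x)" and "v6 = (\<lambda>x. 1 / 2 * (R1 x + R2 x))" and
    "v7 = (\<lambda>x. 1 / 2 * R2 x)" and "v8 = (\<lambda>x. 1 / 2 * rr x)"
  note v_defs = v1_def v2_def v3_def v4_def v5_def v6_def v7_def v8_def
  have [measurable]: "v1 \<in> borel_measurable borel" "v2 \<in> borel_measurable borel" "v3 \<in> borel_measurable borel"
    "v4 \<in> borel_measurable borel" "v5 \<in> borel_measurable borel" "v6 \<in> borel_measurable borel"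
    "v7 \<in> borel_measurable borel" "v8 \<in> borel_measurable borel"
    unfolding v_defs by measurable
  have f: "f = (\<lambda>x. t 6 0 v1 x + t 5 1 v2 x + t 4 2 v3 x + t 3 3 v4 x + t 5 0 v5 x + t 4 1 v6 x + t 3 2 v7 x
      + t 4 0 v8 x + t 3 1 v8 x)"
  proof (rule ext)
    fix x :: "real ^ 'n"
    have a: "complex_of_real (x $ a) = 1 / 2 * planar a b x + 1 / 2 * cnj (planar a b x)"
      by (simp add: planar_def complex_eq_iff)
    show "f x = t 6 0 v1 x + t 5 1 v2 x + t 4 2 v3 x + t 3 3 v4 x + t 5 0 v5 x + t 4 1 v6 x + t 3 2 v7 x
      + t 4 0 v8 x + t 3 1 v8 x"
      unfolding f_eq t_def weighted_monomial_def a component_decomp[OF ab, of x h] component_decomp[OF ab, of x k] cubic_expand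
        v_defs R1_def R2_def rr_def p_def q_def r_def ..
  qed
  have i1: "integrable lborel (t 6 0 v1)" unfolding t_def v_defs
    by (rule weighted_monomial_integrable[OF ab, of _ 2 0]) (use pq in \<open>auto simp: norm_mult\<close>)
  have i2: "integrable lborel (t 5 1 v2)" unfolding t_def v_defs
    by (rule weighted_monomial_integrable[OF ab, of _ 3 0])
       (use pq norm_triple_le[of "p h * p k" "p h * q k" "q h * p k"] in \<open>auto simp: norm_mult\<close>)
  have i3: "integrable lborel (t 4 2 v3)" unfolding t_def v_defs
    by (rule weighted_monomial_integrable[OF ab, of _ 3 0])
       (use pq norm_triple_le[of "p h * q k" "q h * p k" "q h * q k"] in \<open>auto simp: norm_mult\<close>)
  have i4: "integrable lborel (t 3 3 v4)" unfolding t_def v_defs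
    by (rule weighted_monomial_integrable[OF ab, of _ 2 0]) (use pq in \<open>auto simp: norm_mult\<close>)
  have b5: "norm (1 / 2 * R1 x) \<le> 2 * norm x ^ 1" for x
    unfolding norm_mult power_one_right using R1b[of x] norm_ge_zero[of x] by (simp del: norm_ge_zero)
  have i5: "integrable lborel (t 5 0 v5)" unfolding t_def v_defs
    by (rule weighted_monomial_integrable[OF ab _ b5]) auto
  have R12: "norm (R1 x + R2 x) \<le> 4 * norm x" for x
    using norm_triangle_ineq[of "R1 x" "R2 x"] R1b[of x] R2b[of x] by linarith
  have b6: "norm (1 / 2 * (R1 x + R2 x)) \<le> 2 * norm x ^ 1" for x
    unfolding norm_mult power_one_right using R12[of x] norm_ge_zero[of x] by (simp del: norm_ge_zero)
  have i6: "integrable lborel (t 4 1 v6)" unfolding t_def v_defs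
    by (rule weighted_monomial_integrable[OF ab _ b6]) auto
  have b7: "norm (1 / 2 * R2 x) \<le> 2 * norm x ^ 1" for x
    unfolding norm_mult power_one_right using R2b[of x] norm_ge_zero[of x] by (simp del: norm_ge_zero)
  have i7: "integrable lborel (t 3 2 v7)" unfolding t_def v_defs
    by (rule weighted_monomial_integrable[OF ab _ b7]) auto
  have rr2: "norm (1 / 2 * rr x) \<le> 1 / 2 * norm x ^ 2" for x
    using rrb[of x] by (simp add: norm_mult power2_eq_square)
  have i8: "integrable lborel (t 4 0 v8)" unfolding t_def v_defs
    by (rule weighted_monomial_integrable[OF ab _ rr2]) auto
  have i9: "integrable lborel (t 3 1 v8)" unfolding t_def v_defs
    by (rule weighted_monomial_integrable[OF ab _ rr2]) auto
  note ints = i1 i2 i3 i4 i5 i6 i7 i8 i9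
  have z: "(LINT x|lborel. t m n v x) = 0"
    if "n < m" "v \<in> {v1, v2, v3, v5, v6, v7, v8}" for m n v
    unfolding t_def
  proof (rule weighted_monomial_integral_0[OF ab])
    show "v \<in> borel_measurable borel" using that(2) by auto
    fix x y :: "real ^ 'n"
    assume *: "\<And>i. i \<noteq> a \<Longrightarrow> i \<noteq> b \<Longrightarrow> x $ i = y $ i"
    show "v x = v y"
      using that(2) rcong[OF *, of h] rcong[OF *, of k] unfolding v_defs R1_def R2_def rr_def by auto
  qed (rule that)
  show "integrable lborel f"
    unfolding f using ints by (intro Bochner_Integration.integrable_add)
  have "(LINT x|lborel. f x) = (LINT x|lborel. t 6 0 v1 x) + (LINT x|lborel. t 5 1 v2 x) + (LINT x|lborel. t 4 2 v3 x) + (LINT x|lborel. t 3 3 v4 x)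
      + (LINT x|lborel. t 5 0 v5 x) + (LINT x|lborel. t 4 1 v6 x) + (LINT x|lborel. t 3 2 v7 x)
      + (LINT x|lborel. t 4 0 v8 x) + (LINT x|lborel. t 3 1 v8 x)"
    unfolding f using ints
    by (simp only: Bochner_Integration.integral_add Bochner_Integration.integrable_add)
  \<comment> \<open>The other eight terms are unbalanced, and their remaining factors are unchanged
    by rotations of the plane.\<close>
  also have "\<dots> = (LINT x|lborel. t 3 3 v4 x)"
    by (simp add: z)
  also have "\<dots> = (LINT x|lborel. 1 / 2 * conj_coeff a b h * conj_coeff a b k * complex_of_real (norm (planar a b x) ^ 6 * (exp (- (3 / 2 * (norm x)\<^sup>2)) / (norm x)\<^sup>2)))"
  proof (intro Bochner_Integration.integral_cong refl)
    fix x :: "real ^ 'n"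
    have "planar a b x ^ 3 * cnj (planar a b x) ^ 3 = complex_of_real (norm (planar a b x) ^ 6)"
    proof -
      have "planar a b x ^ 3 * cnj (planar a b x) ^ 3 = complex_of_real ((norm (planar a b x))\<^sup>2) ^ 3"
        unfolding complex_norm_square power_mult_distrib ..
      also have "\<dots> = complex_of_real (norm (planar a b x) ^ 6)"
        unfolding of_real_power[symmetric] power_mult[symmetric] by simp
      finally show ?thesis .
    qed
    note eq = this
    show "t 3 3 v4 x = 1 / 2 * conj_coeff a b h * conj_coeff a b k * complex_of_real (norm (planar a b x) ^ 6 * (exp (- (3 / 2 * (norm x)\<^sup>2)) / (norm x)\<^sup>2))"
      unfolding t_def weighted_monomial_def v4_def q_def eq of_real_mult by (simp only: mult_ac)
  qed
  also have "\<dots> = 1 / 2 * conj_coeff a b h * conj_coeff a b k * (LINT x|lborel. complex_of_real (norm (planar a b x) ^ 6 * (exp (- (3 / 2 * (norm (x :: real ^ 'n))\<^sup>2)) / (norm x)\<^sup>2)))"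
    by (rule integral_mult_right_zero)
  also have "(LINT x|lborel. complex_of_real (norm (planar a b x) ^ 6 * (exp (- (3 / 2 * (norm (x :: real ^ 'n))\<^sup>2)) / (norm x)\<^sup>2))) = of_real (sextic_integral a b TYPE(real ^ 'n))"
    unfolding sextic_integral_def by (rule integral_complex_of_real)
  finally show "(LINT x|lborel. f x) = 1 / 2 * conj_coeff a b h * conj_coeff a b k * of_real (sextic_integral a b TYPE(real ^ 'n))" .
qed

lemma sextic_integral_pos:
  fixes a b :: "'n::finite"
  assumes ab: "a \<noteq> b"
  shows "sextic_integral a b TYPE(real ^ 'n) > 0"
proof -
  let ?f = "\<lambda>x::real ^ 'n. norm (planar a b x) ^ 6 * (exp (- (3 / 2 * (norm x)\<^sup>2)) / (norm x)\<^sup>2)"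
  have "integrable lborel (weighted_monomial a b 3 3 (\<lambda>_::real ^ 'n. 1))"
    by (rule weighted_monomial_integrable[OF ab, of _ 1 0]) auto
  then have "integrable lborel (\<lambda>x. norm (weighted_monomial a b 3 3 (\<lambda>_::real ^ 'n. 1) x))"
    by (rule integrable_norm)
  moreover have "norm (weighted_monomial a b 3 3 (\<lambda>_. 1) x) = ?f x" for x :: "real ^ 'n"
    by (simp add: weighted_monomial_def norm_mult norm_divide norm_power flip: power_add)
  ultimately have i: "integrable lborel ?f" by simp
  have nn: "?f x \<ge> 0" for x by simp
  have "sextic_integral a b TYPE(real ^ 'n) \<noteq> 0"
  proof
    assume "sextic_integral a b TYPE(real ^ 'n) = 0"
    then have "AE x in lborel. ?f x = 0"
      unfolding sextic_integral_def using integral_nonneg_eq_0_iff_AE[OF i] nn by simp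
    moreover have "?f x \<noteq> 0" if "x $ a \<noteq> 0" for x :: "real ^ 'n"
      using that by (auto simp: planar_def complex_eq_iff)
    ultimately have "AE x::real ^ 'n in lborel. x \<notin> {x. x $ a \<noteq> 0}"
      by (auto elim!: eventually_mono)
    \<comment> \<open>A closed set that contains almost every point is the whole space, but the
      hyperplane \<open>x $ a = 0\<close> misses \<open>axis a 1\<close>.\<close>
    then have ae: "AE x::real ^ 'n in lebesgue. x \<in> {x. x $ a = 0}"
      by (intro AE_completion) simp
    have "closed {x::real ^ 'n. x $ a = 0}"
      by (intro closed_Collect_eq continuous_intros)
    from mem_closed_if_AE_lebesgue[OF this ae, of "axis a 1"] show False
      by simp
  qed
  moreover have "sextic_integral a b TYPE(real ^ 'n) \<ge> 0"
    unfolding sextic_integral_def by (intro integral_nonneg_AE) simp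
  ultimately show ?thesis by simp
qed

lemma linear_expand:
  fixes z y p q r e :: complex
  shows "z ^ 3 * (p * z + q * y + r) * e = z ^ 4 * y ^ 0 * (e * p) + z ^ 3 * y ^ 1 * (e * q) + z ^ 3 * y ^ 0 * (e * r)"
  by (simp add: algebra_simps eval_nat_numeral)

text \<open>The local part of the symbol: a single coordinate supplies at most one conjugate factor,
  which cannot balance the cube. In other words, harmonics of degrees three and one are
  orthogonal.\<close>

lemma integral_linear:
  fixes f :: "real ^ 'n \<Rightarrow> complex" and a b h :: 'n
  assumes ab: "a \<noteq> b"
  assumes f_eq: "\<And>x. f x = planar a b x ^ 3 * of_real (x $ h) * of_real (exp (- (3 / 2 * (norm x)\<^sup>2)))"
  shows "integrable lborel f" "(LINT x|lborel. f x) = 0"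
proof -
  \<comment> \<open>The factor \<open>(norm x)\<^sup>2\<close> undoes the denominator in
    \<open>weighted_monomial\<close> away from the origin; at the origin both sides vanish with the
    power of \<open>planar\<close>.\<close>
  define v1 v2 v3 :: "real ^ 'n \<Rightarrow> complex" where
    "v1 = (\<lambda>x. of_real ((norm x)\<^sup>2) * cnj (conj_coeff a b h))" and
    "v2 = (\<lambda>x. of_real ((norm x)\<^sup>2) * conj_coeff a b h)" and
    "v3 = (\<lambda>x. of_real ((norm x)\<^sup>2) * other_coeff a b h x)"
  note v_defs = v1_def v2_def v3_def
  have [measurable]: "v1 \<in> borel_measurable borel" "v2 \<in> borel_measurable borel" "v3 \<in> borel_measurable borel"
    unfolding v_defs by measurable
  have f: "f = (\<lambda>x. weighted_monomial a b 4 0 v1 x + weighted_monomial a b 3 1 v2 x + weighted_monomial a b 3 0 v3 x)"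
  proof (rule ext)
    fix x :: "real ^ 'n"
    show "f x = weighted_monomial a b 4 0 v1 x + weighted_monomial a b 3 1 v2 x + weighted_monomial a b 3 0 v3 x"
    proof (cases "x = 0")
      case True
      then show ?thesis by (simp add: f_eq weighted_monomial_def planar_def complex_eq_iff)
    next
      case False
      then have e: "complex_of_real (exp (- (3 / 2 * (norm x)\<^sup>2)) / (norm x)\<^sup>2) * (of_real ((norm x)\<^sup>2) * c) =
          of_real (exp (- (3 / 2 * (norm x)\<^sup>2))) * c" for c
        by simp
      show ?thesis
        unfolding f_eq weighted_monomial_def v_defs e component_decomp[OF ab, of x h]
        by (rule linear_expand)
    qed
  qed
  have q: "norm (conj_coeff a b h) \<le> 1" using norm_conj_coeff_le[of a b h] by linarith
  have b1: "norm (v1 x) \<le> 1 * norm x ^ 2" "norm (v2 x) \<le> 1 * norm x ^ 2" "norm (v3 x) \<le> 1 * norm x ^ 3" for x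
  proof -
    have "(norm x)\<^sup>2 * norm (conj_coeff a b h) \<le> (norm x)\<^sup>2 * 1" by (rule mult_left_mono[OF q]) simp
    then show "norm (v1 x) \<le> 1 * norm x ^ 2" "norm (v2 x) \<le> 1 * norm x ^ 2"
      by (simp_all add: v_defs norm_mult norm_power)
    have "(norm x)\<^sup>2 * norm (other_coeff a b h x) \<le> (norm x)\<^sup>2 * norm x" by (rule mult_left_mono[OF norm_other_coeff_le]) simp
    then show "norm (v3 x) \<le> 1 * norm x ^ 3"
      by (simp add: v_defs norm_mult norm_power power2_eq_square power3_eq_cube)
  qed
  have i1: "integrable lborel (weighted_monomial a b 4 0 v1)" by (rule weighted_monomial_integrable[OF ab _ b1(1)]) auto
  have i2: "integrable lborel (weighted_monomial a b 3 1 v2)" by (rule weighted_monomial_integrable[OF ab _ b1(2)]) auto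
  have i3: "integrable lborel (weighted_monomial a b 3 0 v3)" by (rule weighted_monomial_integrable[OF ab _ b1(3)]) auto
  have z: "(LINT x|lborel. weighted_monomial a b m n v x) = 0"
    if "n < m" "v \<in> {v1, v2, v3}" for m n v
  proof (rule weighted_monomial_integral_0[OF ab])
    show "v \<in> borel_measurable borel" using that(2) by auto
    fix x y :: "real ^ 'n"
    assume *: "norm x = norm y" "\<And>i. i \<noteq> a \<Longrightarrow> i \<noteq> b \<Longrightarrow> x $ i = y $ i"
    show "v x = v y"
      using that(2) other_coeff_cong[OF *(2), of a b h] *(1) unfolding v_defs by auto
  qed (rule that)
  show "integrable lborel f"
    unfolding f using i1 i2 i3 by (intro Bochner_Integration.integrable_add)
  show "(LINT x|lborel. f x) = 0"
    unfolding f using i1 i2 i3 by (simp add: z)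
qed

lemma profile_algebra:
  fixes e1 e2 d A K N H S Z :: complex
  shows "e1 * ((d - A * K / N) * (\<i> * H)) * (- \<i> * S * Z * e2) = S * d * (Z * H * (e1 * e2)) - S * (Z * A * H * K * (e1 * e2 / N))"
proof -
  have "\<i> * (\<i> * x) = - x" for x by (simp flip: mult.assoc)
  then show ?thesis
    unfolding divide_inverse by (simp add: algebra_simps)
qed

text \<open>The Kronecker part of the Leray symbol contributes nothing by
  \<open>integral_linear\<close>, and the nonlocal part is evaluated by
  \<open>integral_cubic\<close>. The factor i of the derivative meets the factor -i of the
  transformed test function, so the remaining minus sign is the one of the projection.\<close>

lemma integral_profile_coeff:
  fixes a b h k :: "'n::finite"
  assumes ab: "a \<noteq> b"
  shows "(LINT \<eta>::real ^ 'n|lborel. of_real (exp (- (norm \<eta>)\<^sup>2)) * (sym_leray a k \<eta> * sym_deriv h \<eta>) * ft (cubic_gaussian a b) \<eta>) =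
    - (of_real (sqrt (2 * pi) ^ CARD('n) * sextic_integral a b TYPE(real ^ 'n) / 2) * (conj_coeff a b h * conj_coeff a b k))"
proof -
  define S where "S = complex_of_real (sqrt (2 * pi) ^ CARD('n))"
  define f1 :: "real ^ 'n \<Rightarrow> complex" where "f1 x = planar a b x ^ 3 * of_real (x $ h) * of_real (exp (- (3 / 2 * (norm x)\<^sup>2)))" for x
  define f2 :: "real ^ 'n \<Rightarrow> complex" where "f2 x = planar a b x ^ 3 * of_real (x $ a) * of_real (x $ h) * of_real (x $ k) *
    of_real (exp (- (3 / 2 * (norm x)\<^sup>2)) / (norm x)\<^sup>2)" for x
  note I1 = integral_linear[OF ab, of f1 h, OF f1_def] and I2 = integral_cubic[OF ab, of f2 h k, OF f2_def]
  define d where "d = (if a = k then 1 else 0 :: complex)"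
  have "of_real (exp (- (norm \<eta>)\<^sup>2)) * (sym_leray a k \<eta> * sym_deriv h \<eta>) * ft (cubic_gaussian a b) \<eta> = S * d * f1 \<eta> - S * f2 \<eta>" for \<eta> :: "real ^ 'n"
  proof -
    have e: "exp (- (3 / 2 * (norm \<eta>)\<^sup>2)) = exp (- (norm \<eta>)\<^sup>2) * exp (- (norm \<eta>)\<^sup>2 / 2)"
      by (simp flip: exp_add)
    have ley: "sym_leray a k \<eta> = d - of_real (\<eta> $ a) * of_real (\<eta> $ k) / of_real ((norm \<eta>)\<^sup>2)"
      by (simp add: sym_leray_def d_def sym_laplace_eq sym_deriv_def divide_inverse mult_ac)
    show ?thesis
      unfolding ft_cubic_gaussian[OF ab] f1_def f2_def S_def[symmetric] e ley sym_deriv_def of_real_mult of_real_divide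
      by (rule profile_algebra)
  qed
  then have "(LINT \<eta>::real ^ 'n|lborel. of_real (exp (- (norm \<eta>)\<^sup>2)) * (sym_leray a k \<eta> * sym_deriv h \<eta>) * ft (cubic_gaussian a b) \<eta>) =
      (LINT \<eta>|lborel. S * d * f1 \<eta> - S * f2 \<eta>)" by simp
  also have "\<dots> = (LINT \<eta>|lborel. S * d * f1 \<eta>) - (LINT \<eta>|lborel. S * f2 \<eta>)"
    using I1(1) I2(1) by (intro Bochner_Integration.integral_diff integrable_mult_right)
  also have "\<dots> = S * d * 0 - S * (1 / 2 * conj_coeff a b h * conj_coeff a b k * of_real (sextic_integral a b TYPE(real ^ 'n)))"
    unfolding integral_mult_right_zero I1(2) I2(2) ..
  finally show ?thesis by (simp add: S_def)
qed

section \<open>Weak asymptotics of the flow\<close>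

lemma integrable_halfline_weight:
  fixes q :: real
  assumes q: "q > 1"
  shows "integrable lborel (\<lambda>y. indicator {0..} y * (1 + y) powr (- q))"
proof -
  let ?f = "\<lambda>x::real. if x \<in> {1..} then x powr (- q) else 0"
  have f: "?f \<in> borel_measurable borel" by measurable
  have "(?f has_integral (-(1 powr (- q + 1)) / (- q + 1))) UNIV"
    unfolding has_integral_restrict_UNIV using q by (intro has_integral_powr_to_inf) auto
  then have "(\<integral>\<^sup>+x. ennreal (?f x) \<partial>lborel) = ennreal (-(1 powr (- q + 1)) / (- q + 1))"
    by (intro nn_integral_has_integral_lborel[OF f]) auto
  then have "integrable lborel ?f"
    using f by (intro integrableI_nonneg) auto
  from lborel_integrable_real_affine[OF this, of 1 1]
  have "integrable lborel (\<lambda>x. ?f (1 + 1 * x))" by simp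
  then show ?thesis
    by (rule Bochner_Integration.integrable_bound) (auto simp: indicator_def)
qed

lemma integrable_line_weight:
  fixes q :: real
  assumes q: "q > 1"
  shows "integrable lborel (\<lambda>y::real. (1 + \<bar>y\<bar>) powr (- q))"
proof -
  let ?f = "\<lambda>y::real. indicator {0..} y * (1 + y) powr (- q)"
  have 1: "integrable lborel ?f" by (rule integrable_halfline_weight[OF q])
  have 2: "integrable lborel (\<lambda>y. ?f (0 + (- 1) * y))"
    by (rule lborel_integrable_real_affine[OF 1]) simp
  show ?thesis
    by (rule Bochner_Integration.integrable_bound[OF Bochner_Integration.integrable_add[OF 1 2]])
       (auto simp: indicator_def)
qed

text \<open>Every coordinate is at most \<open>norm x\<close> in modulus, so the radial weight with
  exponent \<open>r\<close> lies below the product of one-dimensional weights with exponent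
  \<open>r / CARD('n) > 1\<close>. This replaces polar coordinates.\<close>

lemma integrable_weight:
  fixes r :: real
  assumes r: "r > real CARD('n)"
  shows "integrable lborel (\<lambda>x::real ^ 'n. (1 + norm x) powr (- r))"
proof -
  define q where "q = r / real CARD('n)"
  have q: "q > 1" using r by (simp add: q_def)
  have "integrable lborel (\<lambda>x::real ^ 'n. \<Prod>i\<in>UNIV. complex_of_real ((1 + \<bar>x $ i\<bar>) powr (- q)))"
    by (intro integrable_lborel_vec_prod) (simp add: integrable_line_weight[OF q])
  then show ?thesis
  proof (rule Bochner_Integration.integrable_bound)
    show "AE x::real ^ 'n in lborel. norm ((1 + norm x) powr (- r)) \<le> norm (\<Prod>i\<in>UNIV. complex_of_real ((1 + \<bar>x $ i\<bar>) powr (- q)))"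
    proof (rule AE_I2)
      fix x :: "real ^ 'n"
      have "(1 + norm x) powr (- r) = (\<Prod>i\<in>(UNIV :: 'n set). (1 + norm x) powr (- q))"
      proof -
        have "((1 + norm x) powr (- q)) ^ CARD('n) = ((1 + norm x) powr (- q)) powr real CARD('n)"
          using norm_ge_zero[of x] by (intro powr_realpow[symmetric]) (simp add: add_nonneg_eq_0_iff)
        also have "\<dots> = (1 + norm x) powr (- r)" by (simp add: powr_powr q_def)
        finally show ?thesis by simp
      qed
      also have "\<dots> \<le> (\<Prod>i\<in>UNIV. (1 + \<bar>x $ i\<bar>) powr (- q))"
        using q component_le_norm_cart[of x] by (intro prod_mono) (auto intro!: powr_mono2')
      finally show "norm ((1 + norm x) powr (- r)) \<le> norm (\<Prod>i\<in>UNIV. complex_of_real ((1 + \<bar>x $ i\<bar>) powr (- q)))"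
        by (simp add: prod_norm[symmetric])
    qed
  qed simp
qed

section \<open>Borel versions of Lebesgue measurable functions\<close>

lemma completion_measurable_AE:
  fixes f :: "'a \<Rightarrow> 'b::topological_space"
  assumes ae: "AE x in M. f x = g x" and g: "g \<in> borel_measurable M"
  shows "f \<in> borel_measurable (completion M)"
proof (rule measurableI)
  fix A :: "'b set" assume A: "A \<in> sets borel"
  show "f -` A \<inter> space (completion M) \<in> sets (completion M)"
  proof (rule completion.in_sets_AE)
    show "g -` A \<inter> space M \<in> sets (completion M)"
      using measurable_sets[OF g A] by simp
    show "AE x in completion M. (x \<in> g -` A \<inter> space M) = (x \<in> f -` A \<inter> space (completion M))"
      using AE_completion[OF ae] by eventually_elim auto
  qed auto
qed simp

lemma ex_borel_version:
  fixes f :: "'a::euclidean_space \<Rightarrow> real ^ 'n"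
  assumes "f \<in> borel_measurable lebesgue"
  shows "\<exists>g \<in> borel_measurable borel. AE x in lborel. f x = g x"
proof -
  have "\<forall>i. \<exists>g \<in> borel_measurable lborel. AE x in lborel. f x $ i = g x"
    using assms by (intro allI completion_ex_borel_measurable_real) measurable
  then obtain g where g: "\<And>i. g i \<in> borel_measurable lborel" "\<And>i. AE x in lborel. f x $ i = g i x"
    by metis
  have "AE x in lborel. \<forall>i. f x $ i = g i x"
    using g(2) by (intro AE_finite_allI[of UNIV, simplified]) auto
  then have "AE x in lborel. f x = (\<chi> i. g i x)"
    by eventually_elim (simp add: vec_eq_iff)
  moreover have "(\<lambda>x. \<chi> i. g i x) \<in> borel_measurable borel"
  proof (rule borel_measurable_euclidean_space[THEN iffD2], rule ballI)
    fix c :: "real ^ 'n"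
    assume "c \<in> Basis"
    then obtain i where c: "c = axis i 1" by (auto simp: Basis_vec_def)
    have "(\<lambda>x. (\<chi> i. g i x) \<bullet> c) = g i" by (simp add: c inner_axis)
    then show "(\<lambda>x. (\<chi> i. g i x) \<bullet> c) \<in> borel_measurable borel" using g(1)[of i] by simp
  qed
  ultimately show ?thesis
    by (rule bexI)
qed

text \<open>Multipliers depend on the data only through a Fourier integral, so equality almost
  everywhere of the data gives equality of the results at every point. This permits replacing the
  velocity by a Borel version inside the Duhamel integral.\<close>

lemma multiplier_cong_AE:
  assumes "g \<in> borel_measurable lebesgue" "g' \<in> borel_measurable lebesgue" "AE x in lebesgue. g x = g' x"
  shows "multiplier m g = multiplier m g'"
proof -
  have [measurable]: "(\<lambda>x::real ^ 'n. cis (- (x \<bullet> \<xi>))) \<in> borel_measurable lebesgue" for \<xi>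
    by (intro measurable_completion) simp
  have "fourier (\<lambda>x. of_real (g x)) \<xi> = fourier (\<lambda>x. of_real (g' x)) \<xi>" for \<xi>
    unfolding fourier_def using assms
    by (intro integral_cong_AE borel_measurable_times borel_measurable_of_real) auto
  then show ?thesis unfolding multiplier_def by simp
qed

text \<open>The exponents of \<open>space_weight\<close> and \<open>time_weight\<close> arise from
  squaring the a priori bound with \<alpha> = \<beta> = (d + 1) / 2. This balanced choice makes the
  quadratic term integrable in space and in time at once; in time the exponent (d + 1) / 2 exceeds 1
  exactly because d \<ge> 2.\<close>

definition space_weight :: "real ^ 'n \<Rightarrow> real" where "space_weight x = (1 + norm x) powr (- (real CARD('n) + 1))"

definition time_weight :: "'n::finite itself \<Rightarrow> real \<Rightarrow> real" where
  "time_weight _ s = indicator {0..} s * (1 + s) powr (- ((real CARD('n) + 1) / 2))"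

lemma powr_uminus_le_1:
  fixes y r :: real
  assumes "1 \<le> y" "0 \<le> r"
  shows "y powr (- r) \<le> 1"
  using powr_mono[of "- r" 0 y] assms by simp

lemma space_weight_props: "integrable lborel (space_weight :: real ^ 'n \<Rightarrow> real)" "0 \<le> space_weight x" "space_weight x \<le> 1"
proof -
  show "integrable lborel (space_weight :: real ^ 'n \<Rightarrow> real)"
    unfolding space_weight_def[abs_def] by (rule integrable_weight) simp
  show "0 \<le> space_weight x" "space_weight x \<le> 1"
    unfolding space_weight_def by (simp, intro powr_uminus_le_1) auto
qed

lemma time_weight_props:
  assumes "CARD('n::finite) \<ge> 2"
  shows "integrable lborel (time_weight TYPE('n))" "0 \<le> time_weight TYPE('n) s" "time_weight TYPE('n) s \<le> 1"
proof -
  show "integrable lborel (time_weight TYPE('n))"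
    unfolding time_weight_def[abs_def] using assms by (intro integrable_halfline_weight) simp
  show "0 \<le> time_weight TYPE('n) s" "time_weight TYPE('n) s \<le> 1"
    by (auto simp: time_weight_def indicator_def intro!: powr_uminus_le_1)
qed

lemma norm_leray_symbol_le: "norm (sym_leray j k \<xi> * sym_deriv h \<xi>) \<le> 2 * norm \<xi>"
proof -
  have "\<bar>\<xi> $ j\<bar> * \<bar>\<xi> $ k\<bar> \<le> norm \<xi> * norm \<xi>"
    by (intro mult_mono component_le_norm_cart) auto
  then have "\<bar>\<xi> $ j\<bar> * \<bar>\<xi> $ k\<bar> / (norm \<xi> * norm \<xi>) \<le> 1"
    by (cases "\<xi> = 0") (simp_all add: field_simps)
  then have "norm (sym_deriv j \<xi> * inverse (sym_laplace \<xi>) * sym_deriv k \<xi>) \<le> 1"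
    by (simp add: sym_deriv_def sym_laplace_eq norm_mult norm_inverse power2_eq_square divide_inverse mult_ac)
  then have "norm (sym_leray j k \<xi>) \<le> 1 + 1"
    unfolding sym_leray_def by (intro order_trans[OF norm_triangle_ineq4] add_mono) auto
  moreover have "norm (sym_deriv h \<xi>) \<le> norm \<xi>"
    using component_le_norm_cart[of \<xi> h] by (simp add: sym_deriv_def norm_mult)
  ultimately show ?thesis
    unfolding norm_mult by (intro mult_mono) auto
qed

lemma leray_symbol_homogeneous:
  assumes "r > 0"
  shows "sym_leray j k (r *\<^sub>R \<xi>) * sym_deriv h (r *\<^sub>R \<xi>) = of_real r * (sym_leray j k \<xi> * sym_deriv h \<xi>)"
proof -
  have "sym_leray j k (r *\<^sub>R \<xi>) = sym_leray j k \<xi>"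
    using assms by (simp add: sym_leray_def sym_deriv_def sym_laplace_eq power_mult_distrib power2_eq_square field_simps)
  then show ?thesis by (simp add: sym_deriv_def)
qed

text \<open>A Borel version of the velocity whose squared bound holds at every point of nonnegative
  time, together with the coordinate plane used by the test function. Exact bounds and Borel
  measurability allow Fubini's theorem on products of \<open>lborel\<close>.\<close>

locale flow =
  fixes f :: "real \<Rightarrow> real ^ 'n \<Rightarrow> real ^ 'n" and K :: real and a b :: 'n
  assumes f_pair: "(\<lambda>z. f (fst z) (snd z)) \<in> borel_measurable (borel \<Otimes>\<^sub>M borel)"
    and f_le: "\<And>s x. s \<ge> 0 \<Longrightarrow> (norm (f s x))\<^sup>2 \<le> K * (space_weight x * time_weight TYPE('n) s)"
    and K: "K \<ge> 0"
    and card: "CARD('n) \<ge> 2"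
    and ab: "a \<noteq> b"
begin

lemma f_meas [measurable (raw)]:
  assumes [measurable]: "p \<in> borel_measurable M" "q \<in> borel_measurable M"
  shows "(\<lambda>x. f (p x) (q x)) \<in> borel_measurable M"
  using measurable_compose[OF measurable_Pair[OF assms] f_pair] by simp

text \<open>The constant 2 bounds the entries of the Leray symbol, 1 for the identity and 1 for the
  nonlocal part; 20 is the supremum bound of the test function.\<close>

lemma duhamel: "duhamel_term (\<lambda>s x. f s x $ h * f s x $ k) (\<lambda>\<xi>. sym_leray a k \<xi> * sym_deriv h \<xi>) (cubic_gaussian a b) space_weight (time_weight TYPE('n)) K 2 20"
proof
  show "(\<lambda>z. f (fst z) (snd z) $ h * f (fst z) (snd z) $ k) \<in> borel_measurable (borel \<Otimes>\<^sub>M borel)"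
    by measurable
  show "\<bar>f s x $ h * f s x $ k\<bar> \<le> K * (space_weight x * time_weight TYPE('n) s)" if "s \<ge> 0" for s x
  proof -
    have "\<bar>f s x $ h * f s x $ k\<bar> \<le> norm (f s x) * norm (f s x)"
      unfolding abs_mult by (intro mult_mono component_le_norm_cart) auto
    then show ?thesis using f_le[OF that, of x] by (simp add: power2_eq_square)
  qed
  show "integrable lborel (\<lambda>\<eta>. norm \<eta> * norm (ft (cubic_gaussian a b) \<eta>))"
    by (rule ft_cubic_gaussian_integrable[OF ab])
qed (simp_all add: space_weight_props time_weight_props[OF card] K norm_leray_symbol_le leray_symbol_homogeneous cubic_gaussian_integrable[OF ab] norm_cubic_gaussian_bounded[OF ab])

definition energy where "energy h k = (LINT s|lborel. indicator {0..} s * (LINT y|lborel. f s y $ h * f s y $ k))"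

definition duhamel_integrand where "duhamel_integrand h k = duhamel_term.J (\<lambda>s x. f s x $ h * f s x $ k) (\<lambda>\<xi>. sym_leray a k \<xi> * sym_deriv h \<xi>) (cubic_gaussian a b)"

lemma duhamel_integrand_integrable: "t > 0 \<Longrightarrow> integrable (lborel \<Otimes>\<^sub>M lborel) (duhamel_integrand h k t)"
  unfolding duhamel_integrand_def by (rule duhamel_term.J_integrable[OF duhamel])

lemma duhamel_integrand_eq: "duhamel_integrand h k t (s, x) = indicator {0..<t} s * (cubic_gaussian a b ((1 / sqrt t) *\<^sub>R x) *
    multiplier (\<lambda>\<xi>. sym_heat (t - s) \<xi> * sym_leray a k \<xi> * sym_deriv h \<xi>) (\<lambda>y. f s y $ h * f s y $ k) x)"
  unfolding duhamel_integrand_def duhamel_term.J_def[OF duhamel] duhamel_term.multiplier_eq_evolved[OF duhamel, symmetric]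
  by (simp add: mult.assoc)

lemma duhamel_integrand_tendsto:
  "((\<lambda>t. of_real (sqrt t) * (LINT z|(lborel \<Otimes>\<^sub>M lborel). duhamel_integrand h k t z)) \<longlongrightarrow>
    of_real (1 / (2 * pi) ^ CARD('n)) *
      (- (of_real (sqrt (2 * pi) ^ CARD('n) * sextic_integral a b TYPE(real ^ 'n) / 2) * (conj_coeff a b h * conj_coeff a b k)) * of_real (energy h k))) at_top"
  using duhamel_term.J_tendsto[OF duhamel, of h k]
  unfolding integral_profile_coeff[OF ab] duhamel_integrand_def energy_def .

text \<open>The Duhamel term is subtracted in the mild equation and its own limit carries a minus
  sign; the two cancel and leave a positive prefactor.\<close>

definition profile_limit where "profile_limit = complex_of_real (1 / (2 * pi) ^ CARD('n) * (sqrt (2 * pi) ^ CARD('n) * sextic_integral a b TYPE(real ^ 'n) / 2)) *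
   (\<Sum>h\<in>UNIV. \<Sum>k\<in>UNIV. conj_coeff a b h * conj_coeff a b k * of_real (energy h k))"

lemma energy_sym: "energy h k = energy k h"
  unfolding energy_def by (simp add: mult.commute)

text \<open>The coefficients 1/2 and i/2 have opposite squares, so the contraction keeps the
  difference of the diagonal entries in its real part and the off-diagonal entry in its imaginary
  part.\<close>

lemma profile_limit_neq_0:
  assumes "energy a a \<noteq> energy b b \<or> energy a b \<noteq> 0"
  shows "profile_limit \<noteq> 0"
proof -
  have qs: "(\<Sum>k\<in>UNIV. conj_coeff a b k * g k) = 1 / 2 * g a + \<i> / 2 * g b" for g :: "'n \<Rightarrow> complex"
  proof -
    have "(\<Sum>k\<in>UNIV. conj_coeff a b k * g k) = (\<Sum>k\<in>{a, b}. conj_coeff a b k * g k)"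
      by (intro sum.mono_neutral_right) (auto simp: conj_coeff_def)
    then show ?thesis using ab by (simp add: conj_coeff_def)
  qed
  have "(\<Sum>h\<in>UNIV. \<Sum>k\<in>UNIV. conj_coeff a b h * conj_coeff a b k * of_real (energy h k)) =
      (\<Sum>h\<in>UNIV. conj_coeff a b h * (\<Sum>k\<in>UNIV. conj_coeff a b k * of_real (energy h k)))"
    by (simp add: sum_distrib_left mult.assoc)
  also have "\<dots> = Complex ((energy a a - energy b b) / 4) (energy a b / 2)"
    unfolding qs energy_sym[of b a] by (simp add: complex_eq_iff field_simps)
  also have "\<dots> \<noteq> 0"
    using assms by (auto simp: complex_eq_iff)
  finally show ?thesis
    using sextic_integral_pos[OF ab] unfolding profile_limit_def by simp
qed

text \<open>The velocity \<open>u\<close> itself is used at the fixed time \<open>t\<close>, where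
  the mild equation holds for almost every \<open>x\<close>; inside the time integral it is replaced
  by \<open>f\<close>, which agrees with it for almost every \<open>s\<close>.\<close>

theorem weak_asymptotics:
  fixes u :: "real \<Rightarrow> real ^ 'n \<Rightarrow> real ^ 'n" and a0 :: "real ^ 'n \<Rightarrow> real ^ 'n"
  assumes u_meas: "\<And>t. t \<ge> 0 \<Longrightarrow> u t \<in> borel_measurable lebesgue"
    and uf: "AE s in lborel. s \<ge> 0 \<longrightarrow> (AE x in lborel. u s x = f s x)"
    and mild: "\<And>t. t > 0 \<Longrightarrow> AE x in lebesgue. \<forall>j. complex_of_real (u t x $ j) =
          heat t a0 x j - (LINT s:{0..t}|lebesgue. heat_leray_div (t - s) (u s) x j)"
    and a0: "a0 \<in> borel_measurable lebesgue" "AE x in lebesgue. norm (a0 x) \<le> N * (1 + norm x) powr (- \<theta>)"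
      "\<theta> > real CARD('n) + 1"
  shows "((\<lambda>t. of_real (sqrt t) * (LINT x|lebesgue. cubic_gaussian a b ((1 / sqrt t) *\<^sub>R x) * of_real (u t x $ a))) \<longlongrightarrow> profile_limit) at_top"
proof -
  let ?\<phi> = "\<lambda>t x. cubic_gaussian a b ((1 / sqrt t) *\<^sub>R x)"
  obtain a1 where a1[measurable]: "a1 \<in> borel_measurable borel" and aa: "AE x in lborel. a0 x = a1 x"
    using ex_borel_version[OF a0(1)] by blast
  define A where "A x = a1 x $ a" for x
  have [measurable]: "A \<in> borel_measurable borel" unfolding A_def[abs_def] by measurable
  have "AE x in lborel. norm (a0 x) \<le> N * (1 + norm x) powr (- \<theta>)"
    using a0(2) by (simp add: AE_completion_iff)
  with aa have Ab: "AE x in lborel. \<bar>A x\<bar> \<le> \<bar>N\<bar> * (1 + norm x) powr (- \<theta>)"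
  proof eventually_elim
    case (elim x)
    have "\<bar>A x\<bar> \<le> norm (a1 x)" unfolding A_def by (rule component_le_norm_cart)
    also have "\<dots> \<le> N * (1 + norm x) powr (- \<theta>)" using elim by simp
    also have "\<dots> \<le> \<bar>N\<bar> * (1 + norm x) powr (- \<theta>)" by (intro mult_right_mono) auto
    finally show ?case .
  qed
  have Ai: "integrable lborel A"
    by (rule Bochner_Integration.integrable_bound[OF integrable_mult_right[OF integrable_weight[of \<theta>], of "\<bar>N\<bar>"]])
       (use a0(3) Ab in \<open>auto simp: abs_mult elim!: eventually_mono\<close>)
  \<comment> \<open>The first moment costs one power of the decay, and \<open>\<theta> - 1\<close>
    still exceeds the dimension.\<close>
  have Ai2: "integrable lborel (\<lambda>x. norm x * A x)"
  proof (rule Bochner_Integration.integrable_bound[OF integrable_mult_right[OF integrable_weight[of "\<theta> - 1"], of "\<bar>N\<bar>"]])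
    show "AE x in lborel. norm (norm x * A x) \<le> norm (\<bar>N\<bar> * (1 + norm x) powr (- (\<theta> - 1)))"
      using Ab
    proof eventually_elim
      case (elim x)
      have "norm x * \<bar>A x\<bar> \<le> (1 + norm x) * (\<bar>N\<bar> * (1 + norm x) powr (- \<theta>))"
        using elim by (intro mult_mono) auto
      also have "\<dots> = \<bar>N\<bar> * ((1 + norm x) * (1 + norm x) powr (- \<theta>))"
        by simp
      also have "(1 + norm x) * (1 + norm x) powr (- \<theta>) = (1 + norm x) powr (- (\<theta> - 1))"
        by (subst powr_mult_base) simp_all
      finally show ?case by (simp add: abs_mult)
    qed
  qed (use a0(3) in auto)
  have heatA: "heat t a0 x a = multiplier (sym_heat t) A x" for t x
  proof -
    have "multiplier (sym_heat t) (\<lambda>y. a0 y $ a) = multiplier (sym_heat t) A"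
    proof (rule multiplier_cong_AE)
      show "(\<lambda>y. a0 y $ a) \<in> borel_measurable lebesgue" using a0(1) by measurable
      show "A \<in> borel_measurable lebesgue" by (intro measurable_completion) simp
      show "AE x in lebesgue. a0 x $ a = A x"
        using AE_completion[OF aa] by eventually_elim (simp add: A_def)
    qed
    then show ?thesis by (simp add: heat_def)
  qed
  define Y where "Y t s x = (\<Sum>k\<in>UNIV. \<Sum>h\<in>UNIV. indicator {0..<t} s * 
     multiplier (\<lambda>\<xi>. sym_heat (t - s) \<xi> * sym_leray a k \<xi> * sym_deriv h \<xi>) (\<lambda>y. f s y $ h * f s y $ k) x)" for t s x
  have Y_meas: "(\<lambda>s. Y t s x) \<in> borel_measurable borel" for t x
  proof -
    have "(\<lambda>s. multiplier (\<lambda>\<xi>. sym_heat (t - s) \<xi> * sym_leray a k \<xi> * sym_deriv h \<xi>) (\<lambda>y. f s y $ h * f s y $ k) x) =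
        (\<lambda>s. duhamel_term.T (\<lambda>s x. f s x $ h * f s x $ k) (\<lambda>\<xi>. sym_leray a k \<xi> * sym_deriv h \<xi>) (t - s) s x)" for k h
      unfolding duhamel_term.multiplier_eq_evolved[OF duhamel, symmetric] by (simp add: mult.assoc)
    moreover have "(\<lambda>s. duhamel_term.T (\<lambda>s x. f s x $ h * f s x $ k) (\<lambda>\<xi>. sym_leray a k \<xi> * sym_deriv h \<xi>) (t - s) s x) \<in> borel_measurable borel" for k h
      by (rule duhamel_term.T_meas[OF duhamel]) measurable
    ultimately have [measurable]: "(\<lambda>s. multiplier (\<lambda>\<xi>. sym_heat (t - s) \<xi> * sym_leray a k \<xi> * sym_deriv h \<xi>) (\<lambda>y. f s y $ h * f s y $ k) x) \<in> borel_measurable borel" for k h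
      by simp
    show ?thesis unfolding Y_def by measurable
  qed
  \<comment> \<open>The exceptional times, those where \<open>u s\<close> and \<open>f s\<close>
    differ on a set of positive measure and the endpoint \<open>s = t\<close>, form a null set and
    do not affect the integral.\<close>
  have duh: "(LINT s:{0..t}|lebesgue. heat_leray_div (t - s) (u s) x a) = (LINT s|lborel. Y t s x)" if t: "t > 0" for t x
  proof -
    have ae: "AE s in lborel. indicator {0..t} s *\<^sub>R heat_leray_div (t - s) (u s) x a = Y t s x"
      using uf AE_lborel_singleton[of t]
    proof eventually_elim
      case (elim s)
      show ?case
      proof (cases "s \<in> {0..<t}")
        case False
        then show ?thesis using elim by (auto simp: Y_def)
      next
        case True
        then have s: "s \<ge> 0" by simp
        have m: "(\<lambda>y. f s y $ h * f s y $ k) \<in> borel_measurable lebesgue" for h k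
          by (intro measurable_completion) simp
        have mu: "(\<lambda>y. u s y $ h * u s y $ k) \<in> borel_measurable lebesgue" for h k
          using u_meas[OF s] by measurable
        have "AE y in lebesgue. u s y = f s y"
          using elim s by (auto intro: AE_completion)
        then have "AE y in lebesgue. u s y $ h * u s y $ k = f s y $ h * f s y $ k" for h k
          by eventually_elim simp
        from multiplier_cong_AE[OF mu m this] show ?thesis
          using True by (simp add: heat_leray_div_def Y_def)
      qed
    qed
    have Ym: "(\<lambda>s. Y t s x) \<in> borel_measurable lborel" using Y_meas by simp
    have "(LINT s:{0..t}|lebesgue. heat_leray_div (t - s) (u s) x a) = (LINT s|lebesgue. Y t s x)"
      unfolding set_lebesgue_integral_def
      by (intro integral_cong_AE completion_measurable_AE[OF ae Ym] measurable_completion[OF Ym] AE_completion[OF ae])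
    also have "\<dots> = (LINT s|lborel. Y t s x)"
      by (rule integral_completion[OF Ym])
    finally show ?thesis .
  qed
  have main: "of_real (sqrt t) * (LINT x|lebesgue. ?\<phi> t x * of_real (u t x $ a)) =
      of_real (sqrt t) * (LINT x|lborel. ?\<phi> t x * multiplier (sym_heat t) A x)
       - (\<Sum>k\<in>UNIV. \<Sum>h\<in>UNIV. of_real (sqrt t) * (LINT z|(lborel \<Otimes>\<^sub>M lborel). duhamel_integrand h k t z))"
    if t: "t > 0" for t
  proof -
    let ?F = "\<lambda>z. \<Sum>k\<in>UNIV. \<Sum>h\<in>UNIV. duhamel_integrand h k t z"
    have split: "(\<lambda>(s, x). G (s, x)) = G" for G :: "real \<times> (real ^ 'n) \<Rightarrow> complex"
      by (simp add: fun_eq_iff)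
    have "integrable (lborel \<Otimes>\<^sub>M lborel) ?F"
      by (intro Bochner_Integration.integrable_sum duhamel_integrand_integrable t)
    then have Fi: "integrable (lborel \<Otimes>\<^sub>M lborel) (\<lambda>(s, x). ?F (s, x))"
      unfolding split[of ?F] .
    have FY: "?F (s, x) = ?\<phi> t x * Y t s x" for s x
      by (simp add: duhamel_integrand_eq Y_def sum_distrib_left mult_ac)
    \<comment> \<open>A constant factor leaves the integral whether or not the integrand is
      integrable in \<open>s\<close>. The joint integrability of \<open>?F\<close> then gives
      integrability in \<open>x\<close> and the exchange of the two integrals.\<close>
    have X: "(LINT s|lborel. ?F (s, x)) = ?\<phi> t x * (LINT s|lborel. Y t s x)" for x
      unfolding FY by simp
    have Xi: "integrable lborel (\<lambda>x. ?\<phi> t x * (LINT s|lborel. Y t s x))"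
      using lborel_pair.integrable_snd[OF Fi] unfolding X .
    have XX: "(LINT x|lborel. ?\<phi> t x * (LINT s|lborel. Y t s x)) = (\<Sum>k\<in>UNIV. \<Sum>h\<in>UNIV. LINT z|(lborel \<Otimes>\<^sub>M lborel). duhamel_integrand h k t z)"
    proof -
      have "(LINT x|lborel. ?\<phi> t x * (LINT s|lborel. Y t s x)) = (LINT z|(lborel \<Otimes>\<^sub>M lborel). ?F z)"
        using lborel_pair.integral_snd[OF Fi] unfolding X split[of ?F] .
      also have "\<dots> = (\<Sum>k\<in>UNIV. \<Sum>h\<in>UNIV. LINT z|(lborel \<Otimes>\<^sub>M lborel). duhamel_integrand h k t z)"
        by (subst Bochner_Integration.integral_sum) (intro Bochner_Integration.integrable_sum duhamel_integrand_integrable t sum.cong refl Bochner_Integration.integral_sum)+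
      finally show ?thesis .
    qed
    let ?m = "\<lambda>\<xi>. sym_heat t \<xi> * ft (\<lambda>y. complex_of_real (A y)) (- \<xi>)"
    have H: "multiplier (sym_heat t) A x = of_real (1 / (2 * pi) ^ CARD('n)) * ft ?m x" for x
      by (rule multiplier_eq_ft) measurable
    have \<phi>i: "integrable lborel (?\<phi> t)"
      using t by (subst lborel_integrable_scaleR) (simp_all add: cubic_gaussian_integrable[OF ab])
    have [measurable]: "multiplier (sym_heat t) A \<in> borel_measurable borel"
      unfolding H[abs_def] by measurable
    define NM where "NM = (LINT x|lborel. norm (?m x))"
    define \<kappa> where "\<kappa> = norm (complex_of_real (1 / (2 * pi) ^ CARD('n)))"
    have H_le: "norm (multiplier (sym_heat t) A x) \<le> \<kappa> * NM" for x
    proof -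
      have "norm (ft ?m x) \<le> NM"
        unfolding NM_def by (rule norm_ft_le)
      then show ?thesis
        unfolding H norm_mult \<kappa>_def by (rule mult_left_mono) simp
    qed
    have Hi: "integrable lborel (\<lambda>x. ?\<phi> t x * multiplier (sym_heat t) A x)"
    proof (rule Bochner_Integration.integrable_bound[OF integrable_mult_left[OF integrable_norm[OF \<phi>i], of "\<kappa> * NM"]])
      show "AE x in lborel. norm (?\<phi> t x * multiplier (sym_heat t) A x) \<le> norm (norm (?\<phi> t x) * (\<kappa> * NM))"
      proof (rule AE_I2)
        fix x
        have "norm (?\<phi> t x * multiplier (sym_heat t) A x) \<le> norm (?\<phi> t x) * (\<kappa> * NM)"
          unfolding norm_mult by (intro mult_left_mono H_le) simp
        then show "norm (?\<phi> t x * multiplier (sym_heat t) A x) \<le> norm (norm (?\<phi> t x) * (\<kappa> * NM))"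
          by (rule order_trans) simp
      qed
    qed measurable
    have um: "u t \<in> borel_measurable lebesgue" using u_meas t by simp
    have \<phi>m: "?\<phi> t \<in> borel_measurable lebesgue" by (intro measurable_completion) simp
    have D: "(\<lambda>x. ?\<phi> t x * multiplier (sym_heat t) A x - ?\<phi> t x * (LINT s|lborel. Y t s x)) \<in> borel_measurable lborel"
      using Hi Xi by (intro borel_measurable_diff) auto
    have "(LINT x|lebesgue. ?\<phi> t x * of_real (u t x $ a)) =
       (LINT x|lebesgue. ?\<phi> t x * multiplier (sym_heat t) A x - ?\<phi> t x * (LINT s|lborel. Y t s x))"
    proof (rule integral_cong_AE)
      show "(\<lambda>x. ?\<phi> t x * of_real (u t x $ a)) \<in> borel_measurable lebesgue"
        using \<phi>m um by measurable
      show "(\<lambda>x. ?\<phi> t x * multiplier (sym_heat t) A x - ?\<phi> t x * (LINT s|lborel. Y t s x)) \<in> borel_measurable lebesgue"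
        by (rule measurable_completion[OF D])
      show "AE x in lebesgue. ?\<phi> t x * of_real (u t x $ a) =
          ?\<phi> t x * multiplier (sym_heat t) A x - ?\<phi> t x * (LINT s|lborel. Y t s x)"
        using mild[OF t] by eventually_elim (simp add: heatA duh[OF t] right_diff_distrib)
    qed
    also have "\<dots> = (LINT x|lborel. ?\<phi> t x * multiplier (sym_heat t) A x - ?\<phi> t x * (LINT s|lborel. Y t s x))"
      by (rule integral_completion[OF D])
    also have "\<dots> = (LINT x|lborel. ?\<phi> t x * multiplier (sym_heat t) A x) - (LINT x|lborel. ?\<phi> t x * (LINT s|lborel. Y t s x))"
      by (rule Bochner_Integration.integral_diff[OF Hi Xi])
    finally show ?thesis
      unfolding XX by (simp add: right_diff_distrib sum_distrib_left)
  qed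
  have heat0: "((\<lambda>t. of_real (sqrt t) * (LINT x|lborel. ?\<phi> t x * multiplier (sym_heat t) A x)) \<longlongrightarrow> 0) at_top"
    by (rule heat_pairing_tendsto_0[OF Ai Ai2 cubic_gaussian_integrable[OF ab] heat_cubic_gaussian_bounds[OF ab]])
  have "((\<lambda>t. of_real (sqrt t) * (LINT x|lborel. ?\<phi> t x * multiplier (sym_heat t) A x)
       - (\<Sum>k\<in>UNIV. \<Sum>h\<in>UNIV. of_real (sqrt t) * (LINT z|(lborel \<Otimes>\<^sub>M lborel). duhamel_integrand h k t z))) \<longlongrightarrow>
     0 - (\<Sum>k\<in>UNIV. \<Sum>h\<in>UNIV. of_real (1 / (2 * pi) ^ CARD('n)) *
      (- (of_real (sqrt (2 * pi) ^ CARD('n) * sextic_integral a b TYPE(real ^ 'n) / 2) * (conj_coeff a b h * conj_coeff a b k)) * of_real (energy h k)))) at_top"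
    by (intro tendsto_diff heat0 tendsto_sum duhamel_integrand_tendsto)
  also have "0 - (\<Sum>k\<in>UNIV. \<Sum>h\<in>UNIV. of_real (1 / (2 * pi) ^ CARD('n)) *
      (- (of_real (sqrt (2 * pi) ^ CARD('n) * sextic_integral a b TYPE(real ^ 'n) / 2) * (conj_coeff a b h * conj_coeff a b k)) * of_real (energy h k))) = profile_limit"
    unfolding profile_limit_def of_real_mult[of "1 / (2 * pi) ^ CARD('n)"]
    by (subst sum.swap) (simp only: sum_distrib_left mult_minus_left mult_minus_right sum_negf diff_0 minus_minus mult.assoc)
  finally show ?thesis
    by (rule Lim_transform_eventually)
       (use eventually_gt_at_top[of 0] in \<open>eventually_elim, simp only: main\<close>)
qed

end

section \<open>From weak asymptotics to norms\<close>

text \<open>A mass \<open>m\<close> on a set of volume at most \<open>M\<close> forces a p-norm of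
  order \<open>(m / M) * M powr (1 / p)\<close>. The factor lost is 1/2 for every p and \<alpha>, so
  that the final constant can be uniform in them.\<close>

lemma Lp_lower_bound:
  fixes v :: "real ^ 'n \<Rightarrow> real ^ 'n" and A :: "(real ^ 'n) set"
  assumes v: "v \<in> borel_measurable lebesgue" and A: "A \<in> sets lebesgue"
    and lower: "ennreal m \<le> (\<integral>\<^sup>+x. ennreal (norm (v x)) * indicator A x \<partial>lebesgue)"
    and vol: "emeasure lebesgue A \<le> ennreal M" and m: "m > 0" and M: "M > 0"
    and far: "\<And>x. x \<in> A \<Longrightarrow> r \<le> 1 + norm x" and r: "r > 0"
    and p: "1 \<le> p" and \<alpha>: "0 \<le> \<alpha>"
  shows "wLp_norm p \<alpha> v \<ge> ennreal (r powr \<alpha> * (m / (2 * M)) * M powr (1 / p))"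
proof -
  \<comment> \<open>Half of the mean height \<open>m / M\<close>: values below \<open>K\<close>
    account for at most \<open>K * M = m / 2\<close> of the mass, so the other half must come from
    the p-th power.\<close>
  define K where "K = m / (2 * M)"
  have K: "K > 0" using m M by (simp add: K_def)
  define I where "I = (\<integral>\<^sup>+x. ennreal (norm (v x) powr p * (1 + norm x) powr (p * \<alpha>)) \<partial>lebesgue)"
  have [measurable]: "v \<in> borel_measurable lebesgue" "A \<in> sets lebesgue" by fact+
  \<comment> \<open>replaces Hoelder's inequality at the cost of a factor 2\<close>
  have pt: "y \<le> K powr (1 - p) * y powr p + K" if y: "y \<ge> 0" for y
  proof (cases "y \<le> K")
    case True
    then show ?thesis using K by (intro order_trans[OF True]) simp
  next
    case False
    then have "y > K" by simp
    have "y = K powr (1 - p) * (K powr (p - 1) * y)"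
      using K by (simp add: mult.assoc[symmetric] powr_add[symmetric])
    also have "\<dots> \<le> K powr (1 - p) * (y powr (p - 1) * y)"
      using \<open>y > K\<close> K p by (intro mult_left_mono mult_right_mono powr_mono2) auto
    also have "y powr (p - 1) * y = y powr p"
      using powr_mult_base[OF y, of "p - 1"] by (simp add: mult.commute)
    finally show ?thesis using K by simp
  qed
  have "ennreal m \<le> (\<integral>\<^sup>+x. ennreal (norm (v x)) * indicator A x \<partial>lebesgue)" by (rule lower)
  also have "\<dots> \<le> (\<integral>\<^sup>+x. ennreal (K powr (1 - p)) * (ennreal (norm (v x) powr p) * indicator A x) + ennreal K * indicator A x \<partial>lebesgue)"
  proof (rule nn_integral_mono)
    fix x
    have "ennreal (norm (v x)) \<le> ennreal (K powr (1 - p) * norm (v x) powr p + K)"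
      by (intro ennreal_leI pt) simp
    also have "\<dots> = ennreal (K powr (1 - p)) * ennreal (norm (v x) powr p) + ennreal K"
      using K by (simp add: ennreal_mult ennreal_plus)
    finally show "ennreal (norm (v x)) * indicator A x \<le>
        ennreal (K powr (1 - p)) * (ennreal (norm (v x) powr p) * indicator A x) + ennreal K * indicator A x"
      by (simp split: split_indicator)
  qed
  also have "\<dots> = ennreal (K powr (1 - p)) * (\<integral>\<^sup>+x. ennreal (norm (v x) powr p) * indicator A x \<partial>lebesgue) + ennreal K * emeasure lebesgue A"
    by (subst nn_integral_add) (simp_all add: nn_integral_cmult)
  also have "ennreal K * emeasure lebesgue A \<le> ennreal K * ennreal M"
    by (rule mult_left_mono[OF vol]) simp
  also have "ennreal K * ennreal M = ennreal (m / 2)"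
    using K M by (simp add: ennreal_mult[symmetric] K_def)
  finally have 1: "ennreal m \<le> ennreal (K powr (1 - p)) * (\<integral>\<^sup>+x. ennreal (norm (v x) powr p) * indicator A x \<partial>lebesgue) + ennreal (m / 2)"
    by (simp add: add_mono)
  have 2: "ennreal (r powr (p * \<alpha>)) * (\<integral>\<^sup>+x. ennreal (norm (v x) powr p) * indicator A x \<partial>lebesgue) \<le> I"
  proof -
    have "ennreal (r powr (p * \<alpha>)) * (\<integral>\<^sup>+x. ennreal (norm (v x) powr p) * indicator A x \<partial>lebesgue) =
        (\<integral>\<^sup>+x. ennreal (r powr (p * \<alpha>)) * (ennreal (norm (v x) powr p) * indicator A x) \<partial>lebesgue)"
      by (rule nn_integral_cmult[symmetric]) measurable
    also have "\<dots> \<le> I"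
      unfolding I_def
    proof (rule nn_integral_mono)
      fix x
      show "ennreal (r powr (p * \<alpha>)) * (ennreal (norm (v x) powr p) * indicator A x) \<le> ennreal (norm (v x) powr p * (1 + norm x) powr (p * \<alpha>))"
      proof (cases "x \<in> A")
        case True
        have "r powr (p * \<alpha>) \<le> (1 + norm x) powr (p * \<alpha>)"
          using far[OF True] r p \<alpha> by (intro powr_mono2) auto
        then have "r powr (p * \<alpha>) * norm (v x) powr p \<le> norm (v x) powr p * (1 + norm x) powr (p * \<alpha>)"
          using mult_right_mono[of "r powr (p * \<alpha>)" "(1 + norm x) powr (p * \<alpha>)" "norm (v x) powr p"]
          by (simp add: mult_ac)
        then show ?thesis using True by (simp add: ennreal_mult[symmetric])
      qed simp
    qed
    finally show ?thesis .
  qed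
  show ?thesis
  proof (cases "I = \<infinity>")
    case True
    then show ?thesis unfolding wLp_norm_def I_def[symmetric] by simp
  next
    case False
    then obtain i where i: "I = ennreal i" "i \<ge> 0" by (cases I) auto
    let ?Q = "\<integral>\<^sup>+x. ennreal (norm (v x) powr p) * indicator A x \<partial>lebesgue"
    have "?Q \<noteq> \<infinity>"
      using 2 False r by (auto simp: ennreal_mult_top top_unique ennreal_mult_eq_top_iff)
    then obtain q where q: "?Q = ennreal q" "q \<ge> 0" by (cases ?Q) auto
    have "ennreal m \<le> ennreal (K powr (1 - p) * q + m / 2)"
      using 1 q m by (simp add: ennreal_mult ennreal_plus)
    then have "m \<le> K powr (1 - p) * q + m / 2"
      using q m by (subst (asm) ennreal_le_iff) auto
    then have "K powr (p - 1) * (m / 2) \<le> K powr (p - 1) * (K powr (1 - p) * q)"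
      by (intro mult_left_mono) auto
    also have "\<dots> = q"
      using K by (simp add: mult.assoc[symmetric] powr_add[symmetric])
    also have "m / 2 = K * M" using M by (simp add: K_def)
    also have "K powr (p - 1) * (K * M) = K powr p * M"
      using powr_mult_base[of K "p - 1"] K by (simp add: mult.assoc[symmetric] mult.commute)
    finally have qK: "K powr p * M \<le> q" .
    have "r powr (p * \<alpha>) * q \<le> i"
      using 2 i q by (simp add: ennreal_mult[symmetric])
    then have i_lower: "r powr (p * \<alpha>) * (K powr p * M) \<le> i"
      using mult_left_mono[OF qK, of "r powr (p * \<alpha>)"] by simp
    have "r powr \<alpha> * K * M powr (1 / p) = (r powr (p * \<alpha>) * (K powr p * M)) powr (1 / p)"
      using r K M p by (simp add: powr_mult powr_powr)
    also have "\<dots> \<le> i powr (1 / p)"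
      using i_lower K M p r by (intro powr_mono2) auto
    finally show ?thesis
      using False i unfolding wLp_norm_def I_def[symmetric] K_def[symmetric] by (simp add: ennreal_leI)
  qed
qed

lemma Linf_lower_bound:
  fixes v :: "real ^ 'n \<Rightarrow> real ^ 'n" and A :: "(real ^ 'n) set"
  assumes A: "A \<in> sets lebesgue"
    and lower: "ennreal m \<le> (\<integral>\<^sup>+x. ennreal (norm (v x)) * indicator A x \<partial>lebesgue)"
    and vol: "emeasure lebesgue A \<le> ennreal M" and m: "m > 0" and M: "M > 0"
    and far: "\<And>x. x \<in> A \<Longrightarrow> r \<le> 1 + norm x" and r: "r > 0" and \<alpha>: "0 \<le> \<alpha>"
  shows "wLinf_norm \<alpha> v \<ge> ennreal (r powr \<alpha> * (m / M))"
proof (cases "wLinf_norm \<alpha> v")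
  case (real n)
  have ae: "AE x in lebesgue. ennreal ((1 + norm x) powr \<alpha> * norm (v x)) \<le> ennreal n"
    using esssup_AE[where M = lebesgue and f = "\<lambda>x. ennreal ((1 + norm x) powr \<alpha> * norm (v x))"] real
    unfolding wLinf_norm_def by simp
  have "ennreal m \<le> (\<integral>\<^sup>+x. ennreal (n / r powr \<alpha>) * indicator A x \<partial>lebesgue)"
  proof (rule order_trans[OF lower], rule nn_integral_mono_AE)
    show "AE x in lebesgue. ennreal (norm (v x)) * indicator A x \<le> ennreal (n / r powr \<alpha>) * indicator A x"
      using ae
    proof eventually_elim
      case (elim x)
      show ?case
      proof (cases "x \<in> A")
        case True
        have "r powr \<alpha> * norm (v x) \<le> (1 + norm x) powr \<alpha> * norm (v x)"
          using far[OF True] r \<alpha> by (intro mult_right_mono powr_mono2) auto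
        also have "\<dots> \<le> n" using elim real(1) by simp
        finally have "norm (v x) \<le> n / r powr \<alpha>" using r by (simp add: field_simps)
        then show ?thesis using True by (simp add: ennreal_leI)
      qed simp
    qed
  qed
  also have "\<dots> = ennreal (n / r powr \<alpha>) * emeasure lebesgue A"
    using A by (rule nn_integral_cmult_indicator)
  also have "\<dots> \<le> ennreal (n / r powr \<alpha>) * ennreal M"
    by (rule mult_left_mono[OF vol]) simp
  also have "\<dots> = ennreal (n / r powr \<alpha> * M)"
    using real(1) r M by (intro ennreal_mult[symmetric]) auto
  finally have "m \<le> n / r powr \<alpha> * M"
    using real(1) r M by (subst (asm) ennreal_le_iff) auto
  then have "r powr \<alpha> * (m / M) \<le> n"
    using r M by (simp add: field_simps)
  then show ?thesis using real by (simp add: ennreal_leI)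
qed simp

lemma annulus_sets: "{x::real ^ 'n. r \<le> norm x \<and> norm x \<le> R} \<in> sets lebesgue"
proof -
  have "closed {x::real ^ 'n. r \<le> norm x \<and> norm x \<le> R}"
    by (intro closed_Collect_conj closed_Collect_le continuous_intros)
  then show ?thesis by (simp add: borel_closed)
qed

text \<open>The limit gives a lower bound \<open>l / sqrt t\<close> for the pairing. Inside the
  annulus the test function is bounded by 20, and outside it both regions are controlled by
  \<epsilon> times the rescaled profile \<Psi>, so the mass has to lie in the annulus.\<close>

lemma annulus_lower_bound:
  fixes u :: "real \<Rightarrow> real ^ 'n \<Rightarrow> real ^ 'n" and a b :: 'n
  assumes ab: "a \<noteq> b"
    and meas: "\<And>t. t \<ge> 0 \<Longrightarrow> u t \<in> borel_measurable lebesgue"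
    and lim: "((\<lambda>t. of_real (sqrt t) * (LINT x|lebesgue. cubic_gaussian a b ((1 / sqrt t) *\<^sub>R x) * of_real (u t x $ a))) \<longlongrightarrow> L) at_top"
    and L: "L \<noteq> 0"
    and time: "\<And>t. t > 0 \<Longrightarrow> AE x in lebesgue. norm (u t x) \<le> C * (1 + t) powr (- (real CARD('n) + 1) / 2)"
    and space: "\<And>t. t > 0 \<Longrightarrow> AE x in lebesgue. norm (u t x) \<le> C * (1 + norm x) powr (- (real CARD('n) + 1))"
    and C: "C \<ge> 0"
  obtains t0 \<epsilon> c where "t0 > 0" "0 < \<epsilon>" "\<epsilon> \<le> 1" "c > 0"
    "\<And>t. t \<ge> t0 \<Longrightarrow> ennreal (c / sqrt t) \<le>
      (\<integral>\<^sup>+x. ennreal (norm (u t x)) * indicator {x. \<epsilon> * sqrt t \<le> norm x \<and> norm x \<le> sqrt t / \<epsilon>} x \<partial>lebesgue)"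
proof -
  \<comment> \<open>The cube bounds the test function itself, for use far out; the square is what
    remains near the origin after one factor \<open>norm y \<le> \<epsilon>\<close> has been taken
    out.\<close>
  define \<Psi> where "\<Psi> y = (norm y ^ 2 + norm y ^ 3) * exp (- (1 / 2 * (norm y)\<^sup>2))" for y :: "real ^ 'n"
  have \<Psi>i: "integrable lborel \<Psi>"
    unfolding \<Psi>_def[abs_def] distrib_right
    by (intro Bochner_Integration.integrable_add integrable_norm_power_gaussian) auto
  have \<Psi>0: "\<Psi> y \<ge> 0" for y by (simp add: \<Psi>_def)
  define I where "I = (LINT y|lborel. \<Psi> y)"
  have I0: "I \<ge> 0" unfolding I_def using \<Psi>0 by simp
  define l where "l = norm L / 2"
  have l: "l > 0" using L by (simp add: l_def)
  \<comment> \<open>Chosen so that the error \<open>2 * \<epsilon> * C * I\<close> is at most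
    \<open>l / 2\<close>. The added 1 keeps the denominator positive, and the bound by 1 makes
    higher powers of \<epsilon> smaller than \<epsilon>.\<close>
  define \<epsilon> where "\<epsilon> = min 1 (l / (4 * (C * I + 1)))"
  have CI: "C * I + 1 > 0" using C I0 by (simp add: add_nonneg_pos)
  have \<epsilon>: "0 < \<epsilon>" "\<epsilon> \<le> 1" using l CI by (auto simp: \<epsilon>_def)
  have \<epsilon>I: "2 * \<epsilon> * C * I \<le> l / 2"
  proof -
    have "\<epsilon> * (C * I + 1) \<le> l / 4"
    proof -
      have "\<epsilon> * (C * I + 1) \<le> l / (4 * (C * I + 1)) * (C * I + 1)"
        using CI by (intro mult_right_mono) (auto simp: \<epsilon>_def)
      also have "\<dots> = l / 4" using CI by (simp add: divide_simps)
      finally show ?thesis .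
    qed
    moreover have "\<epsilon> * (C * I) \<le> \<epsilon> * (C * I + 1)" using \<epsilon> by (intro mult_left_mono) auto
    ultimately show ?thesis by simp
  qed
  have "\<forall>\<^sub>F t in at_top. norm (of_real (sqrt t) * (LINT x|lebesgue. cubic_gaussian a b ((1 / sqrt t) *\<^sub>R x) * of_real (u t x $ a))) > l"
    using order_tendstoD(1)[OF tendsto_norm[OF lim], of l] L by (simp add: l_def)
  then obtain t1 where t1: "\<And>t. t \<ge> t1 \<Longrightarrow> norm (of_real (sqrt t) * (LINT x|lebesgue. cubic_gaussian a b ((1 / sqrt t) *\<^sub>R x) * of_real (u t x $ a))) > l"
    unfolding eventually_at_top_linorder by blast
  show ?thesis
  \<comment> \<open>After the error has taken \<open>l / 2\<close> from \<open>l\<close>, the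
    remaining \<open>l / 2\<close> is divided by the bound 20 of the test function.\<close>
  proof (rule that[of "max t1 1" \<epsilon> "l / 40"])
    fix t :: real assume t: "t \<ge> max t1 1"
    then have t0: "t > 0" "t \<ge> t1" by auto
    let ?A = "{x::real ^ 'n. \<epsilon> * sqrt t \<le> norm x \<and> norm x \<le> sqrt t / \<epsilon>}"
    let ?y = "\<lambda>x::real ^ 'n. (1 / sqrt t) *\<^sub>R x"
    let ?D = "C * t powr (- (real CARD('n) + 1) / 2)"
    have [measurable]: "u t \<in> borel_measurable lebesgue" using meas t0 by simp
    have [measurable]: "?A \<in> sets lebesgue" by (rule annulus_sets)
    have D0: "?D \<ge> 0" using C by simp
    have pt: "AE x in lebesgue. norm (cubic_gaussian a b (?y x) * of_real (u t x $ a)) \<le>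
        20 * (norm (u t x) * indicator ?A x) + 2 * \<epsilon> * ?D * \<Psi> (?y x)"
      using time[OF t0(1)] space[OF t0(1)]
    proof eventually_elim
      case (elim x)
      have ua: "\<bar>u t x $ a\<bar> \<le> norm (u t x)" by (rule component_le_norm_cart)
      have D1: "norm (u t x) \<le> ?D"
        using elim(1) by (rule order_trans) (use C t0 in \<open>intro mult_left_mono powr_mono2', auto\<close>)
      have EDP: "0 \<le> \<epsilon> * ?D * \<Psi> (?y x)"
        using \<epsilon> by (intro mult_nonneg_nonneg D0 \<Psi>0) auto
      have ny: "norm (?y x) = norm x / sqrt t" using t0 by simp
      have e: "exp (- (norm (?y x))\<^sup>2 / 2) = exp (- (1 / 2 * (norm (?y x))\<^sup>2))" by simp
      have p1: "norm (cubic_gaussian a b (?y x)) \<le> norm (?y x) ^ 3 * exp (- (1 / 2 * (norm (?y x))\<^sup>2))"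
        using norm_cubic_gaussian_le[OF ab, of "?y x"] unfolding e .
      show ?case
      proof (cases "x \<in> ?A")
        case True
        have "norm (cubic_gaussian a b (?y x) * of_real (u t x $ a)) \<le> 20 * norm (u t x)"
          unfolding norm_mult norm_of_real by (intro mult_mono norm_cubic_gaussian_bounded ab ua) auto
        also have "\<dots> \<le> 20 * (norm (u t x) * indicator ?A x) + 2 * \<epsilon> * ?D * \<Psi> (?y x)"
          using True \<epsilon> D0 \<Psi>0[of "?y x"] by simp
        finally show ?thesis .
      next
        case False
        then consider "norm x < \<epsilon> * sqrt t" | "norm x > sqrt t / \<epsilon>" by force
        then have "norm (cubic_gaussian a b (?y x)) * norm (u t x) \<le> 2 * \<epsilon> * ?D * \<Psi> (?y x)"
        proof cases
          \<comment> \<open>Inner ball: the cubic vanishing of the test function supplies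
            \<epsilon>, the decay in time bounds the velocity.\<close>
          case 1
          then have y: "norm (?y x) \<le> \<epsilon>" using t0 by (simp add: ny field_simps)
          have "norm (cubic_gaussian a b (?y x)) \<le> norm (?y x) * (norm (?y x) ^ 2 * exp (- (1 / 2 * (norm (?y x))\<^sup>2)))"
            using p1 by (simp add: power3_eq_cube power2_eq_square mult_ac)
          also have "\<dots> \<le> \<epsilon> * \<Psi> (?y x)"
            using y \<epsilon> unfolding \<Psi>_def by (intro mult_mono mult_right_mono) auto
          finally have "norm (cubic_gaussian a b (?y x)) * norm (u t x) \<le> \<epsilon> * \<Psi> (?y x) * ?D"
            using D1 \<epsilon> \<Psi>0[of "?y x"] by (intro mult_mono) auto
          also have "\<dots> = \<epsilon> * ?D * \<Psi> (?y x)" by (simp only: mult_ac)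
          also have "\<dots> \<le> 2 * (\<epsilon> * ?D * \<Psi> (?y x))" using EDP by linarith
          also have "\<dots> = 2 * \<epsilon> * ?D * \<Psi> (?y x)" by (simp only: mult.assoc)
          finally show ?thesis .
        next
          \<comment> \<open>Exterior: here the velocity supplies \<epsilon>. Its decay in space,
            evaluated at radius \<open>sqrt t / \<epsilon>\<close>, equals the decay in time
            multiplied by \<epsilon>^(d + 1), of which one power is kept.\<close>
          case 2
          have pos: "0 < sqrt t / \<epsilon>" using \<epsilon> t0 by simp
          have "norm (u t x) \<le> C * (sqrt t / \<epsilon>) powr (- (real CARD('n) + 1))"
            using elim(2) by (rule order_trans) (use C 2 pos in \<open>intro mult_left_mono powr_mono2', auto\<close>)
          also have "(sqrt t / \<epsilon>) powr (- (real CARD('n) + 1)) = \<epsilon> powr (real CARD('n) + 1) * t powr (- (real CARD('n) + 1) / 2)"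
          proof -
            have "(sqrt t / \<epsilon>) powr (- q) = \<epsilon> powr q * t powr (- q / 2)" for q
              using t0 \<epsilon> by (simp add: powr_divide powr_minus powr_half_sqrt[symmetric] powr_powr field_simps)
            then show ?thesis .
          qed
          also have "C * \<dots> \<le> C * (\<epsilon> powr 1 * t powr (- (real CARD('n) + 1) / 2))"
            using \<epsilon> C by (intro mult_left_mono mult_right_mono powr_mono') auto
          finally have u2: "norm (u t x) \<le> \<epsilon> * ?D" using \<epsilon> by (simp add: mult_ac)
          have "norm (cubic_gaussian a b (?y x)) \<le> \<Psi> (?y x)"
            using p1 by (rule order_trans) (simp add: \<Psi>_def)
          then have "norm (cubic_gaussian a b (?y x)) * norm (u t x) \<le> \<Psi> (?y x) * (\<epsilon> * ?D)"
            using u2 \<Psi>0 by (intro mult_mono) auto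
          also have "\<dots> = \<epsilon> * ?D * \<Psi> (?y x)" by (simp only: mult_ac)
          also have "\<dots> \<le> 2 * (\<epsilon> * ?D * \<Psi> (?y x))" using EDP by linarith
          also have "\<dots> = 2 * \<epsilon> * ?D * \<Psi> (?y x)" by (simp only: mult.assoc)
          finally show ?thesis .
        qed
        moreover have "norm (cubic_gaussian a b (?y x) * of_real (u t x $ a)) \<le> norm (cubic_gaussian a b (?y x)) * norm (u t x)"
          unfolding norm_mult norm_of_real by (intro mult_left_mono ua) simp
        ultimately show ?thesis using False by simp
      qed
    qed
    have \<Psi>t: "(\<integral>\<^sup>+x. ennreal (\<Psi> (?y x)) \<partial>lebesgue) = ennreal (sqrt t ^ CARD('n) * I)"
    proof -
      have [measurable]: "\<Psi> \<in> borel_measurable borel" unfolding \<Psi>_def[abs_def] by measurable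
      have "(\<integral>\<^sup>+x. ennreal (\<Psi> (?y x)) \<partial>lebesgue) = (\<integral>\<^sup>+x. ennreal (\<Psi> (?y x)) \<partial>lborel)"
        by (rule nn_integral_completion)
      also have "\<dots> = ennreal (sqrt t ^ CARD('n)) * (\<integral>\<^sup>+x. ennreal (\<Psi> (?y (sqrt t *\<^sub>R x))) \<partial>lborel)"
        using t0 by (intro nn_integral_lborel_scaleR) auto
      also have "(\<integral>\<^sup>+x. ennreal (\<Psi> (?y (sqrt t *\<^sub>R x))) \<partial>lborel) = ennreal I"
        using t0 \<Psi>i \<Psi>0 by (simp add: nn_integral_eq_integral I_def)
      finally show ?thesis using I0 t0 by (simp only:) (intro ennreal_mult[symmetric], auto)
    qed
    let ?X = "\<integral>\<^sup>+x. ennreal (norm (u t x)) * indicator ?A x \<partial>lebesgue"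
    have "ennreal (norm (LINT x|lebesgue. cubic_gaussian a b (?y x) * of_real (u t x $ a))) \<le>
        (\<integral>\<^sup>+x. ennreal (norm (cubic_gaussian a b (?y x) * of_real (u t x $ a))) \<partial>lebesgue)"
      by (rule norm_LINT_le_nn_integral)
    also have "\<dots> \<le> (\<integral>\<^sup>+x. ennreal 20 * (ennreal (norm (u t x)) * indicator ?A x) + ennreal (2 * \<epsilon> * ?D) * ennreal (\<Psi> (?y x)) \<partial>lebesgue)"
    proof (rule nn_integral_mono_AE)
      show "AE x in lebesgue. ennreal (norm (cubic_gaussian a b (?y x) * of_real (u t x $ a))) \<le>
          ennreal 20 * (ennreal (norm (u t x)) * indicator ?A x) + ennreal (2 * \<epsilon> * ?D) * ennreal (\<Psi> (?y x))"
        using pt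
      proof eventually_elim
        case (elim x)
        have "ennreal (norm (cubic_gaussian a b (?y x) * of_real (u t x $ a))) \<le> ennreal (20 * (norm (u t x) * indicator ?A x) + 2 * \<epsilon> * ?D * \<Psi> (?y x))"
          by (rule ennreal_leI[OF elim])
        also have "\<dots> = ennreal (20 * (norm (u t x) * indicator ?A x)) + ennreal (2 * \<epsilon> * ?D * \<Psi> (?y x))"
          using \<epsilon> D0 \<Psi>0[of "?y x"] by (intro ennreal_plus) auto
        also have "ennreal (20 * (norm (u t x) * indicator ?A x)) = ennreal 20 * (ennreal (norm (u t x)) * indicator ?A x)"
          by (subst ennreal_mult) (auto simp: ennreal_mult split: split_indicator)
        also have "ennreal (2 * \<epsilon> * ?D * \<Psi> (?y x)) = ennreal (2 * \<epsilon> * ?D) * ennreal (\<Psi> (?y x))"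
          using \<epsilon> D0 \<Psi>0[of "?y x"] by (intro ennreal_mult) auto
        finally show ?case .
      qed
    qed
    also have "\<dots> = ennreal 20 * ?X + ennreal (2 * \<epsilon> * ?D) * ennreal (sqrt t ^ CARD('n) * I)"
    proof -
      have "(\<lambda>x. ennreal (\<Psi> (?y x))) \<in> borel_measurable lebesgue"
        unfolding \<Psi>_def by (intro measurable_completion) measurable
      then show ?thesis
        by (subst nn_integral_add) (simp_all add: nn_integral_cmult \<Psi>t)
    qed
    \<comment> \<open>The Jacobian \<open>sqrt t ^ CARD('n)\<close> cancels all of the decay except
      \<open>1 / sqrt t\<close>, the order of the main term; large \<open>t\<close> gains nothing
      here, only small \<epsilon> does.\<close>
    also have "ennreal (2 * \<epsilon> * ?D) * ennreal (sqrt t ^ CARD('n) * I) = ennreal (2 * \<epsilon> * C * I / sqrt t)"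
    proof -
      have "t powr (- (real CARD('n) + 1) / 2) * sqrt t ^ CARD('n) = t powr (- 1 / 2)"
        using t0 by (simp add: powr_half_sqrt[symmetric] powr_realpow[symmetric] powr_powr powr_add[symmetric] field_simps)
      also have "\<dots> = 1 / sqrt t" using t0 by (simp add: powr_minus_divide powr_half_sqrt)
      finally have "t powr (- (real CARD('n) + 1) / 2) * sqrt t ^ CARD('n) = 1 / sqrt t" .
      then have "2 * \<epsilon> * ?D * (sqrt t ^ CARD('n) * I) = 2 * \<epsilon> * C * I * (1 / sqrt t)"
        by (simp only: mult_ac)
      then show ?thesis
        using \<epsilon> D0 I0 by (simp add: ennreal_mult[symmetric] t0(1)[THEN less_imp_le])
    qed
    also have "\<dots> \<le> ennreal (l / 2 / sqrt t)"
      using \<epsilon>I t0 by (intro ennreal_leI divide_right_mono) auto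
    finally have 1: "ennreal (norm (LINT x|lebesgue. cubic_gaussian a b (?y x) * of_real (u t x $ a))) \<le> ennreal 20 * ?X + ennreal (l / 2 / sqrt t)"
      by (simp add: add_left_mono)
    have "l / sqrt t \<le> norm (LINT x|lebesgue. cubic_gaussian a b (?y x) * of_real (u t x $ a))"
      using t1[OF t0(2)] t0(1) by (simp add: norm_mult field_simps)
    then have "ennreal (l / sqrt t) \<le> ennreal (norm (LINT x|lebesgue. cubic_gaussian a b (?y x) * of_real (u t x $ a)))"
      by (rule ennreal_leI)
    with 1 have 2: "ennreal (l / sqrt t) \<le> ennreal 20 * ?X + ennreal (l / 2 / sqrt t)" by (rule order_trans[rotated])
    show "ennreal (l / 40 / sqrt t) \<le> ?X"
    proof (cases ?X)
      case (real q)
      have "ennreal (l / sqrt t) \<le> ennreal (20 * q + l / 2 / sqrt t)"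
        using 2 real l t0 by (simp add: ennreal_mult ennreal_plus)
      then have "l / sqrt t \<le> 20 * q + l / 2 / sqrt t"
        using real l t0 by (subst (asm) ennreal_le_iff) auto
      then have "l / 40 / sqrt t \<le> q" by (simp add: field_simps)
      then show ?thesis using real by (simp add: ennreal_leI)
    qed simp
  qed (use \<epsilon> l in auto)
qed

section \<open>The limiting energy matrix and the gradient of the asymptotic profile\<close>

lemma (in flow) energy_tendsto:
  "((\<lambda>t. LINT s|lborel. indicator {0..t} s * (LINT y|lborel. f s y $ h * f s y $ k)) \<longlongrightarrow> energy h k) at_top"
  unfolding energy_def
proof (rule integral_dominated_convergence_at_top)
  let ?W = "LINT x::real ^ 'n|lborel. space_weight x"
  let ?g = "\<lambda>s. LINT y|lborel. f s y $ h * f s y $ k"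
  show "integrable lborel (\<lambda>s. K * ?W * time_weight TYPE('n) s)"
    using time_weight_props(1)[OF card] by simp
  have g: "\<bar>?g s\<bar> \<le> K * ?W * time_weight TYPE('n) s" if s: "s \<ge> 0" for s
    using duhamel_term.g_hat_le[OF duhamel s, of h k 0] duhamel_term.g_integrable[OF duhamel s, of h k]
    unfolding duhamel_term.g_hat_def[OF duhamel] duhamel_term.W_def[OF duhamel] by (simp del: of_real_mult)
  show "\<forall>\<^sub>F t in at_top. AE s in lborel. norm (indicator {0..t} s * ?g s) \<le> K * ?W * time_weight TYPE('n) s"
  proof (intro always_eventually allI AE_I2)
    fix t s :: real
    have "0 \<le> K * ?W * time_weight TYPE('n) s"
      using K space_weight_props(2) time_weight_props(2)[OF card] by (intro mult_nonneg_nonneg Bochner_Integration.integral_nonneg) auto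
    then show "norm (indicator {0..t} s * ?g s) \<le> K * ?W * time_weight TYPE('n) s"
      using g[of s] by (auto simp: indicator_def)
  qed
  show "AE s in lborel. ((\<lambda>t. indicator {0..t} s * ?g s) \<longlongrightarrow> indicator {0..} s * ?g s) at_top"
  proof (rule AE_I2)
    fix s :: real
    have "\<forall>\<^sub>F t in at_top. indicator {0..} s * ?g s = indicator {0..t} s * ?g s"
      using eventually_ge_at_top[of s] by eventually_elim (auto simp: indicator_def)
    from Lim_transform_eventually[OF tendsto_const this]
    show "((\<lambda>t. indicator {0..t} s * ?g s) \<longlongrightarrow> indicator {0..} s * ?g s) at_top" .
  qed
qed measurable

text \<open>Away from the origin, a nonzero multiple of the second derivative in directions
  \<open>h\<close> and \<open>k\<close> of the fundamental solution of the Laplacian; harmonicity of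
  the latter is the reason for the vanishing trace.\<close>

definition profile_kernel :: "'n \<Rightarrow> 'n \<Rightarrow> real ^ 'n \<Rightarrow> real" where
  "profile_kernel h k y = (if h = k then 1 else 0) / (real CARD('n) * norm y ^ CARD('n)) - y $ h * y $ k / norm y ^ (CARD('n) + 2)"

lemma sum_profile_kernel_diag: "(\<Sum>h\<in>UNIV. profile_kernel h h y) = 0"
proof (cases "y = 0")
  case True
  then show ?thesis by (simp add: profile_kernel_def)
next
  case False
  have "(\<Sum>h\<in>UNIV. profile_kernel h h y) = (\<Sum>h\<in>(UNIV :: 'a set). 1 / (real CARD('a) * norm y ^ CARD('a))) - (\<Sum>h\<in>UNIV. (y $ h)\<^sup>2) / norm y ^ (CARD('a) + 2)"
    by (simp add: profile_kernel_def sum_subtractf sum_divide_distrib power2_eq_square)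
  also have "\<dots> = 0"
    unfolding norm2_vec[symmetric] using False by (simp add: power_add power2_eq_square)
  finally show ?thesis .
qed

lemma profile_kernel_differentiable:
  assumes "x \<noteq> (0 :: real ^ 'n)"
  shows "profile_kernel h k differentiable (at x)"
proof -
  have n: "(norm :: real ^ 'n \<Rightarrow> real) differentiable (at x)"
    by (rule differentiable_norm_at[OF assms])
  have c: "(\<lambda>y::real ^ 'n. y $ i) differentiable (at x)" for i
    by (rule bounded_linear_imp_differentiable[OF bounded_linear_vec_nth])
  show ?thesis
    unfolding profile_kernel_def[abs_def] using assms
    by (intro differentiable_diff differentiable_divide differentiable_mult differentiable_power differentiable_const n c) auto
qed

text \<open>The profile is a finite combination of fixed kernels whose coefficients depend on time
  alone, so the gradient and the limit in time commute termwise.\<close>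

lemma grad_Pi_inf_eq:
  fixes u :: "real \<Rightarrow> real ^ 'n \<Rightarrow> real ^ 'n"
  assumes x: "x \<noteq> 0"
    and lim: "\<And>h k. ((\<lambda>t. LINT s:{0..t}|lebesgue. (LINT y|lebesgue. u s y $ h * u s y $ k)) \<longlongrightarrow> l h k) at_top"
  shows "grad_Pi_inf u x = (\<chi> i. gamma_const CARD('n) *
    (\<Sum>h\<in>UNIV. \<Sum>k\<in>UNIV. frechet_derivative (profile_kernel h k) (at x) (axis i 1) * l h k))"
proof -
  let ?D = "\<lambda>h k. frechet_derivative (profile_kernel h k) (at x)"
  let ?\<Lambda> = "\<lambda>h k t. LINT s:{0..t}|lebesgue. (LINT y|lebesgue. u s y $ h * u s y $ k)"
  have D: "(profile_kernel h k has_derivative ?D h k) (at x)" for h k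
    using profile_kernel_differentiable[OF x] frechet_derivative_works by blast
  have g: "gradient (\<lambda>y. Pi_profile u y t) x = (\<chi> i. gamma_const CARD('n) * (\<Sum>h\<in>UNIV. \<Sum>k\<in>UNIV. ?D h k (axis i 1) * ?\<Lambda> h k t))" for t
  proof -
    have "((\<lambda>y. gamma_const CARD('n) * (\<Sum>h\<in>UNIV. \<Sum>k\<in>UNIV. profile_kernel h k y * ?\<Lambda> h k t)) has_derivative
        (\<lambda>v. gamma_const CARD('n) * (\<Sum>h\<in>UNIV. \<Sum>k\<in>UNIV. ?D h k v * ?\<Lambda> h k t))) (at x)"
      by (intro has_derivative_mult_right has_derivative_sum has_derivative_mult_left D)
    then have "frechet_derivative (\<lambda>y. Pi_profile u y t) (at x) = (\<lambda>v. gamma_const CARD('n) * (\<Sum>h\<in>UNIV. \<Sum>k\<in>UNIV. ?D h k v * ?\<Lambda> h k t))"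
      unfolding Pi_profile_def profile_kernel_def[symmetric] by (rule frechet_derivative_at[symmetric])
    then show ?thesis by (simp add: gradient_def partial_def)
  qed
  have "((\<lambda>t. gradient (\<lambda>y. Pi_profile u y t) x) \<longlongrightarrow> (\<chi> i. gamma_const CARD('n) *
    (\<Sum>h\<in>UNIV. \<Sum>k\<in>UNIV. ?D h k (axis i 1) * l h k))) at_top"
    unfolding g by (intro tendsto_vec_lambda tendsto_mult tendsto_const tendsto_sum lim)
  then show ?thesis
    unfolding grad_Pi_inf_def by (intro tendsto_Lim) auto
qed

text \<open>The kernels satisfy \<open>\<Sum>h. profile_kernel h h = 0\<close>, so a scalar matrix of limits gives a vanishing profile.\<close>

lemma not_scalar_if_grad_Pi_inf:
  fixes u :: "real \<Rightarrow> real ^ 'n \<Rightarrow> real ^ 'n"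
  assumes x: "x \<noteq> 0" and grad: "grad_Pi_inf u x \<noteq> 0"
    and lim: "\<And>h k. ((\<lambda>t. LINT s:{0..t}|lebesgue. (LINT y|lebesgue. u s y $ h * u s y $ k)) \<longlongrightarrow> l h k) at_top"
  shows "\<exists>a b. a \<noteq> b \<and> (l a a \<noteq> l b b \<or> l a b \<noteq> 0)"
proof (rule ccontr)
  assume "\<nexists>a b. a \<noteq> b \<and> (l a a \<noteq> l b b \<or> l a b \<noteq> 0)"
  then have *: "l a a = l b b" "l a b = 0" if "a \<noteq> b" for a b
    using that by blast+
  \<comment> \<open>An arbitrary reference index; all diagonal entries equal
    \<open>l c c\<close>.\<close>
  obtain c :: 'n where True by simp
  have l: "l h k = (if h = k then l c c else 0)" for h k
    using * by (cases "h = k"; cases "h = c") auto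
  let ?D = "\<lambda>h k. frechet_derivative (profile_kernel h k) (at x)"
  have "((\<lambda>y. \<Sum>h\<in>UNIV. profile_kernel h h y) has_derivative (\<lambda>v. \<Sum>h\<in>UNIV. ?D h h v)) (at x)"
    using profile_kernel_differentiable[OF x] frechet_derivative_works by (intro has_derivative_sum) blast
  then have "((\<lambda>y::real ^ 'n. 0 :: real) has_derivative (\<lambda>v. \<Sum>h\<in>UNIV. ?D h h v)) (at x)"
    unfolding sum_profile_kernel_diag .
  then have "(\<lambda>v. \<Sum>h\<in>UNIV. ?D h h v) = (\<lambda>_. 0)"
    using has_derivative_unique has_derivative_const by blast
  then have z: "(\<Sum>h\<in>UNIV. ?D h h v) = 0" for v by (rule fun_cong)
  have "(\<Sum>h\<in>UNIV. \<Sum>k\<in>UNIV. ?D h k v * l h k) = (\<Sum>h\<in>UNIV. ?D h h v * l c c)" for v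
    by (intro sum.cong refl, subst l) (simp add: if_distrib cong: if_cong)
  then have "(\<Sum>h\<in>UNIV. \<Sum>k\<in>UNIV. ?D h k v * l h k) = 0" for v
    by (simp add: sum_distrib_right[symmetric] z)
  then have "grad_Pi_inf u x = 0"
    unfolding grad_Pi_inf_eq[OF x lim] by (simp add: vec_eq_iff)
  with grad show False by simp
qed

text \<open>A Borel version of the jointly measurable velocity agrees with it on almost every time
  slice, and setting it to 0 where the bound fails alters only null sets there.\<close>

lemma ex_flow_version:
  fixes u :: "real \<Rightarrow> real ^ 'n \<Rightarrow> real ^ 'n"
  assumes joint: "(\<lambda>(t, x). u t x) \<in> borel_measurable (lebesgue_on ({0..} \<times> UNIV))"
    and bound: "\<And>t. t > 0 \<Longrightarrow> AE x in lebesgue. (norm (u t x))\<^sup>2 \<le> K * (space_weight x * time_weight TYPE('n) t)"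
    and K: "K \<ge> 0" and card: "CARD('n) \<ge> 2"
  obtains f where "\<And>a b. a \<noteq> b \<Longrightarrow> flow f K a b"
    "AE s in lborel. s \<ge> 0 \<longrightarrow> (AE x in lborel. u s x = f s x)"
proof -
  let ?S = "{0..} \<times> UNIV :: (real \<times> (real ^ 'n)) set"
  have "closed ?S" by (intro closed_Times) auto
  then have "?S \<in> sets lebesgue" by (simp add: borel_closed)
  then have U: "(\<lambda>z. if z \<in> ?S then (\<lambda>(t, x). u t x) z else 0) \<in> borel_measurable lebesgue"
    by (rule borel_measurable_if_I[OF joint])
  obtain G where G: "G \<in> borel_measurable borel" and UG: "AE z in lborel. (if z \<in> ?S then (\<lambda>(t, x). u t x) z else 0) = G z"
    using ex_borel_version[OF U] by blast
  have "AE z in (lborel \<Otimes>\<^sub>M lborel). (if z \<in> ?S then (\<lambda>(t, x). u t x) z else 0) = G z"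
    using UG unfolding lborel_prod .
  from lborel_pair.AE_pair[OF this]
  have uG: "AE s in lborel. AE x in lborel. s \<ge> 0 \<longrightarrow> u s x = G (s, x)"
    by (auto elim!: eventually_mono)
  have [measurable]: "G \<in> borel_measurable (borel \<Otimes>\<^sub>M borel)"
    using G by (simp add: borel_prod)
  have [measurable]: "space_weight \<in> borel_measurable borel" "time_weight TYPE('n) \<in> borel_measurable borel"
    unfolding space_weight_def[abs_def] time_weight_def[abs_def] by measurable
  \<comment> \<open>The truncation condition is itself Borel, so measurability is kept while the
    bound becomes valid everywhere.\<close>
  define f where "f s x = (if s \<ge> 0 \<and> (norm (G (s, x)))\<^sup>2 \<le> K * (space_weight x * time_weight TYPE('n) s) then G (s, x) else 0)" for s x
  show ?thesis
  proof (rule that[of f])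
    fix a b :: 'n assume ab: "a \<noteq> b"
    show "flow f K a b"
    proof
      have "(\<lambda>z. G (fst z, snd z)) \<in> borel_measurable (borel \<Otimes>\<^sub>M borel)"
        by simp
      then show "(\<lambda>z. f (fst z) (snd z)) \<in> borel_measurable (borel \<Otimes>\<^sub>M borel)"
        unfolding f_def by measurable
      show "(norm (f s x))\<^sup>2 \<le> K * (space_weight x * time_weight TYPE('n) s)" for s x
        using K space_weight_props(2)[of x] time_weight_props(2)[OF card, of s] by (simp add: f_def)
    qed (use K card ab in auto)
  next
    show "AE s in lborel. s \<ge> 0 \<longrightarrow> (AE x in lborel. u s x = f s x)"
      \<comment> \<open>The a priori bound is available for positive times only, so the single time
        0 is discarded.\<close>
      using uG AE_lborel_singleton[of "0 :: real"]
    proof eventually_elim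
      case (elim s)
      show ?case
      proof
        assume s: "s \<ge> 0"
        have "AE x in lborel. (norm (u s x))\<^sup>2 \<le> K * (space_weight x * time_weight TYPE('n) s)"
          using bound[of s] s elim(2) by (simp add: AE_completion_iff)
        then show "AE x in lborel. u s x = f s x"
          using elim(1) by eventually_elim (use s in \<open>simp add: f_def\<close>)
      qed
    qed
  qed
qed

text \<open>Connects the Lebesgue integrals of \<open>u\<close> in the definition of the profile
  with the Borel integrals of \<open>f\<close> for which the limit is known.\<close>

lemma energy_integral_eq:
  fixes u f :: "real \<Rightarrow> real ^ 'n \<Rightarrow> real ^ 'n"
  assumes f: "(\<lambda>z. f (fst z) (snd z)) \<in> borel_measurable (borel \<Otimes>\<^sub>M borel)"
    and u: "\<And>t. t \<ge> 0 \<Longrightarrow> u t \<in> borel_measurable lebesgue"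
    and uf: "AE s in lborel. s \<ge> 0 \<longrightarrow> (AE x in lborel. u s x = f s x)"
  shows "(LINT s:{0..t}|lebesgue. (LINT y|lebesgue. u s y $ h * u s y $ k)) =
    (LINT s|lborel. indicator {0..t} s * (LINT y|lborel. f s y $ h * f s y $ k))"
proof -
  let ?g = "\<lambda>s. indicator {0..t} s * (LINT y|lborel. f s y $ h * f s y $ k)"
  have "(\<lambda>z. f (fst z) (snd z) $ h * f (fst z) (snd z) $ k) \<in> borel_measurable (lborel \<Otimes>\<^sub>M lborel)"
    using f by simp
  then have gm: "?g \<in> borel_measurable lborel"
    by (intro borel_measurable_times lborel.borel_measurable_lebesgue_integral) (simp_all add: case_prod_beta)
  have ae: "AE s in lborel. indicator {0..t} s *\<^sub>R (LINT y|lebesgue. u s y $ h * u s y $ k) = ?g s"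
    using uf
  proof eventually_elim
    case (elim s)
    show ?case
    proof (cases "s \<in> {0..t}")
      case True
      then have s: "s \<ge> 0" by simp
      have "(\<lambda>x. (s, x)) \<in> borel \<rightarrow>\<^sub>M (borel \<Otimes>\<^sub>M borel)" by measurable
      from measurable_compose[OF this f] have [measurable]: "f s \<in> borel_measurable borel" by simp
      have m: "(\<lambda>y. f s y $ h * f s y $ k) \<in> borel_measurable lborel" by measurable
      have "(LINT y|lebesgue. u s y $ h * u s y $ k) = (LINT y|lebesgue. f s y $ h * f s y $ k)"
      proof (rule integral_cong_AE)
        show "(\<lambda>y. u s y $ h * u s y $ k) \<in> borel_measurable lebesgue" using u[OF s] by measurable
        show "(\<lambda>y. f s y $ h * f s y $ k) \<in> borel_measurable lebesgue" by (rule measurable_completion[OF m])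
        have "AE y in lebesgue. u s y = f s y" using elim s by (auto intro: AE_completion)
        then show "AE y in lebesgue. u s y $ h * u s y $ k = f s y $ h * f s y $ k" by eventually_elim simp
      qed
      also have "\<dots> = (LINT y|lborel. f s y $ h * f s y $ k)" by (rule integral_completion[OF m])
      finally show ?thesis by simp
    qed simp
  qed
  have "(LINT s:{0..t}|lebesgue. (LINT y|lebesgue. u s y $ h * u s y $ k)) = (LINT s|lebesgue. ?g s)"
    unfolding set_lebesgue_integral_def
    by (intro integral_cong_AE completion_measurable_AE[OF ae gm] measurable_completion[OF gm] AE_completion[OF ae])
  also have "\<dots> = (LINT s|lborel. ?g s)" by (rule integral_completion[OF gm])
  finally show ?thesis .
qed

section \<open>Lower bounds for all weighted norms with a common constant\<close>

theorem corollary3p6: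
  fixes a :: "real ^ 'n \<Rightarrow> real ^ 'n"
    and u :: "real \<Rightarrow> real ^ 'n \<Rightarrow> real ^ 'n"
    and \<theta> :: real
  assumes "CARD('n) \<ge> 2"
    and "\<theta> > real CARD('n) + 1"
    and "a \<in> wLinf \<theta>"
    and "divergence_free a"
    and "mild_solution a u"
    and "\<exists>C0. \<forall>\<alpha> \<beta> t. 0 \<le> \<alpha> \<longrightarrow> 0 \<le> \<beta> \<longrightarrow> \<alpha> + \<beta> \<le> real CARD('n) + 1 \<longrightarrow> 0 < t \<longrightarrow>
           (AE x in lebesgue.
              norm (u t x) \<le> C0 * (1 + norm x) powr (- \<alpha>) * (1 + t) powr (- \<beta> / 2))"
    and "\<exists>x. x \<noteq> 0 \<and> grad_Pi_inf u x \<noteq> 0"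
  shows "\<exists>t0 c :: real. t0 > 0 \<and> c > 0 \<and>
           (\<forall>p \<alpha> t. 1 \<le> p \<longrightarrow> 0 \<le> \<alpha> \<longrightarrow> \<alpha> + real CARD('n) / p < real CARD('n) + 1 \<longrightarrow> t0 \<le> t \<longrightarrow>
              wLp_norm p \<alpha> (u t)
                \<ge> ennreal (c * t powr (- (real CARD('n) + 1 - \<alpha> - real CARD('n) / p) / 2))) \<and>
           (\<forall>\<alpha> t. 0 \<le> \<alpha> \<longrightarrow> \<alpha> \<le> real CARD('n) + 1 \<longrightarrow> t0 \<le> t \<longrightarrow>
              wLinf_norm \<alpha> (u t)
                \<ge> ennreal (c * t powr (- (real CARD('n) + 1 - \<alpha>) / 2)))"
proof -
  let ?d = "real CARD('n)"
  obtain C0 where C0: "\<And>\<alpha> \<beta> t. 0 \<le> \<alpha> \<Longrightarrow> 0 \<le> \<beta> \<Longrightarrow> \<alpha> + \<beta> \<le> ?d + 1 \<Longrightarrow> 0 < t \<Longrightarrow>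
      AE x in lebesgue. norm (u t x) \<le> C0 * (1 + norm x) powr (- \<alpha>) * (1 + t) powr (- \<beta> / 2)"
    using assms(6) by blast
  obtain x0 where x0: "x0 \<noteq> 0" "grad_Pi_inf u x0 \<noteq> 0" using assms(7) by blast
  define C where "C = \<bar>C0\<bar>"
  have C: "C \<ge> 0" by (simp add: C_def)
  have bound: "AE x in lebesgue. norm (u t x) \<le> C * ((1 + norm x) powr (- \<alpha>) * (1 + t) powr (- \<beta> / 2))"
    if "0 \<le> \<alpha>" "0 \<le> \<beta>" "\<alpha> + \<beta> \<le> ?d + 1" "0 < t" for \<alpha> \<beta> t
    using C0[OF that]
  proof eventually_elim
    case (elim x)
    have "C0 * ((1 + norm x) powr (- \<alpha>) * (1 + t) powr (- \<beta> / 2)) \<le> C * ((1 + norm x) powr (- \<alpha>) * (1 + t) powr (- \<beta> / 2))"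
      unfolding C_def by (intro mult_right_mono) auto
    then show ?case using elim by (simp add: mult.assoc)
  qed
  have time: "AE x in lebesgue. norm (u t x) \<le> C * (1 + t) powr (- (?d + 1) / 2)" if t: "t > 0" for t
    using bound[of 0 "?d + 1", OF _ _ _ t]
  proof (rule eventually_mono)
    fix x :: "real ^ 'n"
    have "1 + norm x \<noteq> 0" using norm_ge_zero[of x] by linarith
    then show "norm (u t x) \<le> C * ((1 + norm x) powr (- 0) * (1 + t) powr (- (?d + 1) / 2)) \<Longrightarrow> norm (u t x) \<le> C * (1 + t) powr (- (?d + 1) / 2)"
      by simp
  qed auto
  have space: "AE x in lebesgue. norm (u t x) \<le> C * (1 + norm x) powr (- (?d + 1))" if t: "t > 0" for t
    using bound[of "?d + 1" 0 t] t by simp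
  \<comment> \<open>The balanced case \<alpha> = \<beta> = (d + 1) / 2 of the a priori bound,
    squared.\<close>
  have bound2: "AE x in lebesgue. (norm (u t x))\<^sup>2 \<le> C\<^sup>2 * (space_weight x * time_weight TYPE('n) t)" if t: "t > 0" for t
  proof -
    have "AE x in lebesgue. norm (u t x) \<le> C * ((1 + norm x) powr (- ((?d + 1) / 2)) * (1 + t) powr (- ((?d + 1) / 2) / 2))"
      by (rule bound) (use t in \<open>auto simp: field_simps\<close>)
    then show ?thesis
    proof eventually_elim
      case (elim x)
      have "(norm (u t x))\<^sup>2 \<le> (C * ((1 + norm x) powr (- ((?d + 1) / 2)) * (1 + t) powr (- ((?d + 1) / 2) / 2)))\<^sup>2"
        by (rule power_mono[OF elim]) simp
      also have "\<dots> = C\<^sup>2 * (space_weight x * time_weight TYPE('n) t)"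
      proof -
        have "(y powr (- (q / 2)))\<^sup>2 = y powr (- q)" "(y powr (- (q / 2) / 2))\<^sup>2 = y powr (- (q / 2))" for y q :: real
          by (simp_all add: power2_eq_square powr_add[symmetric])
        then show ?thesis
          using t by (simp only: power_mult_distrib space_weight_def time_weight_def) simp
      qed
      finally show ?case .
    qed
  qed
  have joint: "(\<lambda>(t, x). u t x) \<in> borel_measurable (lebesgue_on ({0..} \<times> UNIV))"
    and um: "\<And>t. t \<ge> 0 \<Longrightarrow> u t \<in> borel_measurable lebesgue"
    and mild: "\<And>t. t > 0 \<Longrightarrow> AE x in lebesgue. \<forall>j. complex_of_real (u t x $ j) =
          heat t a x j - (LINT s:{0..t}|lebesgue. heat_leray_div (t - s) (u s) x j)"
    using assms(5) unfolding mild_solution_def by auto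
  obtain f where f: "\<And>a b. a \<noteq> b \<Longrightarrow> flow f (C\<^sup>2) a b"
    and uf: "AE s in lborel. s \<ge> 0 \<longrightarrow> (AE x in lborel. u s x = f s x)"
    using ex_flow_version[OF joint bound2 _ assms(1)] by auto
  \<comment> \<open>The matrix \<open>flow.energy f\<close> depends on \<open>f\<close> alone, but
    the locale facts about it require some pair of distinct indices; the pair that matters is found
    afterwards from this matrix.\<close>
  obtain a' b' :: 'n where "a' \<noteq> b'"
    using assms(1) by (metis One_nat_def card_2_iff' card_le_Suc0_iff_eq finite not_less_eq_eq numeral_2_eq_2 UNIV_I)
  note f' = f[OF this]
  have lim: "((\<lambda>t. LINT s:{0..t}|lebesgue. (LINT y|lebesgue. u s y $ h * u s y $ k)) \<longlongrightarrow> flow.energy f h k) at_top" for h k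
  proof -
    have "(\<lambda>t. LINT s:{0..t}|lebesgue. (LINT y|lebesgue. u s y $ h * u s y $ k)) =
        (\<lambda>t. LINT s|lborel. indicator {0..t} s * (LINT y|lborel. f s y $ h * f s y $ k))"
      by (rule ext, rule energy_integral_eq[OF flow.f_pair[OF f'] um uf])
    then show ?thesis
      using flow.energy_tendsto[OF f'] by (simp only:)
  qed
  obtain i j where ij: "i \<noteq> j" "flow.energy f i i \<noteq> flow.energy f j j \<or> flow.energy f i j \<noteq> 0"
    using not_scalar_if_grad_Pi_inf[OF x0 lim] by blast
  note flow = f[OF ij(1)]
  have am: "a \<in> borel_measurable lebesgue" and an: "wLinf_norm \<theta> a < \<infinity>"
    using assms(3) by (auto simp: wLinf_def)
  obtain N where N: "wLinf_norm \<theta> a = ennreal N" "N \<ge> 0" using an by (cases "wLinf_norm \<theta> a") auto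
  have ab: "AE x in lebesgue. norm (a x) \<le> N * (1 + norm x) powr (- \<theta>)"
    using esssup_AE[where M = lebesgue and f = "\<lambda>x. ennreal ((1 + norm x) powr \<theta> * norm (a x))"]
    unfolding wLinf_norm_def[symmetric] N(1)
  proof eventually_elim
    case (elim x)
    then have "(1 + norm x) powr \<theta> * norm (a x) \<le> N" using N(2) by simp
    moreover have "(1 + norm x) powr \<theta> > 0" using norm_ge_zero[of x] by (simp add: add_nonneg_eq_0_iff)
    ultimately show ?case by (simp add: powr_minus field_simps)
  qed
  note weak = flow.weak_asymptotics[OF flow um uf mild am ab assms(2)]
  obtain t0 \<epsilon> c where tc: "t0 > 0" "0 < \<epsilon>" "\<epsilon> \<le> 1" "c > 0"
    and low: "\<And>t. t \<ge> t0 \<Longrightarrow> ennreal (c / sqrt t) \<le>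
      (\<integral>\<^sup>+x. ennreal (norm (u t x)) * indicator {x. \<epsilon> * sqrt t \<le> norm x \<and> norm x \<le> sqrt t / \<epsilon>} x \<partial>lebesgue)"
    using annulus_lower_bound[OF ij(1) um weak flow.profile_limit_neq_0[OF flow ij(2)] time space C] by blast
  \<comment> \<open>The annulus lies in a ball of radius \<open>sqrt t / \<epsilon>\<close>, whose
    volume is at most \<open>V * t powr (d / 2)\<close> with d the dimension. The maximum with 1
    ensures \<open>V powr (1 / p) \<ge> 1\<close> for every p.\<close>
  define V where "V = max 1 (unit_ball_vol (real CARD('n)) / \<epsilon> ^ CARD('n))"
  have V: "V \<ge> 1" by (simp add: V_def)
  \<comment> \<open>Since \<epsilon> \<le> 1 and \<alpha> \<le> d + 1, the factor
    \<open>\<epsilon> powr \<alpha>\<close> from the inner radius is at least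
    \<open>\<epsilon> powr (d + 1)\<close>. This removes \<alpha> from the constant.\<close>
  define c' where "c' = \<epsilon> powr (?d + 1) * (c / (2 * V))"
  have c': "c' > 0" using tc V by (simp add: c'_def)
  let ?A = "\<lambda>t. {x::real ^ 'n. \<epsilon> * sqrt t \<le> norm x \<and> norm x \<le> sqrt t / \<epsilon>}"
  have vol: "emeasure lebesgue (?A t) \<le> ennreal (V * t powr (?d / 2))" if t: "t > 0" for t
  proof -
    have "emeasure lebesgue (?A t) \<le> emeasure lebesgue (cball (0 :: real ^ 'n) (sqrt t / \<epsilon>))"
      by (intro emeasure_mono) auto
    also have "\<dots> = ennreal (unit_ball_vol ?d * (sqrt t / \<epsilon>) ^ CARD('n))"
      using t tc by (simp add: emeasure_cball)
    also have "unit_ball_vol ?d * (sqrt t / \<epsilon>) ^ CARD('n) = unit_ball_vol ?d / \<epsilon> ^ CARD('n) * t powr (?d / 2)"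
      using t by (simp add: power_divide powr_half_sqrt[symmetric] powr_realpow[symmetric] powr_powr)
    also have "ennreal \<dots> \<le> ennreal (V * t powr (?d / 2))"
      by (intro ennreal_leI mult_right_mono) (auto simp: V_def)
    finally show ?thesis .
  qed
  have far: "\<epsilon> * sqrt t \<le> 1 + norm x" if "x \<in> ?A t" for x t using that by simp
  have eps: "c' \<le> \<epsilon> powr \<alpha> * (c / (2 * V))" if "\<alpha> \<le> ?d + 1" for \<alpha>
    unfolding c'_def using that tc V by (intro mult_right_mono powr_mono') auto
  have e1: "(\<epsilon> * sqrt t) powr \<alpha> * (c / sqrt t / (2 * (V * t powr (?d / 2)))) = \<epsilon> powr \<alpha> * (c / (2 * V)) * t powr (- (?d + 1 - \<alpha>) / 2)"
    if t: "t > 0" for t \<alpha>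
  proof -
    have "t powr (- (?d + 1 - \<alpha>) / 2) = t powr (\<alpha> / 2) / (t powr (1 / 2) * t powr (?d / 2))"
      unfolding powr_add[symmetric] powr_diff[symmetric] by (simp add: field_simps)
    then show ?thesis
      using t tc by (simp add: powr_mult powr_half_sqrt[symmetric] powr_powr mult_ac)
  qed
  have Lp: "ennreal (c' * t powr (- (?d + 1 - \<alpha> - ?d / p) / 2)) \<le> wLp_norm p \<alpha> (u t)"
    if p: "1 \<le> p" and \<alpha>: "0 \<le> \<alpha>" and lt: "\<alpha> + ?d / p < ?d + 1" and t: "t0 \<le> t" for p \<alpha> t
  proof -
    have t_pos: "t > 0" using tc t by simp
    have \<alpha>': "\<alpha> \<le> ?d + 1"
      using lt p divide_nonneg_nonneg[of ?d p] by linarith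
    \<comment> \<open>Mass \<open>c / sqrt t\<close>, volume \<open>V * t powr (d / 2)\<close> and
      inner radius \<open>\<epsilon> * sqrt t\<close>. Counting powers of \<open>t\<close> gives
      \<alpha>/2 from the weight, -(d + 1)/2 from the mean height and d/(2p) from the
      volume.\<close>
    have "ennreal ((\<epsilon> * sqrt t) powr \<alpha> * (c / sqrt t / (2 * (V * t powr (?d / 2)))) * (V * t powr (?d / 2)) powr (1 / p)) \<le> wLp_norm p \<alpha> (u t)"
      by (rule Lp_lower_bound[OF um annulus_sets low[OF t] vol[OF t_pos] _ _ far _ p \<alpha>]) (use tc V t_pos in auto)
    moreover have "c' * t powr (- (?d + 1 - \<alpha> - ?d / p) / 2) \<le>
        (\<epsilon> * sqrt t) powr \<alpha> * (c / sqrt t / (2 * (V * t powr (?d / 2)))) * (V * t powr (?d / 2)) powr (1 / p)"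
    proof -
      have V1: "1 \<le> V powr (1 / p)" using V p by (intro ge_one_powr_ge_zero) auto
      have "t powr (- (?d + 1 - \<alpha> - ?d / p) / 2) = t powr (- (?d + 1 - \<alpha>) / 2) * t powr (?d / 2 * (1 / p))"
      proof -
        have "- (?d + 1 - \<alpha> - ?d / p) / 2 = - (?d + 1 - \<alpha>) / 2 + ?d / 2 * (1 / p)"
          using p by (simp add: field_simps)
        then show ?thesis by (simp only: powr_add)
      qed
      then have "c' * t powr (- (?d + 1 - \<alpha> - ?d / p) / 2) = c' * t powr (- (?d + 1 - \<alpha>) / 2) * (1 * t powr (?d / 2 * (1 / p)))"
        by simp
      also have "\<dots> \<le> \<epsilon> powr \<alpha> * (c / (2 * V)) * t powr (- (?d + 1 - \<alpha>) / 2) * (V powr (1 / p) * t powr (?d / 2 * (1 / p)))"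
        using eps[OF \<alpha>'] V1 c' tc(4) V by (intro mult_mono mult_right_mono) auto
      also have "\<dots> = (\<epsilon> * sqrt t) powr \<alpha> * (c / sqrt t / (2 * (V * t powr (?d / 2)))) * (V * t powr (?d / 2)) powr (1 / p)"
        unfolding e1[OF t_pos] using V by (simp add: powr_mult powr_powr)
      finally show ?thesis .
    qed
    ultimately show ?thesis by (meson ennreal_leI order_trans)
  qed
  have Linf: "ennreal (c' * t powr (- (?d + 1 - \<alpha>) / 2)) \<le> wLinf_norm \<alpha> (u t)"
    if \<alpha>: "0 \<le> \<alpha>" "\<alpha> \<le> ?d + 1" and t: "t0 \<le> t" for \<alpha> t
  proof -
    have t_pos: "t > 0" using tc t by simp
    have "ennreal ((\<epsilon> * sqrt t) powr \<alpha> * (c / sqrt t / (V * t powr (?d / 2)))) \<le> wLinf_norm \<alpha> (u t)"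
      by (rule Linf_lower_bound[OF annulus_sets low[OF t] vol[OF t_pos] _ _ far _ \<alpha>(1)]) (use tc V t_pos in auto)
    \<comment> \<open>The supremum bound comes without the factor 1/2; it is weakened by that factor
      to share the constant with the integral norms.\<close>
    moreover have "c' * t powr (- (?d + 1 - \<alpha>) / 2) \<le> (\<epsilon> * sqrt t) powr \<alpha> * (c / sqrt t / (V * t powr (?d / 2)))"
    proof -
      have "c' * t powr (- (?d + 1 - \<alpha>) / 2) \<le> \<epsilon> powr \<alpha> * (c / (2 * V)) * t powr (- (?d + 1 - \<alpha>) / 2)"
        using eps[OF \<alpha>(2)] by (intro mult_right_mono) auto
      also have "\<dots> = (\<epsilon> * sqrt t) powr \<alpha> * (c / sqrt t / (2 * (V * t powr (?d / 2))))"
        by (rule e1[OF t_pos, symmetric])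
      also have "\<dots> \<le> (\<epsilon> * sqrt t) powr \<alpha> * (c / sqrt t / (V * t powr (?d / 2)))"
        using tc V t_pos by (intro mult_left_mono divide_left_mono) auto
      finally show ?thesis .
    qed
    ultimately show ?thesis by (meson ennreal_leI order_trans)
  qed
  show ?thesis
    using tc(1) c' Lp Linf by (intro exI[of _ t0] exI[of _ c']) auto
qed

end
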